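(* Let $M$ be a special Lagrangian submanifold of $\mathbb{C}^4$ with $SO(2)\rtimes S_3$-symmetry, with adapted local orthonormal frame $\{X_1,X_2,X_3,X_4\}$, and let $\mathcal{N}_1=\mathrm{span}\{X_1,X_2\}$. Suppose that $\mathcal{N}_1$ is an integrable distribution and that $\nabla_{X_1}X_1$ is nowhere contained in $\mathcal{N}_1$. Then $M$ is locally congruent to $$F(t,s,u,v)=(t,\,s\,\phi(u,v))\in\mathbb{C}\times\mathbb{C}^3,$$ where $\phi$ is the horizontal lift of a special Lagrangian submanifold of $\mathbb{C}P^2$ to the unit sphere $S^5\subset\mathbb{C}^3$.
   Context: Let $(N,J,g)$ be a Kähler manifold with Levi-Civita connection $D$ and $\omega(X,Y)=g(X,JY)$. A submanifold $M$ is Lagrangian if $\omega$ vanishes on $M$ and $\dim_{\mathbb{R}}M=\dim_{\mathbb{C}}N$. Its Levi-Civita connection $\nabla$ and its symmetric $(1,2)$-tensor $A$ are given by $D_XY=\nabla_XY+JA(X,Y)$. "Special Lagrangian" means Lagrangian and minimal, i.e. $\mathrm{Tr}(A(X,\cdot))=0$ for all $X$. A special Lagrangian 4-fold has $SO(2)\rtimes S_3$-symmetry if locally there is an orthonormal frame $\{X_1,X_2,X_3,X_4\}$ (the adapted frame) and a strictly positive function $r$ with $A(X_1,X_1)=rX_1$, $A(X_1,X_2)=A(X_2,X_1)=-rX_2$, $A(X_2,X_2)=-rX_1$, and $A(X_i,X_j)=0$ whenever $i\in\{3,4\}$ or $j\in\{3,4\}$. $\mathbb{C}^n$ carries its standard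 flat Kähler structure. $\mathbb{C}P^n$ is the quotient $S^{2n+1}/S^1$ of the unit sphere in $\mathbb{C}^{n+1}$, with the metric of constant holomorphic sectional curvature $4$ that makes the Hopf fibration $\pi$ a Riemannian submersion. A horizontal lift of a special Lagrangian submanifold of $\mathbb{C}P^n$ is an immersion $\phi$ into $S^{2n+1}$ with $i\phi$ orthogonal to the image of $d\phi$, which projects isometrically under $\pi$ onto that submanifold; such lifts are minimal C-totally real submanifolds of $S^{2n+1}$. *)

theory Defs
  imports "HOL-Analysis.Analysis"
begin

section \<open>Smooth maps and submanifolds of Euclidean spaces\<close>

primrec Ck_on :: "nat \<Rightarrow> 'a::euclidean_space set \<Rightarrow> ('a \<Rightarrow> 'b::euclidean_space) \<Rightarrow> bool" where
  "Ck_on 0 V f \<longleftrightarrow> continuous_on V f"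
| "Ck_on (Suc k) V f \<longleftrightarrow>
     (\<forall>x\<in>V. f differentiable (at x)) \<and> (\<forall>v. Ck_on k V (\<lambda>x. frechet_derivative f (at x) v))"

text \<open>Smoothness on an arbitrary subset: local extendability to \<open>C\<^sup>\<infinity>\<close> maps on open sets.
  For open \<open>S\<close> this is ordinary \<open>C\<^sup>\<infinity>\<close>-smoothness.\<close>

definition smooth_on :: "'a::euclidean_space set \<Rightarrow> ('a \<Rightarrow> 'b::euclidean_space) \<Rightarrow> bool" where
  "smooth_on S f \<longleftrightarrow>
     (\<forall>p\<in>S. \<exists>V F. open V \<and> p \<in> V \<and> (\<forall>k. Ck_on k V F) \<and> (\<forall>x\<in>V \<inter> S. F x = f x))"

definition immersion_on :: "'a::euclidean_space set \<Rightarrow> ('a \<Rightarrow> 'b::euclidean_space) \<Rightarrow> bool" where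
  "immersion_on U f \<longleftrightarrow>
     open U \<and> smooth_on U f \<and> (\<forall>x\<in>U. inj (frechet_derivative f (at x)))"

text \<open>Embedded \<open>n\<close>-dimensional submanifolds: locally diffeomorphic to open subsets of an
  \<open>n\<close>-dimensional vector space.  The latter is taken to be a subspace of the ambient space only in
  order to keep the dimension a number instead of a type.\<close>

definition submanifold :: "nat \<Rightarrow> 'e::euclidean_space set \<Rightarrow> bool" where
  "submanifold n M \<longleftrightarrow>
     (\<forall>p\<in>M. \<exists>W T U (f :: 'e \<Rightarrow> 'e) g.
        open W \<and> p \<in> W \<and> subspace T \<and> dim T = n \<and> openin (top_of_set T) U \<and>
        homeomorphism (M \<inter> W) U f g \<and> smooth_on (M \<inter> W) f \<and> smooth_on U g)"

definition tangent_space :: "'e::euclidean_space set \<Rightarrow> 'e \<Rightarrow> 'e set" where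
  "tangent_space M p =
     {v. \<exists>\<gamma> \<epsilon>. \<epsilon> > 0 \<and> smooth_on {-\<epsilon><..<\<epsilon>} \<gamma> \<and> \<gamma> ` {-\<epsilon><..<\<epsilon>} \<subseteq> M \<and> \<gamma> (0::real) = p \<and>
            (\<gamma> has_vector_derivative v) (at 0)}"

definition tangent_field :: "'e::euclidean_space set \<Rightarrow> ('e \<Rightarrow> 'e) \<Rightarrow> bool" where
  "tangent_field M Y \<longleftrightarrow> smooth_on M Y \<and> (\<forall>q\<in>M. Y q \<in> tangent_space M q)"

text \<open>A submanifold \<open>N\<close> of a Euclidean space carries the induced Riemannian metric; its Levi-Civita
  connection is the orthogonal projection to the tangent spaces (\<^const>\<open>closest_point\<close>) of the flat
  derivative. For a tangent field \<open>Y\<close> of a submanifold \<open>M \<subseteq> N\<close> and \<open>x\<close> tangent to \<open>M\<close>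
  at \<open>p\<close>, \<open>cov_deriv N M Y p x\<close> is \<open>D\<^sub>x Y\<close> for the Levi-Civita connection \<open>D\<close> of \<open>N\<close>; in
  particular \<open>cov_deriv M M\<close> is the Levi-Civita connection \<open>\<nabla>\<close> of \<open>M\<close>. A derivative within \<open>M\<close> is
  determined only on vectors tangent to \<open>M\<close>; it is used for such \<open>x\<close> only.\<close>

definition cov_deriv ::
  "'e::euclidean_space set \<Rightarrow> 'e set \<Rightarrow> ('e \<Rightarrow> 'e) \<Rightarrow> 'e \<Rightarrow> 'e \<Rightarrow> 'e" where
  "cov_deriv N M Y p x =
     closest_point (tangent_space N p) (frechet_derivative Y (at p within M) x)"

text \<open>A distribution \<open>E\<close> of rank \<open>k\<close> on \<open>M\<close> is integrable if there is an integral manifold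
  through every point.\<close>

definition integrable_distribution ::
  "nat \<Rightarrow> 'e::euclidean_space set \<Rightarrow> ('e \<Rightarrow> 'e set) \<Rightarrow> bool" where
  "integrable_distribution k M E \<longleftrightarrow>
     (\<forall>p\<in>M. \<exists>S. submanifold k S \<and> p \<in> S \<and> S \<subseteq> M \<and> (\<forall>q\<in>S. tangent_space S q = E q))"


section \<open>Special Lagrangian submanifolds\<close>

text \<open>Throughout, the Kaehler manifold \<open>(N, J, g)\<close> is a submanifold \<open>N\<close> of a Euclidean space with
  the induced metric \<open>g\<close>; \<open>J p\<close> is the complex structure on \<^term>\<open>tangent_space N p\<close>.\<close>

definition lagrangian ::
  "'e::euclidean_space set \<Rightarrow> ('e \<Rightarrow> 'e \<Rightarrow> 'e) \<Rightarrow> 'e set \<Rightarrow> bool" where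
  "lagrangian N J M \<longleftrightarrow>
     M \<subseteq> N \<and> (\<exists>n. submanifold (2 * n) N \<and> submanifold n M) \<and>
     (\<forall>p\<in>M. \<forall>x\<in>tangent_space M p. \<forall>y\<in>tangent_space M p. inner x (J p y) = 0)"

text \<open>\<open>lagr_A N J M p x y\<close> is the value at \<open>p\<close> of the tensor \<open>A\<close> with
  \<open>D\<^sub>X Y = \<nabla>\<^sub>X Y + J A(X,Y)\<close>; \<open>Y\<close> ranges over the local extensions of \<open>y\<close> to a tangent
  field of \<open>M\<close>.\<close>

definition lagr_A ::
  "'e::euclidean_space set \<Rightarrow> ('e \<Rightarrow> 'e \<Rightarrow> 'e) \<Rightarrow> 'e set \<Rightarrow> 'e \<Rightarrow> 'e \<Rightarrow> 'e \<Rightarrow> 'e" where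
  "lagr_A N J M p x y =
     (THE a. a \<in> tangent_space M p \<and>
        (\<forall>W Y. open W \<and> p \<in> W \<and> tangent_field (M \<inter> W) Y \<and> Y p = y \<longrightarrow>
           cov_deriv N M Y p x = cov_deriv M M Y p x + J p a))"

definition orthonormal_basis_of :: "'e::euclidean_space set \<Rightarrow> 'e set \<Rightarrow> bool" where
  "orthonormal_basis_of T B \<longleftrightarrow>
     B \<subseteq> T \<and> span B = T \<and> pairwise orthogonal B \<and> (\<forall>b\<in>B. norm b = 1)"

definition special_lagrangian ::
  "'e::euclidean_space set \<Rightarrow> ('e \<Rightarrow> 'e \<Rightarrow> 'e) \<Rightarrow> 'e set \<Rightarrow> bool" where
  "special_lagrangian N J M \<longleftrightarrow>
     lagrangian N J M \<and>
     (\<forall>p\<in>M. \<forall>x\<in>tangent_space M p. \<forall>B. orthonormal_basis_of (tangent_space M p) B \<longrightarrow>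
        (\<Sum>b\<in>B. inner (lagr_A N J M p x b) b) = 0)"

text \<open>An adapted frame \<open>X 1, \<dots>, X 4\<close> of \<open>M\<close> on \<open>M \<inter> W\<close>; a special Lagrangian 4-fold has
  \<open>SO(2) \<rtimes> S\<^sub>3\<close>-symmetry if it has such a frame near every point.\<close>

definition adapted_frame ::
  "'e::euclidean_space set \<Rightarrow> ('e \<Rightarrow> 'e \<Rightarrow> 'e) \<Rightarrow> 'e set \<Rightarrow> 'e set \<Rightarrow>
   (nat \<Rightarrow> 'e \<Rightarrow> 'e) \<Rightarrow> ('e \<Rightarrow> real) \<Rightarrow> bool" where
  "adapted_frame N J M W X r \<longleftrightarrow>
     (\<forall>i\<in>{1..4}. tangent_field (M \<inter> W) (X i)) \<and>
     (\<forall>q\<in>M \<inter> W.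
        (\<forall>i\<in>{1..4}. \<forall>j\<in>{1..4}. inner (X i q) (X j q) = (if i = j then 1 else 0)) \<and>
        r q > 0 \<and>
        lagr_A N J M q (X 1 q) (X 1 q) = r q *\<^sub>R X 1 q \<and>
        lagr_A N J M q (X 1 q) (X 2 q) = - r q *\<^sub>R X 2 q \<and>
        lagr_A N J M q (X 2 q) (X 1 q) = - r q *\<^sub>R X 2 q \<and>
        lagr_A N J M q (X 2 q) (X 2 q) = - r q *\<^sub>R X 1 q \<and>
        (\<forall>i\<in>{1..4}. \<forall>j\<in>{1..4}. i \<in> {3,4} \<or> j \<in> {3,4} \<longrightarrow>
           lagr_A N J M q (X i q) (X j q) = 0))"


section \<open>The flat space \<open>\<complex>\<^sup>n\<close>\<close>

definition std_J :: "complex^'n::finite \<Rightarrow> complex^'n \<Rightarrow> complex^'n" where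
  "std_J p v = \<i> *s v"

definition unitary_congruence :: "(complex^'n::finite \<Rightarrow> complex^'n) \<Rightarrow> bool" where
  "unitary_congruence G \<longleftrightarrow>
     (\<exists>L b. orthogonal_transformation L \<and> (\<forall>c v. L (c *s v) = c *s L v) \<and> G = (\<lambda>z. L z + b))"


section \<open>Complex projective space\<close>

text \<open>The orbit of the unit vector \<open>z\<close> under \<open>S\<^sup>1\<close> is represented by the Hermitian matrix
  \<open>z z\<^sup>* / \<surd>2\<close>. The lemmas \<open>hopf_eq_iff\<close>, \<open>hopf_deriv_vertical\<close> and \<open>hopf_deriv_isometric\<close>
  below say that, on the unit sphere, the fibres of \<open>hopf\<close> are exactly the \<open>S\<^sup>1\<close>-orbits, and that
  \<open>hopf\<close> is a Riemannian submersion onto its image with the metric induced from the space of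
  matrices. Thus \<open>CP\<close> is isometric to \<open>S\<^sup>2\<^sup>n\<^sup>+\<^sup>1/S\<^sup>1\<close>, with holomorphic sectional curvature 4.\<close>

definition outer :: "complex^'n::finite \<Rightarrow> complex^'n \<Rightarrow> complex^'n^'n" where
  "outer v w = (\<chi> i j. v$i * cnj (w$j))"

definition hopf :: "complex^'n::finite \<Rightarrow> complex^'n^'n" where
  "hopf z = (1 / sqrt 2) *\<^sub>R outer z z"

definition CP :: "(complex^'n::finite^'n) set" where
  "CP = hopf ` sphere 0 1"

definition horizontal :: "complex^'n::finite \<Rightarrow> (complex^'n) set" where
  "horizontal z = {v. inner v z = 0 \<and> inner v (\<i> *s z) = 0}"

text \<open>The complex structure for which \<open>d\<pi>\<close> is complex linear on horizontal spaces;
  cf. lemma \<open>CP_J_hopf\<close>.\<close>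

definition CP_J :: "complex^'n::finite^'n \<Rightarrow> complex^'n^'n \<Rightarrow> complex^'n^'n" where
  "CP_J P V =
     (THE W. \<exists>z v. norm z = 1 \<and> hopf z = P \<and> v \<in> horizontal z \<and>
        frechet_derivative hopf (at z) v = V \<and> W = frechet_derivative hopf (at z) (\<i> *s v))"

text \<open>\<open>\<phi>\<close>, defined on the open set \<open>U\<close>, is a horizontal lift of \<open>L \<subseteq> CP\<close> to the unit sphere.\<close>

definition horizontal_lift ::
  "'a::euclidean_space set \<Rightarrow> ('a \<Rightarrow> complex^'n::finite) \<Rightarrow> (complex^'n^'n) set \<Rightarrow> bool" where
  "horizontal_lift U \<phi> L \<longleftrightarrow>
     immersion_on U \<phi> \<and> \<phi> ` U \<subseteq> sphere 0 1 \<and>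
     (\<forall>x\<in>U. \<forall>v. inner (\<i> *s \<phi> x) (frechet_derivative \<phi> (at x) v) = 0) \<and>
     inj_on (hopf \<circ> \<phi>) U \<and> (hopf \<circ> \<phi>) ` U = L \<and>
     (\<forall>x\<in>U. \<forall>v w.
        inner (frechet_derivative (hopf \<circ> \<phi>) (at x) v) (frechet_derivative (hopf \<circ> \<phi>) (at x) w)
      = inner (frechet_derivative \<phi> (at x) v) (frechet_derivative \<phi> (at x) w))"

lemma bounded_bilinear_outer: "bounded_bilinear (outer :: complex^'n::finite \<Rightarrow> _)"
  unfolding bilinear_conv_bounded_bilinear[symmetric] bilinear_def
  by (auto intro!: linearI simp: outer_def vec_eq_iff algebra_simps)

lemma frechet_derivative_hopf:
  "frechet_derivative hopf (at z) v = (1 / sqrt 2) *\<^sub>R (outer z v + outer v z)"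
proof -
  have "((\<lambda>z. outer z z) has_derivative (\<lambda>v. outer z v + outer v z)) (at z)"
    by (rule bounded_bilinear.FDERIV[OF bounded_bilinear_outer has_derivative_ident
          has_derivative_ident])
  from has_derivative_scaleR_right[OF this, of "1 / sqrt 2"]
  have "(hopf has_derivative (\<lambda>v. (1 / sqrt 2) *\<^sub>R (outer z v + outer v z))) (at z)"
    unfolding hopf_def[abs_def] .
  from frechet_derivative_at[OF this, symmetric] show ?thesis by (rule fun_cong)
qed

lemma inner_complex_vec:
  "inner v w = Re (\<Sum>i\<in>UNIV. v$i * cnj (w$i))" for v w :: "complex^'n::finite"
  by (simp add: inner_vec_def inner_complex_def)

lemma inner_outer:
  "inner (outer a b) (outer c d) =
     Re ((\<Sum>i\<in>UNIV. a$i * cnj (c$i)) * cnj (\<Sum>j\<in>UNIV. b$j * cnj (d$j)))"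
proof -
  have "inner (outer a b) (outer c d) =
      Re (\<Sum>i\<in>UNIV. \<Sum>j\<in>UNIV. (a$i * cnj (c$i)) * cnj (b$j * cnj (d$j)))"
    by (simp add: inner_vec_def outer_def inner_complex_def algebra_simps)
  then show ?thesis by (simp only: cnj_sum sum_product)
qed

lemma horizontal_hermitian:
  assumes "v \<in> horizontal z"
  shows "(\<Sum>i\<in>UNIV. v$i * cnj (z$i)) = 0"
proof (rule complex_eqI)
  show "Re (\<Sum>i\<in>UNIV. v$i * cnj (z$i)) = Re 0"
    using assms by (simp add: horizontal_def inner_complex_vec)
  have "inner v (\<i> *s z) = Im (\<Sum>i\<in>UNIV. v$i * cnj (z$i))"
    by (simp add: inner_complex_vec)
  then show "Im (\<Sum>i\<in>UNIV. v$i * cnj (z$i)) = Im 0"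
    using assms by (simp add: horizontal_def)
qed

lemma hermitian_self:
  "(\<Sum>i\<in>UNIV. z$i * cnj (z$i)) = complex_of_real ((norm z)\<^sup>2)" for z :: "complex^'n::finite"
proof (rule complex_eqI)
  show "Re (\<Sum>i\<in>UNIV. z$i * cnj (z$i)) = Re (complex_of_real ((norm z)\<^sup>2))"
    by (simp only: inner_complex_vec[symmetric] power2_norm_eq_inner Re_complex_of_real)
qed (simp add: algebra_simps)

lemma hopf_eq_iff:
  assumes "norm z = 1" "norm w = 1"
  shows "hopf z = hopf w \<longleftrightarrow> (\<exists>c. norm c = 1 \<and> w = c *s z)"
proof
  assume "hopf z = hopf w"
  then have eq: "z$i * cnj (z$j) = w$i * cnj (w$j)" for i j
    by (simp add: hopf_def outer_def vec_eq_iff)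
  define c where "c = (\<Sum>j\<in>UNIV. w$j * cnj (z$j))"
  have "w$i = c * z$i" for i
  proof -
    have "w$i * (\<Sum>j\<in>UNIV. w$j * cnj (w$j)) = (\<Sum>j\<in>UNIV. w$j * (w$i * cnj (w$j)))"
      by (simp add: sum_distrib_left algebra_simps)
    also have "\<dots> = (\<Sum>j\<in>UNIV. w$j * (z$i * cnj (z$j)))" by (simp only: eq)
    also have "\<dots> = c * z$i" by (simp add: c_def sum_distrib_left algebra_simps)
    finally show ?thesis using assms by (simp add: hermitian_self)
  qed
  then have w: "w = c *s z" by (simp add: vec_eq_iff)
  have "complex_of_real ((norm w)\<^sup>2) = c * cnj c * complex_of_real ((norm z)\<^sup>2)"
    unfolding hermitian_self[symmetric] w by (simp add: sum_distrib_left algebra_simps)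
  then have "complex_of_real ((norm c)\<^sup>2) = complex_of_real 1"
    using assms by (simp only: complex_norm_square[of c]) simp
  then have "(norm c)\<^sup>2 = 1" by (simp only: of_real_eq_iff)
  then have "norm c = 1" using norm_ge_zero[of c] by (simp add: power2_eq_1_iff)
  with w show "\<exists>c. norm c = 1 \<and> w = c *s z" by blast
next
  assume "\<exists>c. norm c = 1 \<and> w = c *s z"
  then obtain c where c: "norm c = 1" "w = c *s z" by blast
  have "c * cnj c = 1" using c(1) by (metis complex_norm_square of_real_1 one_power2)
  then have "c * z$i * cnj (c * z$j) = z$i * cnj (z$j)" for i j
    by (metis (no_types, lifting) complex_cnj_mult mult.assoc mult.commute mult.left_neutral)
  then show "hopf z = hopf w" by (simp only: hopf_def outer_def c(2) vector_smult_component)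
qed

lemma hopf_deriv_vertical: "frechet_derivative hopf (at z) (\<i> *s z) = 0"
  by (simp add: frechet_derivative_hopf outer_def vec_eq_iff)

lemma hopf_deriv_isometric:
  assumes "norm z = 1" "v \<in> horizontal z" "w \<in> horizontal z"
  shows "inner (frechet_derivative hopf (at z) v) (frechet_derivative hopf (at z) w) = inner v w"
proof -
  have h: "(\<Sum>i\<in>UNIV. v$i * cnj (z$i)) = 0" "(\<Sum>i\<in>UNIV. w$i * cnj (z$i)) = 0"
    using assms horizontal_hermitian by blast+
  have n: "(\<Sum>i\<in>UNIV. z$i * cnj (z$i)) = 1"
    using assms(1) by (simp only: hermitian_self) simp
  have "inner (outer z v + outer v z) (outer z w + outer w z) = 2 * Re (\<Sum>i\<in>UNIV. v$i * cnj (w$i))"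
    unfolding inner_add_left inner_add_right inner_outer h n
    by (simp only: mult_zero_right mult_zero_left mult_1_left mult_1_right complex_cnj_zero
        complex_cnj_one complex_cnj_cnj cnj.sel zero_complex.sel add_0_left add_0_right mult_2)
  then have "inner (outer z v + outer v z) (outer z w + outer w z) = 2 * inner v w"
    unfolding inner_complex_vec .
  then show ?thesis by (simp add: frechet_derivative_hopf)
qed

lemma CP_J_hopf:
  assumes "norm z = 1" "v \<in> horizontal z"
  shows "CP_J (hopf z) (frechet_derivative hopf (at z) v) = frechet_derivative hopf (at z) (\<i> *s v)"
  unfolding CP_J_def
proof (rule the_equality)
  show "\<exists>z' v'. norm z' = 1 \<and> hopf z' = hopf z \<and> v' \<in> horizontal z' \<and>
      frechet_derivative hopf (at z') v' = frechet_derivative hopf (at z) v \<and>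
      frechet_derivative hopf (at z) (\<i> *s v) = frechet_derivative hopf (at z') (\<i> *s v')"
    using assms by blast
next
  \<comment> \<open>in terms of matrices the complex structure is \<open>V \<mapsto> \<i> \<surd>2 (V P - P V)\<close>\<close>
  have key: "frechet_derivative hopf (at z) (\<i> *s v) = (\<chi> i j. \<i> * of_real (sqrt 2) *
      ((frechet_derivative hopf (at z) v ** hopf z - hopf z ** frechet_derivative hopf (at z) v)$i$j))"
    if z: "norm z = 1" and v: "v \<in> horizontal z" for z v :: "complex^'n"
  proof -
    have h: "(\<Sum>i\<in>UNIV. v$i * cnj (z$i)) = 0" using v by (rule horizontal_hermitian)
    have "cnj (\<Sum>i\<in>UNIV. v$i * cnj (z$i)) = (\<Sum>i\<in>UNIV. cnj (v$i) * z$i)" by simp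
    with h have h': "(\<Sum>i\<in>UNIV. cnj (v$i) * z$i) = 0" by simp
    have n: "(\<Sum>i\<in>UNIV. cnj (z$i) * z$i) = 1"
      using hermitian_self[of z] z by (simp add: mult.commute)
    have mm: "outer a b ** outer c d = (\<chi> i j. a$i * (\<Sum>k\<in>UNIV. cnj (b$k) * c$k) * cnj (d$j))"
      for a b c d :: "complex^'n"
      by (simp add: outer_def matrix_matrix_mult_def vec_eq_iff sum_distrib_left sum_distrib_right
          mult.assoc)
    have h'': "(\<Sum>i\<in>UNIV. cnj (z$i) * v$i) = 0" using h by (simp add: mult.commute)
    have dist': "(a *\<^sub>R A) ** (a *\<^sub>R B) = (a * a) *\<^sub>R (A ** B)"
      for A B :: "complex^'n^'n" and a
      by (simp add: matrix_matrix_mult_def vec_eq_iff scaleR_sum_right)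
    have dist: "((1 / sqrt 2) *\<^sub>R A) ** ((1 / sqrt 2) *\<^sub>R B) = (1 / 2) *\<^sub>R (A ** B)"
      for A B :: "complex^'n^'n"
      unfolding dist' by simp
    have s: "complex_of_real (sqrt 2) * ((1 / 2) *\<^sub>R x) = (1 / sqrt 2) *\<^sub>R x" for x :: complex
    proof -
      have "complex_of_real (sqrt 2) * ((1 / 2) *\<^sub>R x) = (sqrt 2 * (1 / 2)) *\<^sub>R x"
        by (simp add: scaleR_conv_of_real)
      also have "sqrt 2 * (1 / 2) = 1 / sqrt 2" by (simp add: real_div_sqrt)
      finally show ?thesis .
    qed
    have add: "(A + B) ** C = A ** C + B ** C" "C ** (A + B) = C ** A + C ** B"
      for A B C :: "complex^'n^'n"
      by (simp_all add: matrix_matrix_mult_def vec_eq_iff distrib_left distrib_right sum.distrib)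
    let ?P = "outer z z" and ?V = "outer z v + outer v z"
    have VP: "?V ** ?P = outer v z" and PV: "?P ** ?V = outer z v"
      by (simp_all only: add mm h h' h'' n)
         (simp_all add: outer_def vec_eq_iff)
    show ?thesis
      unfolding frechet_derivative_hopf hopf_def dist VP PV
        scaleR_right_diff_distrib[symmetric] vector_scaleR_component mult.assoc s
      by (simp add: vec_eq_iff outer_def algebra_simps)
  qed
  fix W
  assume "\<exists>z' v'. norm z' = 1 \<and> hopf z' = hopf z \<and> v' \<in> horizontal z' \<and>
      frechet_derivative hopf (at z') v' = frechet_derivative hopf (at z) v \<and>
      W = frechet_derivative hopf (at z') (\<i> *s v')"
  then obtain z' v' where z': "norm z' = 1" "v' \<in> horizontal z'" and
    eq: "hopf z' = hopf z" "frechet_derivative hopf (at z') v' = frechet_derivative hopf (at z) v" and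
    W: "W = frechet_derivative hopf (at z') (\<i> *s v')" by blast
  show "W = frechet_derivative hopf (at z) (\<i> *s v)"
    unfolding W key[OF z'] key[OF assms] eq ..
qed


section \<open>The model immersion\<close>

definition cone_times_line ::
  "(real \<times> real \<Rightarrow> complex^3) \<Rightarrow> real \<times> real \<times> real \<times> real \<Rightarrow> complex^4" where
  "cone_times_line \<phi> = (\<lambda>(t, s, u, v). vector [of_real t,
     of_real s * \<phi> (u, v) $ 1, of_real s * \<phi> (u, v) $ 2, of_real s * \<phi> (u, v) $ 3])"

lemma cone_times_line_nth:
  "cone_times_line \<phi> (t, s, u, v) $ 1 = of_real t"
  "cone_times_line \<phi> (t, s, u, v) $ 2 = of_real s * \<phi> (u, v) $ 1"
  "cone_times_line \<phi> (t, s, u, v) $ 3 = of_real s * \<phi> (u, v) $ 2"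
  "cone_times_line \<phi> (t, s, u, v) $ 4 = of_real s * \<phi> (u, v) $ 3"
  by (simp_all add: cone_times_line_def vector_def)

end

theory Submission
  imports Defs
begin

text \<open>Why the theorem holds.  Write \<open>N\<^sub>1 = span {X 1, X 2}\<close> and \<open>N\<^sub>2 = span {X 3, X 4}\<close>; \<open>N\<^sub>2\<close> is the
  kernel of the tensor \<open>A\<close>, and on \<open>N\<^sub>1\<close> the form \<open>A\<close> is trace free and nowhere zero.

  For a section \<open>T\<close> of \<open>N\<^sub>2\<close> the derivative \<open>D\<^sub>x T\<close> is tangent to \<open>M\<close>.  Differentiating this once more and
  using that second derivatives of maps into the flat space \<open>\<complex>\<^sup>4\<close> are symmetric gives the Codazzi equation
  \<open>A(x, D\<^sub>y T) = A(y, D\<^sub>x T)\<close> (lemma \<open>codazzi\<close>).  Linear algebra then shows that \<open>N\<^sub>2\<close> is parallel along its own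
  directions and that the \<open>N\<^sub>1\<close>-component of \<open>D\<^sub>x T\<close> for \<open>x \<in> N\<^sub>1\<close> is a homothety followed by a rotation.
  Integrability of \<open>N\<^sub>1\<close> makes this map symmetric and so removes the rotation: the component is
  \<open>- \<lambda>(T) x\<close> for a linear form \<open>\<lambda>\<close> on \<open>N\<^sub>2\<close> (lemma \<open>kernel_derivative\<close>).  Since \<open>\<lambda>\<close> is given by the
  \<open>N\<^sub>2\<close>-component of \<open>\<nabla>\<^bsub>X 1\<^esub> X 1\<close>, the second hypothesis on the frame says that it vanishes nowhere.

  The same symmetry argument shows that a map \<open>f\<close> on \<open>M\<close> whose differential takes values in \<open>N\<^sub>2\<close> satisfies
  \<open>\<lambda>(df) = 0\<close> (lemma \<open>kernel_valued_derivative\<close>).  It is used twice.  For the unit section \<open>e\<close> of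
  \<open>ker \<lambda>\<close> it gives \<open>de = 0\<close>, so \<open>e\<close> is a constant vector.  For the focal point \<open>q + Z\<close>, where \<open>Z \<in> N\<^sub>2\<close> is
  orthogonal to \<open>e\<close> with \<open>\<lambda>(Z) = 1\<close>, it says that the focal point moves along \<open>e\<close> only.  Hence all focal
  points lie on one line \<open>c + \<real> e\<close>, and at each \<open>q \<in> M\<close> both \<open>e\<close> and the vector from this line to \<open>q\<close> are
  tangent to \<open>M\<close> (lemma \<open>local_cone_structure\<close>).

  A uniqueness argument for the flow of these two fields shows that \<open>M\<close> contains straight segments in their
  directions, of a length that is bounded below (lemma \<open>ruled_segments\<close>).  Sweeping an integral surface of
  \<open>N\<^sub>1\<close> along them gives the model immersion, whose image is open in \<open>M\<close> by invariance of domain.  Height and distance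
  with respect to the line are constant on the integral surface, so that up to scale it is a surface \<open>\<phi>\<close> in
  \<open>S\<^sup>5\<close>.  It is horizontal because \<open>M\<close> is Lagrangian and contains the radial directions.  The second fundamental
  tensor of its projection to the projective plane is that of \<open>M\<close> restricted to \<open>N\<^sub>1\<close>, up to scale, and
  therefore has trace zero (locale \<open>horizontal_surface\<close>, lemma \<open>\<phi>_minimal\<close>).

  All derivatives are taken in the ambient space: near a point a submanifold \<open>M\<close> is the fixed point set of a
  smooth retraction \<open>\<rho>\<close>, its tangent spaces are the fixed spaces of \<open>d\<rho>\<close>, and a map \<open>f\<close> on \<open>M\<close> is replaced by
  \<open>f \<circ> \<rho>\<close>.\<close>

section \<open>Smooth maps between Euclidean spaces\<close>

lemma Ck_on_subset: "Ck_on k V f \<Longrightarrow> U \<subseteq> V \<Longrightarrow> Ck_on k U f"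
  by (induction k arbitrary: f) (auto intro: continuous_on_subset)

lemma frechet_derivative_cong_open:
  assumes "open V" "x \<in> V" "\<And>y. y \<in> V \<Longrightarrow> f y = g y"
  shows "frechet_derivative f (at x) = frechet_derivative g (at x)"
proof -
  have "(f has_derivative D) (at x) \<longleftrightarrow> (g has_derivative D) (at x)" for D
    by (rule iffI; erule has_derivative_transform_within_open[OF _ assms(1,2)]) (simp_all add: assms(3))
  then show ?thesis by (simp add: frechet_derivative_def)
qed

lemma Ck_on_cong:
  assumes "open V" "\<And>y. y \<in> V \<Longrightarrow> f y = g y" "Ck_on k V f"
  shows "Ck_on k V g"
  using assms(2,3)
proof (induction k arbitrary: f g)
  case 0 then show ?case using continuous_on_eq[of V f g] by auto
next
  case (Suc k)
  have "g differentiable (at x)" if "x \<in> V" for x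
    using Suc.prems(2) that has_derivative_transform_within_open[OF _ assms(1) that, of f _ UNIV g,
        OF _ Suc.prems(1)]
    unfolding Ck_on.simps differentiable_def by blast
  moreover have "Ck_on k V (\<lambda>x. frechet_derivative g (at x) v)" for v
    by (rule Suc.IH[of "\<lambda>x. frechet_derivative f (at x) v"])
      (use Suc.prems frechet_derivative_cong_open[OF assms(1) _ Suc.prems(1)] in auto)
  ultimately show ?case by simp
qed

text \<open>Regularity is usually proved by induction on the order; this is the induction step for a map with an
  explicit derivative, without reference to \<^const>\<open>frechet_derivative\<close>.\<close>

lemma Ck_on_SucI:
  assumes "open V" "\<And>x. x \<in> V \<Longrightarrow> (f has_derivative D x) (at x)"
    "\<And>v. Ck_on k V (\<lambda>x. D x v)"
  shows "Ck_on (Suc k) V f"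
proof -
  have "Ck_on k V (\<lambda>x. frechet_derivative f (at x) v)" for v
    by (rule Ck_on_cong[OF assms(1) _ assms(3)[of v]])
      (use assms(2) frechet_derivative_at in metis)
  then show ?thesis using assms(2) by (auto simp: differentiable_def)
qed

lemma Ck_on_SucD:
  assumes "Ck_on (Suc k) V f"
  shows "x \<in> V \<Longrightarrow> (f has_derivative frechet_derivative f (at x)) (at x)"
    "Ck_on k V (\<lambda>x. frechet_derivative f (at x) v)"
  using assms by (auto simp: frechet_derivative_works[symmetric])

lemma Ck_on_continuous: "Ck_on k V f \<Longrightarrow> continuous_on V f"
  by (cases k) (auto intro!: continuous_at_imp_continuous_on differentiable_imp_continuous_within)

lemma Ck_on_Suc_mono: "Ck_on (Suc k) V f \<Longrightarrow> Ck_on k V f"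
proof (induction k arbitrary: f)
  case 0 then show ?case using Ck_on_continuous[of "Suc 0"] by simp
next
  case (Suc k) then show ?case by (metis Ck_on.simps(2))
qed

lemma Ck_on_const: "open V \<Longrightarrow> Ck_on k V (\<lambda>x. c)"
proof (induction k arbitrary: c)
  case (Suc k)
  show ?case by (rule Ck_on_SucI[OF Suc.prems has_derivative_const Suc.IH[OF Suc.prems]])
qed simp

lemma Ck_on_linear: "open V \<Longrightarrow> bounded_linear f \<Longrightarrow> Ck_on k V f"
proof (cases k)
  case (Suc k')
  assume o: "open V" and f: "bounded_linear f"
  show ?thesis unfolding Suc
    by (rule Ck_on_SucI[OF o bounded_linear_imp_has_derivative[OF f] Ck_on_const[OF o]])
qed (simp add: linear_continuous_on)

lemma Ck_on_add:
  assumes "open V" shows "Ck_on k V f \<Longrightarrow> Ck_on k V g \<Longrightarrow> Ck_on k V (\<lambda>x. f x + g x)"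
proof (induction k arbitrary: f g)
  case 0 then show ?case by (auto intro: continuous_on_add)
next
  case (Suc k)
  note f = Suc.prems(1) and g = Suc.prems(2)
  show ?case
    by (rule Ck_on_SucI[OF assms has_derivative_add[OF Ck_on_SucD(1)[OF f] Ck_on_SucD(1)[OF g]]])
      (assumption+, rule Suc.IH[OF Ck_on_SucD(2)[OF f] Ck_on_SucD(2)[OF g]])
qed

lemma Ck_on_sum:
  assumes "open V" shows "(\<And>i. i \<in> I \<Longrightarrow> Ck_on k V (f i)) \<Longrightarrow> Ck_on k V (\<lambda>x. \<Sum>i\<in>I. f i x)"
  by (induction I rule: infinite_finite_induct) (auto intro: Ck_on_const Ck_on_add assms)

lemma Ck_on_bilinear:
  assumes "open V" "bounded_bilinear B"
  shows "Ck_on k V f \<Longrightarrow> Ck_on k V g \<Longrightarrow> Ck_on k V (\<lambda>x. B (f x) (g x))"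
proof (induction k arbitrary: f g)
  case 0 then show ?case by (auto intro: bounded_bilinear.continuous_on[OF assms(2)])
next
  case (Suc k)
  note f = Suc.prems(1) and g = Suc.prems(2)
  show ?case
    by (rule Ck_on_SucI[OF assms(1) bounded_bilinear.FDERIV[OF assms(2)
        Ck_on_SucD(1)[OF f] Ck_on_SucD(1)[OF g]]])
      (assumption+, rule Ck_on_add[OF assms(1) Suc.IH[OF Ck_on_Suc_mono[OF f] Ck_on_SucD(2)[OF g]]
          Suc.IH[OF Ck_on_SucD(2)[OF f] Ck_on_Suc_mono[OF g]]])
qed

lemma linear_basis_expand:
  assumes "linear f"
  shows "f v = (\<Sum>b\<in>Basis. (v \<bullet> b) *\<^sub>R f b)"
  using linear_sum[OF assms, of "\<lambda>b. (v \<bullet> b) *\<^sub>R b" Basis] linear_scale[OF assms]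
  by (simp add: euclidean_representation)

text \<open>Expanding the inner derivative in a basis turns the chain rule into a sum of products of maps to which the induction
  hypothesis applies.\<close>

lemma Ck_on_compose:
  assumes "open V" "open W"
  shows "Ck_on k W f \<Longrightarrow> Ck_on k V g \<Longrightarrow> g ` V \<subseteq> W \<Longrightarrow> Ck_on k V (\<lambda>x. f (g x))"
proof (induction k arbitrary: f)
  case 0 then show ?case by (auto intro: continuous_on_compose2)
next
  case (Suc k)
  have D: "((\<lambda>x. f (g x)) has_derivative
      (\<lambda>v. \<Sum>b\<in>Basis. (frechet_derivative g (at x) v \<bullet> b) *\<^sub>R frechet_derivative f (at (g x)) b)) (at x)"
    if "x \<in> V" for x
  proof -
    have f: "(f has_derivative frechet_derivative f (at (g x))) (at (g x))"
      using Suc.prems that by (intro Ck_on_SucD(1)) auto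
    have "((\<lambda>x. f (g x)) has_derivative (\<lambda>v. frechet_derivative f (at (g x)) (frechet_derivative g (at x) v))) (at x)"
      by (rule has_derivative_compose[OF Ck_on_SucD(1)[OF Suc.prems(2) that] f])
    then show ?thesis
      by (subst (asm) linear_basis_expand[OF has_derivative_linear[OF f]])
  qed
  have 1: "Ck_on k V (\<lambda>x. frechet_derivative g (at x) v \<bullet> b)" for v b
    by (rule Ck_on_bilinear[OF assms(1) bounded_bilinear_inner Ck_on_SucD(2)[OF Suc.prems(2)]
        Ck_on_const[OF assms(1)]])
  have 2: "Ck_on k V (\<lambda>x. frechet_derivative f (at (g x)) b)" for b
    by (rule Suc.IH[OF Ck_on_SucD(2)[OF Suc.prems(1)] Ck_on_Suc_mono[OF Suc.prems(2)] Suc.prems(3)])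
  show ?case
    by (rule Ck_on_SucI[OF assms(1) D], assumption,
        rule Ck_on_sum[OF assms(1) Ck_on_bilinear[OF assms(1) bounded_bilinear_scaleR 1 2]])
qed

lemma Ck_on_inverse_real: "Ck_on k (- {0}) (inverse :: real \<Rightarrow> real)"
proof (induction k)
  case 0 show ?case by (auto intro!: continuous_intros)
next
  case (Suc k)
  have o: "open (- {0::real})" by auto
  have 1: "Ck_on k (- {0}) (\<lambda>x. - inverse x * v * inverse x)" for v :: real
    by (intro Ck_on_bilinear[OF o bounded_bilinear_mult] Ck_on_const o Suc
        Ck_on_compose[OF o open_UNIV Ck_on_linear[OF _ bounded_linear_minus[OF bounded_linear_ident]]]) auto
  have 2: "(inverse has_derivative (\<lambda>v. - inverse x * v * inverse x)) (at x)" if "x \<in> - {0}" for x :: real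
    using has_derivative_inverse'[of x UNIV] that by simp
  show ?case
    by (rule Ck_on_SucI[OF o 2 1])
qed

lemma Ck_on_sqrt: "Ck_on k {0<..} sqrt"
proof (induction k)
  case 0 show ?case by (auto intro!: continuous_intros)
next
  case (Suc k)
  have o: "open {0::real<..}" by auto
  have 1: "Ck_on k {0<..} (\<lambda>x. v * (inverse (sqrt x) * (1 / 2)))" for v :: real
    by (intro Ck_on_bilinear[OF o bounded_bilinear_mult] Ck_on_const o Suc
        Ck_on_compose[OF o _ Ck_on_inverse_real]) auto
  have 2: "(sqrt has_derivative (\<lambda>v. v * (inverse (sqrt x) * (1 / 2)))) (at x)" if "x \<in> {0<..}" for x
  proof -
    have "(\<lambda>v. v * (inverse (sqrt x) * (1 / 2))) = (*) (inverse (sqrt x) / 2)" by (rule ext) simp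
    then show ?thesis using DERIV_real_sqrt[of x] that by (simp add: has_field_derivative_def)
  qed
  show ?case by (rule Ck_on_SucI[OF o 2 1])
qed

lemma Ck_on_local:
  assumes "\<And>p. p \<in> V \<Longrightarrow> \<exists>U. open U \<and> p \<in> U \<and> Ck_on k U f"
  shows "Ck_on k V f"
  using assms
proof (induction k arbitrary: f)
  case 0
  have "isCont f p" if "p \<in> V" for p
    using 0[OF that] by (auto simp: continuous_on_eq_continuous_at)
  then show ?case by (simp add: continuous_at_imp_continuous_on)
next
  case (Suc k)
  have "Ck_on k V (\<lambda>x. frechet_derivative f (at x) v)" for v
    using Suc.prems by (intro Suc.IH) (metis Ck_on.simps(2))
  with Suc.prems show ?case by (metis Ck_on.simps(2))
qed

definition Cinf_on :: "'a::euclidean_space set \<Rightarrow> ('a \<Rightarrow> 'b::euclidean_space) \<Rightarrow> bool" where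
  "Cinf_on V f \<longleftrightarrow> open V \<and> (\<forall>k. Ck_on k V f)"

lemma Cinf_on_open: "Cinf_on V f \<Longrightarrow> open V"
  by (simp add: Cinf_on_def)

lemma Cinf_on_subset: "Cinf_on V f \<Longrightarrow> open U \<Longrightarrow> U \<subseteq> V \<Longrightarrow> Cinf_on U f"
  by (auto simp: Cinf_on_def intro: Ck_on_subset)

lemma Cinf_on_cong: "Cinf_on V f \<Longrightarrow> (\<And>y. y \<in> V \<Longrightarrow> f y = g y) \<Longrightarrow> Cinf_on V g"
  using Ck_on_cong unfolding Cinf_on_def by blast

lemma Cinf_on_continuous: "Cinf_on V f \<Longrightarrow> continuous_on V f"
  using Ck_on_continuous unfolding Cinf_on_def by blast

lemma Cinf_on_has_derivative:
  "Cinf_on V f \<Longrightarrow> x \<in> V \<Longrightarrow> (f has_derivative frechet_derivative f (at x)) (at x)"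
  using Ck_on_SucD(1) unfolding Cinf_on_def by blast

lemma Cinf_on_linear: "open V \<Longrightarrow> bounded_linear f \<Longrightarrow> Cinf_on V f"
  by (simp add: Cinf_on_def Ck_on_linear)

lemma Cinf_on_ident: "open V \<Longrightarrow> Cinf_on V (\<lambda>x. x)"
  by (intro Cinf_on_linear bounded_linear_ident)

lemma Cinf_on_const: "open V \<Longrightarrow> Cinf_on V (\<lambda>x. c)"
  by (simp add: Cinf_on_def Ck_on_const)

lemma Cinf_on_add: "Cinf_on V f \<Longrightarrow> Cinf_on V g \<Longrightarrow> Cinf_on V (\<lambda>x. f x + g x)"
  by (simp add: Cinf_on_def Ck_on_add)

lemma Cinf_on_sum: "open V \<Longrightarrow> (\<And>i. i \<in> I \<Longrightarrow> Cinf_on V (f i)) \<Longrightarrow> Cinf_on V (\<lambda>x. \<Sum>i\<in>I. f i x)"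
  by (simp add: Cinf_on_def Ck_on_sum)

lemma Cinf_on_bilinear:
  "bounded_bilinear B \<Longrightarrow> Cinf_on V f \<Longrightarrow> Cinf_on V g \<Longrightarrow> Cinf_on V (\<lambda>x. B (f x) (g x))"
  by (simp add: Cinf_on_def Ck_on_bilinear)

lemmas Cinf_on_scaleR = Cinf_on_bilinear[OF bounded_bilinear_scaleR]
lemmas Cinf_on_inner = Cinf_on_bilinear[OF bounded_bilinear_inner]

lemma Cinf_on_mult: "Cinf_on V f \<Longrightarrow> Cinf_on V g \<Longrightarrow> Cinf_on V (\<lambda>x. f x * g x :: real)"
  by (rule Cinf_on_bilinear[OF bounded_bilinear_mult])

lemma Cinf_on_compose:
  "Cinf_on W f \<Longrightarrow> Cinf_on V g \<Longrightarrow> g ` V \<subseteq> W \<Longrightarrow> Cinf_on V (\<lambda>x. f (g x))"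
  unfolding Cinf_on_def using Ck_on_compose by blast

lemma Cinf_on_linear_compose:
  "bounded_linear f \<Longrightarrow> Cinf_on V g \<Longrightarrow> Cinf_on V (\<lambda>x. f (g x))"
  by (rule Cinf_on_compose[OF Cinf_on_linear[OF open_UNIV]]) auto

lemma Cinf_on_minus: "Cinf_on V f \<Longrightarrow> Cinf_on V (\<lambda>x. - f x)"
  by (rule Cinf_on_linear_compose[OF bounded_linear_minus[OF bounded_linear_ident]])

lemma Cinf_on_diff: "Cinf_on V f \<Longrightarrow> Cinf_on V g \<Longrightarrow> Cinf_on V (\<lambda>x. f x - g x)"
  using Cinf_on_add[OF _ Cinf_on_minus, of V f g] by simp

lemma Cinf_on_divide:
  fixes f g :: "_ \<Rightarrow> real"
  assumes "Cinf_on V f" "Cinf_on V g" "\<And>x. x \<in> V \<Longrightarrow> g x \<noteq> 0"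
  shows "Cinf_on V (\<lambda>x. f x / g x)"
proof -
  have "Cinf_on (- {0}) (inverse :: real \<Rightarrow> real)"
    using Ck_on_inverse_real by (auto simp: Cinf_on_def)
  then have "Cinf_on V (\<lambda>x. inverse (g x))"
    by (rule Cinf_on_compose) (use assms in auto)
  then show ?thesis using Cinf_on_mult[OF assms(1)] by (simp add: divide_inverse)
qed

lemma Cinf_on_sqrt:
  assumes "Cinf_on V f" "\<And>x. x \<in> V \<Longrightarrow> f x > 0"
  shows "Cinf_on V (\<lambda>x. sqrt (f x))"
proof -
  have "Cinf_on {0<..} sqrt" using Ck_on_sqrt by (auto simp: Cinf_on_def)
  then show ?thesis by (rule Cinf_on_compose) (use assms in auto)
qed

lemma Cinf_on_norm:
  assumes "Cinf_on V f" "\<And>x. x \<in> V \<Longrightarrow> f x \<noteq> 0"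
  shows "Cinf_on V (\<lambda>x. norm (f x))"
  unfolding norm_eq_sqrt_inner by (intro Cinf_on_sqrt Cinf_on_inner assms) (use assms in auto)

lemma Cinf_on_Pair: "Cinf_on V f \<Longrightarrow> Cinf_on V g \<Longrightarrow> Cinf_on V (\<lambda>x. (f x, g x))"
  using Cinf_on_add[OF Cinf_on_linear_compose[OF bounded_linear_Pair[OF bounded_linear_ident
    bounded_linear_zero], of V f] Cinf_on_linear_compose[OF bounded_linear_Pair[OF bounded_linear_zero
    bounded_linear_ident], of V g]] by simp

lemma Cinf_on_derivative:
  "Cinf_on V f \<Longrightarrow> Cinf_on V (\<lambda>x. frechet_derivative f (at x) v)"
  unfolding Cinf_on_def using Ck_on_SucD(2) by blast

lemma Cinf_on_derivative_apply:
  assumes "Cinf_on V f" "Cinf_on V g"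
  shows "Cinf_on V (\<lambda>x. frechet_derivative f (at x) (g x))"
proof (rule Cinf_on_cong)
  show "Cinf_on V (\<lambda>x. \<Sum>b\<in>Basis. (g x \<bullet> b) *\<^sub>R frechet_derivative f (at x) b)"
    by (intro Cinf_on_sum Cinf_on_scaleR Cinf_on_inner Cinf_on_const Cinf_on_derivative assms
        Cinf_on_open[OF assms(1)])
qed (simp add: linear_basis_expand[OF has_derivative_linear[OF Cinf_on_has_derivative[OF assms(1)]], symmetric])

lemma smooth_on_imp_Cinf_on: "open V \<Longrightarrow> smooth_on V f \<Longrightarrow> Cinf_on V f"
  unfolding Cinf_on_def
proof (intro conjI allI Ck_on_local)
  fix k p assume "open V" "smooth_on V f" "p \<in> V"
  then obtain W F where W: "open W" "p \<in> W" "Ck_on k W F" "\<forall>x\<in>W \<inter> V. F x = f x"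
    unfolding smooth_on_def by blast
  then show "\<exists>U. open U \<and> p \<in> U \<and> Ck_on k U f"
    using \<open>open V\<close> \<open>p \<in> V\<close>
    by (intro exI[of _ "W \<inter> V"]) (auto intro!: Ck_on_cong[of "W \<inter> V" F f] intro: Ck_on_subset[of _ W])
qed auto

lemma Cinf_on_imp_smooth_on: "Cinf_on V f \<Longrightarrow> S \<subseteq> V \<Longrightarrow> smooth_on S f"
  unfolding Cinf_on_def smooth_on_def by blast

lemma smooth_onE:
  assumes "smooth_on S f" "p \<in> S"
  obtains V F where "Cinf_on V F" "p \<in> V" "\<And>x. x \<in> V \<Longrightarrow> x \<in> S \<Longrightarrow> F x = f x"
proof -
  obtain V F where "open V" "p \<in> V" "\<forall>k. Ck_on k V F" "\<forall>x\<in>V \<inter> S. F x = f x"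
    using bspec[OF assms(1)[unfolded smooth_on_def] assms(2)] by (elim exE conjE) (assumption | rule that)+
  then show thesis using that[of V F] by (simp add: Cinf_on_def)
qed

lemma Cinf_on_open_preimage:
  "Cinf_on V g \<Longrightarrow> open W \<Longrightarrow> open (V \<inter> g -` W)"
  by (rule continuous_open_preimage[OF Cinf_on_continuous Cinf_on_open])

lemma smooth_on_compose:
  assumes "smooth_on S f" "smooth_on R g" "g ` R \<subseteq> S"
  shows "smooth_on R (\<lambda>x. f (g x))"
  unfolding smooth_on_def
proof
  fix p assume "p \<in> R"
  obtain V G where G: "Cinf_on V G" "p \<in> V" "\<And>x. x \<in> V \<Longrightarrow> x \<in> R \<Longrightarrow> G x = g x"
    using smooth_onE[OF assms(2) \<open>p \<in> R\<close>] by metis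
  obtain W F where F: "Cinf_on W F" "g p \<in> W" "\<And>x. x \<in> W \<Longrightarrow> x \<in> S \<Longrightarrow> F x = f x"
    using smooth_onE[OF assms(1), of "g p"] \<open>p \<in> R\<close> assms(3) by blast
  have "open (V \<inter> G -` W)" by (rule Cinf_on_open_preimage[OF G(1) Cinf_on_open[OF F(1)]])
  then have "Cinf_on (V \<inter> G -` W) (\<lambda>x. F (G x))"
    using Cinf_on_subset[OF G(1)] by (intro Cinf_on_compose[OF F(1)]) auto
  then show "\<exists>V F. open V \<and> p \<in> V \<and> (\<forall>k. Ck_on k V F) \<and> (\<forall>x\<in>V \<inter> R. F x = f (g x))"
    unfolding Cinf_on_def
    by (intro exI[of _ "V \<inter> G -` W"] exI[of _ "\<lambda>x. F (G x)"])
      (use G F \<open>p \<in> R\<close> assms(3) in \<open>auto simp: image_subset_iff\<close>)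
qed

lemma Cinf_on_smooth_compose:
  assumes "smooth_on S f" "Cinf_on V g" "g ` V \<subseteq> S"
  shows "Cinf_on V (\<lambda>x. f (g x))"
  using smooth_on_imp_Cinf_on[OF Cinf_on_open smooth_on_compose] Cinf_on_imp_smooth_on assms by blast

lemma smooth_on_continuous: 
  assumes "smooth_on S f" shows "continuous_on S f"
proof -
  have "continuous (at p within S) f" if p: "p \<in> S" for p
  proof -
    obtain V F where F: "Cinf_on V F" "p \<in> V" "\<And>x. x \<in> V \<Longrightarrow> x \<in> S \<Longrightarrow> F x = f x"
      using smooth_onE[OF assms p] by metis
    have "isCont F p"
      using F(1,2) Cinf_on_continuous[OF F(1)] Cinf_on_open[OF F(1)] by (simp add: continuous_on_eq_continuous_at)
    then have "(F \<longlongrightarrow> F p) (at p within S)"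
      using continuous_at_imp_continuous_at_within continuous_within by blast
    then have "(f \<longlongrightarrow> F p) (at p within S)"
    proof (rule Lim_transform_eventually)
      show "\<forall>\<^sub>F x in at p within S. F x = f x"
        unfolding eventually_at_topological using F Cinf_on_open[OF F(1)] by blast
    qed
    then show ?thesis using F(2,3) p by (simp add: continuous_within)
  qed
  then show ?thesis by (simp add: continuous_on_eq_continuous_within)
qed

text \<open>On a closed ball the partial derivatives are bounded by compactness, and the ball is convex.\<close>

lemma Cinf_on_locally_lipschitz:
  assumes "Cinf_on V f" "p \<in> V"
  obtains e L where "e > 0" "L \<ge> 0" "ball p e \<subseteq> V"
    "\<And>x y. x \<in> ball p e \<Longrightarrow> y \<in> ball p e \<Longrightarrow> norm (f x - f y) \<le> L * norm (x - y)"
proof -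
  obtain e where e: "e > 0" "cball p e \<subseteq> V"
    using assms Cinf_on_open open_contains_cball by blast
  let ?h = "\<lambda>x. \<Sum>b\<in>Basis. norm (frechet_derivative f (at x) b)"
  have "continuous_on (cball p e) ?h"
    by (intro continuous_intros continuous_on_subset[OF Cinf_on_continuous[OF Cinf_on_derivative[OF assms(1)]] e(2)])
  then have "bounded (?h ` cball p e)"
    by (intro compact_imp_bounded compact_continuous_image) auto
  then obtain L where L: "\<And>x. x \<in> cball p e \<Longrightarrow> norm (?h x) \<le> L"
    unfolding bounded_iff by blast
  have on: "onorm (frechet_derivative f (at x)) \<le> L" if x: "x \<in> ball p e" for x
  proof (rule onorm_le)
    fix v
    have xV: "x \<in> V" using x e(2) by auto
    have "norm (frechet_derivative f (at x) v) =
        norm (\<Sum>b\<in>Basis. (v \<bullet> b) *\<^sub>R frechet_derivative f (at x) b)"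
      by (metis linear_basis_expand[OF has_derivative_linear[OF Cinf_on_has_derivative[OF assms(1) xV]]])
    also have "\<dots> \<le> (\<Sum>b\<in>Basis. norm v * norm (frechet_derivative f (at x) b))"
      by (rule sum_norm_le) (simp add: Basis_le_norm mult_right_mono)
    also have "\<dots> = norm v * ?h x" by (simp add: sum_distrib_left)
    also have "\<dots> \<le> norm v * L" using L[of x] x by (intro mult_left_mono) auto
    finally show "norm (frechet_derivative f (at x) v) \<le> L * norm v" by (simp add: mult.commute)
  qed
  have "norm (f x - f y) \<le> L * norm (x - y)" if "x \<in> ball p e" "y \<in> ball p e" for x y
    by (rule differentiable_bound[OF convex_ball _ on that])
      (use e in \<open>auto intro!: has_derivative_at_withinI Cinf_on_has_derivative[OF assms(1)]\<close>)
  moreover have "L \<ge> 0" using L[of p] e norm_ge_zero by (meson centre_in_cball less_imp_le order_trans)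
  moreover have "ball p e \<subseteq> V" using e by auto
  ultimately show thesis using that e(1) by blast
qed

section \<open>The inverse function theorem in the plane\<close>

text \<open>Cramer's rule in dimension two.  It exhibits the inverse as a rational expression in the entries, from
  which its smooth dependence on the linear map can be read off.\<close>

lemma linear_plane_inverse:
  fixes D :: "real \<times> real \<Rightarrow> real \<times> real"
  assumes D: "linear D" "bij D"
  defines "d \<equiv> fst (D (1, 0)) * snd (D (0, 1)) - fst (D (0, 1)) * snd (D (1, 0))"
  shows "d \<noteq> 0"
    "inv D v = ((snd (D (0, 1)) * fst v - fst (D (0, 1)) * snd v) / d,
                (fst (D (1, 0)) * snd v - snd (D (1, 0)) * fst v) / d)"
proof -
  obtain a c where ac: "D (1, 0) = (a, c)" by (cases "D (1, 0)")
  obtain b e where be: "D (0, 1) = (b, e)" by (cases "D (0, 1)")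
  have D': "D (x, y) = (a * x + b * y, c * x + e * y)" for x y
  proof -
    have "D (x, y) = D (x *\<^sub>R (1, 0) + y *\<^sub>R (0, 1))" by simp
    also have "\<dots> = x *\<^sub>R D (1, 0) + y *\<^sub>R D (0, 1)"
      by (simp only: linear_add[OF D(1)] linear_scale[OF D(1)])
    finally show ?thesis by (simp add: ac be)
  qed
  have d: "d = a * e - b * c" by (simp add: d_def ac be)
  show d0: "d \<noteq> 0"
  proof
    assume "d = 0"
    then have "D (e, - c) = D (0, 0)" "D (b, - a) = D (0, 0)" by (auto simp: D' d algebra_simps)
    then have "(e, - c) = (0, 0)" "(b, - a) = (0, 0)" using bij_is_inj[OF D(2)] by (blast dest: injD)+
    then have "e = 0" "c = 0" "b = 0" "a = 0" by auto
    then have "D (1, 0) = D (0, 0)" by (simp add: D')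
    then show False using bij_is_inj[OF D(2)] by (auto dest!: injD)
  qed
  have "D ((e * fst v - b * snd v) / d, (a * snd v - c * fst v) / d) = v"
  proof (cases v)
    case (Pair x y)
    have "a * (e * x - b * y) + b * (a * y - c * x) = d * x"
      "c * (e * x - b * y) + e * (a * y - c * x) = d * y" by (simp_all add: d algebra_simps)
    then show ?thesis using d0 by (simp add: Pair D' add_divide_distrib[symmetric])
  qed
  then show "inv D v = ((snd (D (0, 1)) * fst v - fst (D (0, 1)) * snd v) / d,
                (fst (D (1, 0)) * snd v - snd (D (1, 0)) * fst v) / d)"
    using bij_is_inj[OF D(2)] by (simp add: ac be inv_f_eq)
qed

text \<open>The derivative of the local inverse \<open>g\<close> at \<open>y\<close> is the inverse of the derivative of \<open>F\<close> at \<open>g y\<close>.  By Cramer's rule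
  it is a smooth function of \<open>g y\<close>, so if \<open>g\<close> is of class \<open>C\<^sup>k\<close> then so is its derivative.\<close>

lemma smooth_inverse_function_plane:
  fixes F :: "real \<times> real \<Rightarrow> real \<times> real"
  assumes F: "Cinf_on O1 F" and x0: "x0 \<in> O1"
    and A: "linear A" "\<And>v. A (frechet_derivative F (at x0) v) = v"
  obtains U V g where "open U" "x0 \<in> U" "U \<subseteq> O1" "homeomorphism U V F g" "Cinf_on V g"
proof -
  let ?D = "\<lambda>x. frechet_derivative F (at x)"
  note der = Cinf_on_has_derivative[OF F]
  define f' where "f' x = Blinfun (?D x)" for x
  have f': "blinfun_apply (f' x) = ?D x" if "x \<in> O1" for x
    unfolding f'_def by (rule bounded_linear_Blinfun_apply) (rule has_derivative_bounded_linear[OF der[OF that]])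
  have A': "bounded_linear A" using A(1) by (simp add: linear_linear)
  have inv: "Blinfun A o\<^sub>L f' x0 = id_blinfun"
    by (rule blinfun_eqI) (simp add: f'[OF x0] bounded_linear_Blinfun_apply[OF A'] A(2))
  have cont: "continuous_on O1 f'"
  proof (rule continuous_on_blinfun_componentwise)
    fix i show "continuous_on O1 (\<lambda>x. blinfun_apply (f' x) i)"
      by (rule continuous_on_eq[OF Cinf_on_continuous[OF Cinf_on_derivative[OF F, of i]]]) (simp add: f')
  qed
  have dF: "(F has_derivative blinfun_apply (f' x)) (at x)" if "x \<in> O1" for x
    using der[OF that] by (simp add: f'[OF that])
  obtain U V g g' where U: "open U" "U \<subseteq> O1" "x0 \<in> U" "open V" "F x0 \<in> V" "homeomorphism U V F g"
    and g: "\<And>y. y \<in> V \<Longrightarrow> (g has_derivative (g' y)) (at y)"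
      "\<And>y. y \<in> V \<Longrightarrow> g' y = inv (blinfun_apply (f' (g y)))"
      "\<And>y. y \<in> V \<Longrightarrow> bij (blinfun_apply (f' (g y)))"
    by (rule inverse_function_theorem[OF Cinf_on_open[OF F] dF cont x0 inv]) (assumption | rule that)+
  have gO: "g y \<in> O1" if "y \<in> V" for y using U that homeomorphism_image2 by blast
  have gOV: "g ` V \<subseteq> O1" using gO by blast
  define d where "d y = fst (?D y (1, 0)) * snd (?D y (0, 1)) - fst (?D y (0, 1)) * snd (?D y (1, 0))" for y
  have dg: "(g has_derivative (\<lambda>v. ((snd (?D (g y) (0, 1)) * fst v - fst (?D (g y) (0, 1)) * snd v) / d (g y),
                (fst (?D (g y) (1, 0)) * snd v - snd (?D (g y) (1, 0)) * fst v) / d (g y)))) (at y)"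
    and d0: "d (g y) \<noteq> 0" if "y \<in> V" for y
  proof -
    have l: "linear (?D (g y))" by (rule has_derivative_linear[OF der[OF gO[OF that]]])
    have b: "bij (?D (g y))" using g(3)[OF that] f'[OF gO[OF that]] by simp
    show "d (g y) \<noteq> 0" unfolding d_def by (rule linear_plane_inverse(1)[OF l b])
    have "g' y = (\<lambda>v. ((snd (?D (g y) (0, 1)) * fst v - fst (?D (g y) (0, 1)) * snd v) / d (g y),
                (fst (?D (g y) (1, 0)) * snd v - snd (?D (g y) (1, 0)) * fst v) / d (g y)))"
      unfolding g(2)[OF that] f'[OF gO[OF that]] d_def by (rule ext) (rule linear_plane_inverse(2)[OF l b])
    then show "(g has_derivative (\<lambda>v. ((snd (?D (g y) (0, 1)) * fst v - fst (?D (g y) (0, 1)) * snd v) / d (g y),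
                (fst (?D (g y) (1, 0)) * snd v - snd (?D (g y) (1, 0)) * fst v) / d (g y)))) (at y)"
      using g(1)[OF that] by simp
  qed
  let ?Q = "O1 \<inter> {x. d x \<noteq> 0}"
  have dC: "Cinf_on O1 d"
    unfolding d_def by (intro Cinf_on_diff Cinf_on_mult Cinf_on_linear_compose[OF bounded_linear_fst]
        Cinf_on_linear_compose[OF bounded_linear_snd] Cinf_on_derivative F)
  have Q: "open ?Q"
    using Cinf_on_open_preimage[OF dC open_Compl[OF closed_singleton[of 0]]]
    by (simp add: vimage_def)
  have h: "Cinf_on ?Q (\<lambda>x. ((snd (?D x (0, 1)) * fst v - fst (?D x (0, 1)) * snd v) / d x,
                (fst (?D x (1, 0)) * snd v - snd (?D x (1, 0)) * fst v) / d x))" for v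
    by (intro Cinf_on_Pair Cinf_on_divide Cinf_on_diff Cinf_on_mult Cinf_on_const Q
        Cinf_on_linear_compose[OF bounded_linear_fst] Cinf_on_linear_compose[OF bounded_linear_snd]
        Cinf_on_derivative Cinf_on_subset[OF F] Cinf_on_subset[OF dC]) auto
  have "Ck_on k V g" for k
  proof (induction k)
    case 0 show ?case using U(6) by (simp add: homeomorphism_def)
  next
    case (Suc k)
    show ?case
      by (rule Ck_on_SucI[OF U(4) dg Ck_on_compose[OF U(4) Q _ Suc]])
        (use h gO d0 in \<open>auto simp: Cinf_on_def\<close>)
  qed
  then have "Cinf_on V g" using U(4) by (simp add: Cinf_on_def)
  then show thesis using that U by blast
qed

text \<open>A linear left inverse of the derivative at \<open>u0\<close>, applied after \<open>f\<close>, gives a local diffeomorphism of the plane.  Its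
  inverse provides a smooth left inverse of \<open>f\<close> on an open subset of the ambient space.\<close>

lemma immersion_local_left_inverse:
  fixes f :: "real \<times> real \<Rightarrow> 'e::euclidean_space"
  assumes f: "Cinf_on O1 f" and u0: "u0 \<in> O1" and inj: "inj (frechet_derivative f (at u0))"
  obtains U W \<kappa> where "open U" "u0 \<in> U" "U \<subseteq> O1" "Cinf_on W \<kappa>" "f ` U \<subseteq> W" "\<kappa> ` W \<subseteq> U"
    "\<And>u. u \<in> U \<Longrightarrow> \<kappa> (f u) = u"
proof -
  note der = Cinf_on_has_derivative[OF f]
  obtain B where B: "linear B" "B \<circ> frechet_derivative f (at u0) = id"
    using linear_injective_left_inverse[OF has_derivative_linear[OF der[OF u0]] inj] by blast
  have Bl: "bounded_linear B" using B(1) by (simp add: linear_linear)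
  have "((\<lambda>x. B (f x)) has_derivative (\<lambda>v. B (frechet_derivative f (at u0) v))) (at u0)"
    by (rule has_derivative_compose[OF der[OF u0] bounded_linear_imp_has_derivative[OF Bl]])
  then have 1: "frechet_derivative (\<lambda>x. B (f x)) (at u0) v = v" for v
    using frechet_derivative_at B(2) by (metis comp_apply id_apply)
  obtain U V g where U: "open U" "u0 \<in> U" "U \<subseteq> O1" "homeomorphism U V (\<lambda>x. B (f x)) g" "Cinf_on V g"
    using smooth_inverse_function_plane[OF Cinf_on_linear_compose[OF Bl f] u0, of id] 1
    by (metis id_apply linear_id)
  show thesis
  proof (rule that[of U "B -` V" "\<lambda>x. g (B x)"])
    have "open (B -` V)"
      using Cinf_on_open_preimage[OF Cinf_on_linear[OF open_UNIV Bl] Cinf_on_open[OF U(5)]] by simp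
    then show "Cinf_on (B -` V) (\<lambda>x. g (B x))"
      by (intro Cinf_on_compose[OF U(5)] Cinf_on_linear Bl) auto
  qed (use U in \<open>auto simp: homeomorphism_def\<close>)
qed

section \<open>Symmetry of the second derivative\<close>

abbreviation deriv_at :: "('a::euclidean_space \<Rightarrow> 'b::euclidean_space) \<Rightarrow> 'a \<Rightarrow> 'a \<Rightarrow> 'b" where
  "deriv_at f x \<equiv> frechet_derivative f (at x)"

text \<open>\<open>deriv2_at f x u v\<close> differentiates first in the constant direction \<open>v\<close> and then in the direction \<open>u\<close>.\<close>

definition deriv2_at :: "('a::euclidean_space \<Rightarrow> 'b::euclidean_space) \<Rightarrow> 'a \<Rightarrow> 'a \<Rightarrow> 'a \<Rightarrow> 'b" where
  "deriv2_at f x u v = deriv_at (\<lambda>y. deriv_at f y v) x u"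

lemma deriv_at_eq: "(f has_derivative D) (at x) \<Longrightarrow> deriv_at f x = D"
  using frechet_derivative_at by metis

text \<open>The mean value theorem is applied twice, first in the direction \<open>u\<close> and then in the direction \<open>v\<close>.\<close>

lemma mixed_difference_mean_value:
  fixes f :: "'a::euclidean_space \<Rightarrow> real"
  assumes f: "Cinf_on V f" and V: "ball x e \<subseteq> V" and h: "h > 0" "h * (norm u + norm v) < e"
  obtains y where "dist x y \<le> h * (norm u + norm v)"
    "f (x + h *\<^sub>R u + h *\<^sub>R v) - f (x + h *\<^sub>R u) - f (x + h *\<^sub>R v) + f x = h * h * deriv2_at f y v u"
proof -
  have bd: "norm (s *\<^sub>R u + t *\<^sub>R v) \<le> h * (norm u + norm v)" if "s \<in> {0..h}" "t \<in> {0..h}" for s t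
  proof -
    have "norm (s *\<^sub>R u + t *\<^sub>R v) \<le> s * norm u + t * norm v"
      using norm_triangle_ineq[of "s *\<^sub>R u" "t *\<^sub>R v"] that by simp
    also have "\<dots> \<le> h * norm u + h * norm v"
      using that by (intro add_mono mult_right_mono) auto
    finally show ?thesis by (simp add: algebra_simps)
  qed
  have inV: "x + s *\<^sub>R u + t *\<^sub>R v \<in> V" if "s \<in> {0..h}" "t \<in> {0..h}" for s t
  proof (rule subsetD[OF V])
    have "dist x (x + s *\<^sub>R u + t *\<^sub>R v) = norm (s *\<^sub>R u + t *\<^sub>R v)"
      by (metis add.assoc add_diff_cancel_left' dist_commute dist_norm)
    then show "x + s *\<^sub>R u + t *\<^sub>R v \<in> ball x e" using bd[OF that] h(2) by simp
  qed
  have ds: "((\<lambda>s. f (x + s *\<^sub>R u + t *\<^sub>R v)) has_derivative (\<lambda>k. deriv_at f (x + s *\<^sub>R u + t *\<^sub>R v) (k *\<^sub>R u))) (at s within S)"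
    if "s \<in> {0..h}" "t \<in> {0..h}" for s t S
    by (rule has_derivative_compose[of "\<lambda>s. x + s *\<^sub>R u + t *\<^sub>R v" "\<lambda>k. k *\<^sub>R u"])
      (auto intro!: derivative_eq_intros Cinf_on_has_derivative[OF f inV[OF that]])
  note f1 = Cinf_on_derivative[OF f, of u]
  have dt: "((\<lambda>t. deriv_at f (x + s *\<^sub>R u + t *\<^sub>R v) u) has_derivative
      (\<lambda>k. deriv_at (\<lambda>y. deriv_at f y u) (x + s *\<^sub>R u + t *\<^sub>R v) (k *\<^sub>R v))) (at t within S)"
    if "s \<in> {0..h}" "t \<in> {0..h}" for s t S
    by (rule has_derivative_compose[of "\<lambda>t. x + s *\<^sub>R u + t *\<^sub>R v" "\<lambda>k. k *\<^sub>R v"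
          t S "\<lambda>y. deriv_at f y u"])
      (auto intro!: derivative_eq_intros Cinf_on_has_derivative[OF f1 inV[OF that]])
  let ?k = "\<lambda>s. f (x + s *\<^sub>R u + h *\<^sub>R v) - f (x + s *\<^sub>R u + 0 *\<^sub>R v)"
  let ?k' = "\<lambda>s k. deriv_at f (x + s *\<^sub>R u + h *\<^sub>R v) (k *\<^sub>R u) - deriv_at f (x + s *\<^sub>R u + 0 *\<^sub>R v) (k *\<^sub>R u)"
  have h0: "h \<in> {0..h}" "0 \<in> {0..h}" using h(1) by auto
  have "(?k has_derivative ?k' s) (at s within {0..h})" if "0 \<le> s" "s \<le> h" for s
    by (rule has_derivative_diff[OF ds[OF _ h0(1)] ds[OF _ h0(2)]]) (use that in simp_all)
  then have "\<exists>s\<in>{0<..<h}. ?k h - ?k 0 = ?k' s (h - 0)" by (rule mvt_simple[OF h(1)])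
  then obtain s where s: "s \<in> {0<..<h}" and 1: "?k h - ?k 0 = ?k' s (h - 0)" by (elim bexE)
  have sc: "deriv_at f y (h *\<^sub>R u) = h * deriv_at f y u" if "y \<in> V" for y
    using linear_scale[OF has_derivative_linear[OF Cinf_on_has_derivative[OF f that]], of h u] by simp
  let ?l = "\<lambda>t. deriv_at f (x + s *\<^sub>R u + t *\<^sub>R v) u"
  have "(?l has_derivative (\<lambda>k. deriv_at (\<lambda>y. deriv_at f y u) (x + s *\<^sub>R u + t *\<^sub>R v) (k *\<^sub>R v)))
      (at t within {0..h})" if "0 \<le> t" "t \<le> h" for t
    by (rule dt) (use that s in simp_all)
  then have "\<exists>t\<in>{0<..<h}. ?l h - ?l 0 = deriv_at (\<lambda>y. deriv_at f y u) (x + s *\<^sub>R u + t *\<^sub>R v) ((h - 0) *\<^sub>R v)"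
    by (rule mvt_simple[OF h(1)])
  then obtain t where t: "t \<in> {0<..<h}" and
    2: "?l h - ?l 0 = deriv_at (\<lambda>y. deriv_at f y u) (x + s *\<^sub>R u + t *\<^sub>R v) ((h - 0) *\<^sub>R v)"
    by (elim bexE)
  have st: "s \<in> {0..h}" "t \<in> {0..h}" using s t by auto
  have "deriv_at (\<lambda>y. deriv_at f y u) (x + s *\<^sub>R u + t *\<^sub>R v) (h *\<^sub>R v) =
      h * deriv2_at f (x + s *\<^sub>R u + t *\<^sub>R v) v u"
    using linear_scale[OF has_derivative_linear[OF Cinf_on_has_derivative[OF f1 inV[OF st]]], of h v]
    by (simp add: deriv2_at_def)
  then have "f (x + h *\<^sub>R u + h *\<^sub>R v) - f (x + h *\<^sub>R u) - f (x + h *\<^sub>R v) + f x =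
      h * h * deriv2_at f (x + s *\<^sub>R u + t *\<^sub>R v) v u"
    using 1 2 sc[OF inV[of s h]] sc[OF inV[of s 0]] st h(1) by (simp add: algebra_simps)
  then show thesis using bd[OF st] that[of "x + s *\<^sub>R u + t *\<^sub>R v"] by (simp add: dist_norm add.assoc norm_minus_commute norm_minus_cancel add.commute)
qed

text \<open>The second difference is symmetric in \<open>u\<close> and \<open>v\<close>, and it is approximated by either second derivative.\<close>

lemma deriv2_at_symmetric_real:
  fixes f :: "'a::euclidean_space \<Rightarrow> real"
  assumes f: "Cinf_on V f" and x: "x \<in> V"
  shows "deriv2_at f x u v = deriv2_at f x v u"
proof (rule ccontr)
  assume ne: "deriv2_at f x u v \<noteq> deriv2_at f x v u"
  define d where "d = \<bar>deriv2_at f x u v - deriv2_at f x v u\<bar>"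
  have d: "d > 0" using ne by (simp add: d_def)
  obtain e where e: "e > 0" "ball x e \<subseteq> V"
    using x Cinf_on_open[OF f] open_contains_ball by blast
  have c: "isCont (\<lambda>y. deriv2_at f y u v) x" for u v
    using Cinf_on_continuous[OF Cinf_on_derivative[OF Cinf_on_derivative[OF f]]] x Cinf_on_open[OF f]
    by (auto simp: deriv2_at_def continuous_on_eq_continuous_at)
  obtain \<delta>1 where \<delta>1: "\<delta>1 > 0" "\<And>y. dist x y < \<delta>1 \<Longrightarrow> \<bar>deriv2_at f y u v - deriv2_at f x u v\<bar> < d / 2"
    using c[of u v, unfolded continuous_at_eps_delta, rule_format, of "d / 2"] d
    by (auto simp: dist_real_def dist_commute)
  obtain \<delta>2 where \<delta>2: "\<delta>2 > 0" "\<And>y. dist x y < \<delta>2 \<Longrightarrow> \<bar>deriv2_at f y v u - deriv2_at f x v u\<bar> < d / 2"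
    using c[of v u, unfolded continuous_at_eps_delta, rule_format, of "d / 2"] d
    by (auto simp: dist_real_def dist_commute)
  define \<mu> where "\<mu> = min e (min \<delta>1 \<delta>2)"
  have \<mu>: "\<mu> > 0" using e \<delta>1 \<delta>2 by (simp add: \<mu>_def)
  \<comment> \<open>chosen so that the points of the mean value lemma stay within distance \<open>\<mu>\<close> of \<open>x\<close>; the summand 1 covers \<open>u = v = 0\<close>\<close>
  define h where "h = \<mu> / (2 * (norm u + norm v + 1))"
  have np: "norm u + norm v + 1 > 0" by (simp add: add_nonneg_pos)
  have h: "h > 0" unfolding h_def by (rule divide_pos_pos) (use \<mu> np in auto)
  have "h * (norm u + norm v) < h * (2 * (norm u + norm v + 1))"
    using h by (intro mult_strict_left_mono) (auto simp: add_nonneg_pos add_pos_nonneg)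
  also have "\<dots> = \<mu>" using np by (simp add: h_def)
  finally have hm: "h * (norm u + norm v) < \<mu>" .
  then have he: "h * (norm u + norm v) < e" "h * (norm v + norm u) < e"
    "h * (norm u + norm v) < \<delta>1" "h * (norm u + norm v) < \<delta>2"
    by (auto simp: \<mu>_def add.commute)
  obtain y where y: "dist x y \<le> h * (norm u + norm v)"
    "f (x + h *\<^sub>R u + h *\<^sub>R v) - f (x + h *\<^sub>R u) - f (x + h *\<^sub>R v) + f x = h * h * deriv2_at f y v u"
    by (rule mixed_difference_mean_value[OF f e(2) h he(1)])
  obtain z where z: "dist x z \<le> h * (norm v + norm u)"
    "f (x + h *\<^sub>R v + h *\<^sub>R u) - f (x + h *\<^sub>R v) - f (x + h *\<^sub>R u) + f x = h * h * deriv2_at f z u v"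
    by (rule mixed_difference_mean_value[OF f e(2) h he(2)])
  have "h * h * deriv2_at f y v u = h * h * deriv2_at f z u v"
    unfolding y(2)[symmetric] z(2)[symmetric] by (simp add: add.commute add.left_commute)
  then have "deriv2_at f y v u = deriv2_at f z u v" using h by simp
  moreover have "\<bar>deriv2_at f y v u - deriv2_at f x v u\<bar> < d / 2"
    using y(1) he by (intro \<delta>2) linarith
  moreover have "\<bar>deriv2_at f z u v - deriv2_at f x u v\<bar> < d / 2"
    using z(1) he by (intro \<delta>1) (simp add: add.commute)
  moreover have "False" if "a = b" "\<bar>a - q\<bar> < d / 2" "\<bar>b - p\<bar> < d / 2" "d = \<bar>p - q\<bar>" for a b p q :: real
    using that by arith
  ultimately show False using d_def by blast
qed

lemma deriv2_at_symmetric: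
  assumes f: "Cinf_on V f" and x: "x \<in> V"
  shows "deriv2_at f x u v = deriv2_at f x v u"
proof (rule euclidean_eqI)
  fix b :: 'b assume "b \<in> Basis"
  have 1: "deriv_at (\<lambda>y. f y \<bullet> b) y v = deriv_at f y v \<bullet> b" if "y \<in> V" for y v
    using fun_cong[OF deriv_at_eq[OF has_derivative_inner_left[OF Cinf_on_has_derivative[OF f that]]]] .
  have 2: "deriv2_at (\<lambda>y. f y \<bullet> b) x u v = deriv2_at f x u v \<bullet> b" for u v
  proof -
    have "deriv2_at (\<lambda>y. f y \<bullet> b) x u v = deriv_at (\<lambda>y. deriv_at f y v \<bullet> b) x u"
      unfolding deriv2_at_def
      by (rule fun_cong[OF frechet_derivative_cong_open[OF Cinf_on_open[OF f] x 1]])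
    also have "\<dots> = deriv2_at f x u v \<bullet> b"
      unfolding deriv2_at_def
      by (rule fun_cong[OF deriv_at_eq[OF has_derivative_inner_left[OF Cinf_on_has_derivative[OF Cinf_on_derivative[OF f] x]]]])
    finally show ?thesis .
  qed
  show "deriv2_at f x u v \<bullet> b = deriv2_at f x v u \<bullet> b"
    unfolding 2[symmetric]
    by (rule deriv2_at_symmetric_real[OF Cinf_on_inner[OF f Cinf_on_const[OF Cinf_on_open[OF f]]] x])
qed

section \<open>Smooth retractions and tangent spaces\<close>

lemma subspace_orthonormal_expansion:
  fixes T :: "'e::euclidean_space set"
  assumes "subspace T"
  obtains B where "finite B" "B \<subseteq> T" "\<And>x. x \<in> T \<Longrightarrow> (\<Sum>b\<in>B. (x \<bullet> b) *\<^sub>R b) = x"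
proof -
  obtain B where B: "B \<subseteq> T" "pairwise orthogonal B" "\<And>x. x \<in> B \<Longrightarrow> norm x = 1"
    "independent B" "card B = dim T" "span B = T"
    using orthonormal_basis_subspace[OF assms] by blast
  have fin: "finite B" using B(4) independent_imp_finite by blast
  show thesis using that[OF fin B(1)] orthonormal_basis_expand[OF B(2,3) _ fin] B(6) by blast
qed

lemma subspace_linear_retraction:
  fixes T :: "'e::euclidean_space set"
  assumes "subspace T"
  obtains P where "bounded_linear P" "range P \<subseteq> T" "\<And>x. x \<in> T \<Longrightarrow> P x = x"
proof -
  obtain B where B: "finite B" "B \<subseteq> T" "\<And>x. x \<in> T \<Longrightarrow> (\<Sum>b\<in>B. (x \<bullet> b) *\<^sub>R b) = x"
    using subspace_orthonormal_expansion[OF assms] by blast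
  show thesis
  proof (rule that[of "\<lambda>v. \<Sum>b\<in>B. (v \<bullet> b) *\<^sub>R b"])
    show "bounded_linear (\<lambda>v. \<Sum>b\<in>B. (v \<bullet> b) *\<^sub>R b)"
      by (intro bounded_linear_sum bounded_linear_scaleR_const bounded_linear_inner_left)
    show "range (\<lambda>v. \<Sum>b\<in>B. (v \<bullet> b) *\<^sub>R b) \<subseteq> T"
      using assms B(2) by (auto intro!: subspace_sum subspace_scale)
  qed (rule B(3))
qed

text \<open>The domain \<open>V\<close> is mapped to itself, so that \<open>f \<circ> \<rho>\<close> is again invariant under \<open>\<rho>\<close> on all of \<open>V\<close>.\<close>

definition smooth_retraction :: "'e::euclidean_space set \<Rightarrow> 'e set \<Rightarrow> ('e \<Rightarrow> 'e) \<Rightarrow> bool" where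
  "smooth_retraction V M \<rho> \<longleftrightarrow> Cinf_on V \<rho> \<and> \<rho> ` V \<subseteq> M \<inter> V \<and> (\<forall>x\<in>M \<inter> V. \<rho> x = x)"

lemma smooth_retractionD:
  assumes "smooth_retraction V M \<rho>"
  shows "Cinf_on V \<rho>" "open V" "x \<in> V \<Longrightarrow> \<rho> x \<in> M" "x \<in> V \<Longrightarrow> \<rho> x \<in> V"
    "x \<in> M \<Longrightarrow> x \<in> V \<Longrightarrow> \<rho> x = x"
  using assms Cinf_on_open by (auto simp: smooth_retraction_def)

text \<open>Shrinking the domain to \<open>V0 \<inter> \<rho> -` V0\<close> makes it invariant, since \<open>\<rho>\<close> is idempotent there.\<close>

lemma smooth_retractionI:
  assumes "Cinf_on V0 \<rho>" "\<And>x. x \<in> V0 \<Longrightarrow> \<rho> x \<in> M" "\<And>x. x \<in> M \<Longrightarrow> x \<in> V0 \<Longrightarrow> \<rho> x = x"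
  shows "smooth_retraction (V0 \<inter> \<rho> -` V0) M \<rho>"
  unfolding smooth_retraction_def
  using Cinf_on_subset[OF assms(1) Cinf_on_open_preimage[OF assms(1) Cinf_on_open[OF assms(1)]]]
    assms(2,3) by auto

lemma submanifoldE:
  assumes "submanifold n M" "p \<in> M"
  obtains W T U and f :: "'e::euclidean_space \<Rightarrow> 'e" and g where "open W" "p \<in> W" "subspace T" "dim T = n"
    "openin (top_of_set T) U" "homeomorphism (M \<inter> W) U f g" "smooth_on (M \<inter> W) f" "smooth_on U g"
  using bspec[OF assms(1)[unfolded submanifold_def] assms(2)]
  by (elim exE conjE) (rule that; assumption)

text \<open>If \<open>f\<close> is a chart with inverse \<open>g\<close>, then \<open>g \<circ> f\<close> is a retraction.  Only extensions of \<open>f\<close> and \<open>g\<close> are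
  smooth on open sets, and the extension of \<open>f\<close> may leave the model space \<open>T\<close>; composing with a linear
  projection to \<open>T\<close> repairs this.\<close>

lemma submanifold_smooth_retraction:
  fixes M :: "'e::euclidean_space set"
  assumes "submanifold n M" "p \<in> M" "open Q" "p \<in> Q"
  obtains V \<rho> where "smooth_retraction V M \<rho>" "p \<in> V" "V \<subseteq> Q"
proof -
  obtain W T U and f :: "'e \<Rightarrow> 'e" and g where W: "open W" "p \<in> W" "subspace T" "dim T = n" "openin (top_of_set T) U"
    "homeomorphism (M \<inter> W) U f g" "smooth_on (M \<inter> W) f" "smooth_on U g"
    by (rule submanifoldE[OF assms(1,2)]) (rule that; assumption)
  note hom = W(6)[unfolded homeomorphism_def]
  have pW: "p \<in> M \<inter> W" and fp: "f p \<in> U" using assms(2) W(2) hom by auto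
  obtain U' where U': "open U'" "U = T \<inter> U'" using W(5) by (auto simp: openin_open)
  obtain V1 F where F: "Cinf_on V1 F" "p \<in> V1" "\<And>x. x \<in> V1 \<Longrightarrow> x \<in> M \<inter> W \<Longrightarrow> F x = f x"
    using smooth_onE[OF W(7) pW] by metis
  obtain V2 G where G: "Cinf_on V2 G" "f p \<in> V2" "\<And>x. x \<in> V2 \<Longrightarrow> x \<in> U \<Longrightarrow> G x = g x"
    using smooth_onE[OF W(8) fp] by metis
  obtain P where P: "bounded_linear P" "range P \<subseteq> T" "\<And>x. x \<in> T \<Longrightarrow> P x = x"
    using subspace_linear_retraction[OF W(3)] by metis
  have PF: "Cinf_on V1 (\<lambda>x. P (F x))" by (rule Cinf_on_linear_compose[OF P(1) F(1)])
  define V0 where "V0 = (V1 \<inter> (\<lambda>x. P (F x)) -` (V2 \<inter> U')) \<inter> (W \<inter> Q)"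
  have oV0: "open V0"
    unfolding V0_def using Cinf_on_open[OF G(1)] U' W assms
    by (intro open_Int Cinf_on_open_preimage[OF PF]) auto
  define \<rho> where "\<rho> x = G (P (F x))" for x
  have c: "Cinf_on V0 \<rho>"
    unfolding \<rho>_def by (rule Cinf_on_compose[OF G(1) Cinf_on_subset[OF PF oV0]]) (auto simp: V0_def)
  have 1: "\<rho> x \<in> M" if "x \<in> V0" for x
  proof -
    have "P (F x) \<in> U" "P (F x) \<in> V2" using that P(2) U' by (auto simp: V0_def)
    then show ?thesis using G(3) hom by (auto simp: \<rho>_def)
  qed
  have 2: "\<rho> x = x" if "x \<in> M" "x \<in> V0" for x
  proof -
    have x: "x \<in> M \<inter> W" "x \<in> V1" "P (F x) \<in> V2" using that by (auto simp: V0_def)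
    then have "f x \<in> U" using hom by auto
    moreover have "P (F x) = f x" using F(3)[OF x(2,1)] P(3) U' calculation by auto
    ultimately show ?thesis using G(3) x hom by (auto simp: \<rho>_def)
  qed
  have "P (F p) = f p" using F(3)[OF F(2) pW] P(3) U' fp by auto
  then have "p \<in> V0" using F(2) G(2) fp U' pW assms by (auto simp: V0_def)
  then show thesis
    using that[OF smooth_retractionI[OF c 1 2]] 2[OF assms(2)] by (auto simp: V0_def)
qed

lemma tangent_spaceI:
  assumes "Cinf_on V \<gamma>" "(0::real) \<in> V" "\<gamma> ` V \<subseteq> M" "(\<gamma> has_derivative D) (at 0)"
  shows "D 1 \<in> tangent_space M (\<gamma> 0)"
proof -
  obtain e where e: "e > 0" "ball 0 e \<subseteq> V"
    using open_contains_ball[THEN iffD1, OF Cinf_on_open[OF assms(1)], rule_format, OF assms(2)] by blast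
  then have V: "{- e<..<e} \<subseteq> V" by (simp add: ball_eq_greaterThanLessThan)
  have "D = (\<lambda>t. t *\<^sub>R D 1)"
    by (rule ext) (metis linear_scale[OF has_derivative_linear[OF assms(4)]] mult.right_neutral real_scaleR_def)
  then have "(\<gamma> has_vector_derivative D 1) (at 0)"
    using assms(4) by (simp add: has_vector_derivative_def)
  moreover have "smooth_on {- e<..<e} \<gamma>" by (rule Cinf_on_imp_smooth_on[OF assms(1) V])
  moreover have "\<gamma> ` {- e<..<e} \<subseteq> M" using V assms(3) by blast
  ultimately show ?thesis unfolding tangent_space_def
    by (intro CollectI exI[of _ \<gamma>] exI[of _ e] conjI e(1) refl)
qed

lemma tangent_spaceE:
  assumes "v \<in> tangent_space M p"
  obtains V \<gamma> where "Cinf_on V \<gamma>" "(0::real) \<in> V" "\<gamma> ` V \<subseteq> M" "\<gamma> 0 = p"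
    "(\<gamma> has_derivative (\<lambda>t. t *\<^sub>R v)) (at 0)"
proof -
  obtain \<gamma> e where g: "e > 0" "smooth_on {- e<..<e} \<gamma>" "\<gamma> ` {- e<..<e} \<subseteq> M" "\<gamma> (0::real) = p"
    "(\<gamma> has_vector_derivative v) (at 0)"
    using assms unfolding tangent_space_def mem_Collect_eq by (elim exE conjE) (rule that; assumption)
  show thesis
    by (rule that[OF smooth_on_imp_Cinf_on[OF _ g(2)] _ g(3,4)])
      (use g in \<open>auto simp: has_vector_derivative_def\<close>)
qed

text \<open>Two maps that agree on \<open>M\<close> have the same derivative along tangent vectors, since these are velocities of
  curves in \<open>M\<close>.  An identity that holds on \<open>M\<close> may thus be differentiated in tangent directions.\<close>

lemma tangent_derivative_along:
  assumes v: "v \<in> tangent_space M p" and p: "p \<in> V" "open V"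
    and f: "(f has_derivative f') (at p)" and g: "(g has_derivative g') (at p)"
    and eq: "\<And>q. q \<in> M \<Longrightarrow> q \<in> V \<Longrightarrow> f q = g q"
  shows "f' v = g' v"
proof -
  obtain I \<gamma> where \<gamma>: "Cinf_on I \<gamma>" "(0::real) \<in> I" "\<gamma> ` I \<subseteq> M" "\<gamma> 0 = p"
    "(\<gamma> has_derivative (\<lambda>t. t *\<^sub>R v)) (at 0)"
    using tangent_spaceE[OF v] by metis
  have o: "open (I \<inter> \<gamma> -` V)" by (rule Cinf_on_open_preimage[OF \<gamma>(1) p(2)])
  have 1: "((\<lambda>t. f (\<gamma> t)) has_derivative (\<lambda>t. f' (t *\<^sub>R v))) (at 0)"
    by (rule has_derivative_compose[OF \<gamma>(5)]) (use f \<gamma>(4) in simp)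
  have 2: "((\<lambda>t. g (\<gamma> t)) has_derivative (\<lambda>t. g' (t *\<^sub>R v))) (at 0)"
    by (rule has_derivative_compose[OF \<gamma>(5)]) (use g \<gamma>(4) in simp)
  have "((\<lambda>t. g (\<gamma> t)) has_derivative (\<lambda>t. f' (t *\<^sub>R v))) (at 0)"
    by (rule has_derivative_transform_within_open[OF 1 o]) (use \<gamma> p eq in auto)
  then have "(\<lambda>t. f' (t *\<^sub>R v)) = (\<lambda>t. g' (t *\<^sub>R v))" using 2 has_derivative_unique by blast
  from fun_cong[OF this, of 1] show ?thesis by simp
qed

lemma tangent_space_Int_open:
  assumes "open W" "p \<in> W"
  shows "tangent_space (M \<inter> W) p = tangent_space M p"
proof
  show "tangent_space (M \<inter> W) p \<subseteq> tangent_space M p" unfolding tangent_space_def by blast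
  show "tangent_space M p \<subseteq> tangent_space (M \<inter> W) p"
  proof
    fix v assume "v \<in> tangent_space M p"
    then obtain I \<gamma> where \<gamma>: "Cinf_on I \<gamma>" "(0::real) \<in> I" "\<gamma> ` I \<subseteq> M" "\<gamma> 0 = p"
      "(\<gamma> has_derivative (\<lambda>t. t *\<^sub>R v)) (at 0)"
      using tangent_spaceE by metis
    have o: "open (I \<inter> \<gamma> -` W)" by (rule Cinf_on_open_preimage[OF \<gamma>(1) assms(1)])
    have "1 *\<^sub>R v \<in> tangent_space (M \<inter> W) (\<gamma> 0)"
      by (rule tangent_spaceI[OF Cinf_on_subset[OF \<gamma>(1) o] _ _ \<gamma>(5)]) (use \<gamma> assms in auto)
    then show "v \<in> tangent_space (M \<inter> W) p" using \<gamma>(4) by simp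
  qed
qed

lemma tangent_space_UNIV: "tangent_space UNIV p = UNIV"
proof -
  have "v \<in> tangent_space UNIV p" for v
  proof -
    have "(\<lambda>t. t *\<^sub>R v) 1 \<in> tangent_space UNIV ((\<lambda>t. p + t *\<^sub>R v) 0)"
      by (rule tangent_spaceI[of UNIV])
        (auto intro!: derivative_eq_intros Cinf_on_add Cinf_on_const Cinf_on_scaleR Cinf_on_ident)
    then show ?thesis by simp
  qed
  then show ?thesis by blast
qed

context
  fixes V M :: "'e::euclidean_space set" and \<rho>
  assumes ret: "smooth_retraction V M \<rho>"
begin

lemma retraction_has_derivative: "q \<in> V \<Longrightarrow> (\<rho> has_derivative deriv_at \<rho> q) (at q)"
  by (rule Cinf_on_has_derivative[OF smooth_retractionD(1)[OF ret]])

lemma retraction_deriv_tangent: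
  assumes q: "q \<in> V"
  shows "deriv_at \<rho> q v \<in> tangent_space M (\<rho> q)"
proof -
  have l: "Cinf_on UNIV (\<lambda>t. q + t *\<^sub>R v)"
    by (intro Cinf_on_add Cinf_on_const Cinf_on_scaleR Cinf_on_ident) auto
  have o: "open ((\<lambda>t. q + t *\<^sub>R v) -` V)"
    using Cinf_on_open_preimage[OF l smooth_retractionD(2)[OF ret]] by simp
  have d: "((\<lambda>t. \<rho> (q + t *\<^sub>R v)) has_derivative (\<lambda>t. deriv_at \<rho> q (t *\<^sub>R v))) (at 0)"
    by (rule has_derivative_compose[of "\<lambda>t. q + t *\<^sub>R v"])
      (use q in \<open>auto intro!: derivative_eq_intros retraction_has_derivative\<close>)
  have "deriv_at \<rho> q (1 *\<^sub>R v) \<in> tangent_space M ((\<lambda>t. \<rho> (q + t *\<^sub>R v)) 0)"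
    by (rule tangent_spaceI[OF _ _ _ d], rule Cinf_on_compose[OF smooth_retractionD(1)[OF ret]
        Cinf_on_subset[OF l o]]) (use q smooth_retractionD[OF ret] in auto)
  then show ?thesis by simp
qed

text \<open>A tangent vector \<open>v\<close> is fixed because \<open>\<rho>\<close> fixes curves in \<open>M\<close>; conversely \<open>\<rho>\<close> maps the line \<open>q + t v\<close> to a curve in
  \<open>M\<close> with velocity \<open>d\<rho> v\<close>.\<close>

lemma tangent_space_iff_retraction:
  assumes q: "q \<in> M" "q \<in> V"
  shows "v \<in> tangent_space M q \<longleftrightarrow> deriv_at \<rho> q v = v"
proof
  assume "v \<in> tangent_space M q"
  then show "deriv_at \<rho> q v = v"
    using tangent_derivative_along[OF _ q(2) smooth_retractionD(2)[OF ret] retraction_has_derivative[OF q(2)]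
      has_derivative_ident] smooth_retractionD[OF ret] by blast
next
  assume "deriv_at \<rho> q v = v"
  then show "v \<in> tangent_space M q"
    using retraction_deriv_tangent[OF q(2), of v] smooth_retractionD(5)[OF ret] q by simp
qed

lemma subspace_tangent_space:
  assumes q: "q \<in> M" "q \<in> V"
  shows "subspace (tangent_space M q)"
proof -
  have l: "linear (deriv_at \<rho> q)" by (rule has_derivative_linear[OF retraction_has_derivative[OF q(2)]])
  show ?thesis
    unfolding subspace_def Ball_def tangent_space_iff_retraction[OF q]
    by (simp add: linear_0[OF l] linear_add[OF l] linear_scale[OF l])
qed

lemma deriv_compose_retraction:
  assumes f: "(f has_derivative f') (at q)" and q: "q \<in> M" "q \<in> V"
  shows "deriv_at (\<lambda>x. f (\<rho> x)) q v = f' (deriv_at \<rho> q v)"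
  by (rule fun_cong[OF deriv_at_eq[OF has_derivative_compose[OF retraction_has_derivative[OF q(2)]]]])
    (use f smooth_retractionD(5)[OF ret q] in simp)

text \<open>The derivative within \<open>M\<close> in the definition of \<^const>\<open>cov_deriv\<close> is some linear map that is determined on tangent
  vectors only.  There it agrees with an ordinary derivative.\<close>

lemma deriv_within_tangent:
  assumes W: "open W" "q \<in> W" and q: "q \<in> M" "q \<in> V" and Y: "smooth_on (M \<inter> W) Y"
    and v: "v \<in> tangent_space M q"
  shows "frechet_derivative Y (at q within M) v = deriv_at (\<lambda>x. Y (\<rho> x)) q v"
proof -
  obtain V1 F where F: "Cinf_on V1 F" "q \<in> V1" "\<And>x. x \<in> V1 \<Longrightarrow> x \<in> M \<inter> W \<Longrightarrow> F x = Y x"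
    using smooth_onE[OF Y] W q by (metis IntI)
  have "(F has_derivative deriv_at F q) (at q within M)"
    by (rule has_derivative_at_withinI[OF Cinf_on_has_derivative[OF F(1,2)]])
  note F' = this
  obtain d where d: "d > 0" "ball q d \<subseteq> V1 \<inter> W"
    using open_contains_ball[THEN iffD1, OF open_Int[OF Cinf_on_open[OF F(1)] W(1)], rule_format, of q]
      F(2) W(2) by blast
  have "(Y has_derivative deriv_at F q) (at q within M)"
  proof (rule has_derivative_transform_within[OF F' d(1) q(1)])
    fix x assume "x \<in> M" "dist x q < d"
    moreover have "x \<in> V1 \<inter> W" by (rule subsetD[OF d(2)]) (use calculation in \<open>simp add: dist_commute\<close>)
    ultimately show "F x = Y x" by (intro F(3)) auto
  qed
  then have D: "(Y has_derivative frechet_derivative Y (at q within M)) (at q within M)"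
    using frechet_derivative_works differentiableI by blast
  have "((\<lambda>x. Y (\<rho> x)) has_derivative (\<lambda>v. frechet_derivative Y (at q within M) (deriv_at \<rho> q v))) (at q within V)"
    by (rule has_derivative_in_compose[OF has_derivative_at_withinI[OF retraction_has_derivative[OF q(2)]]],
        rule has_derivative_subset) (use D smooth_retractionD[OF ret] q in auto)
  then have "((\<lambda>x. Y (\<rho> x)) has_derivative (\<lambda>v. frechet_derivative Y (at q within M) (deriv_at \<rho> q v))) (at q)"
    using at_within_open[OF q(2) smooth_retractionD(2)[OF ret]] by simp
  from deriv_at_eq[OF this] show ?thesis
    using v tangent_space_iff_retraction[OF q] by simp
qed

text \<open>\<open>f \<circ> \<rho>\<close> has derivative zero on the whole ball, and the ball is convex.\<close>

lemma tangent_constant_on_ball: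
  assumes f: "Cinf_on V f" and 0: "\<And>q v. q \<in> M \<Longrightarrow> q \<in> V \<Longrightarrow> v \<in> tangent_space M q \<Longrightarrow> deriv_at f q v = 0"
    and b: "ball p e \<subseteq> V" "p \<in> M" and q: "q \<in> M" "q \<in> ball p e"
  shows "f q = f p"
proof -
  have "((\<lambda>x. f (\<rho> x)) has_derivative (\<lambda>v. 0)) (at x within ball p e)" if "x \<in> ball p e" for x
  proof -
    have x: "x \<in> V" using that b by blast
    have "((\<lambda>x. f (\<rho> x)) has_derivative (\<lambda>v. deriv_at f (\<rho> x) (deriv_at \<rho> x v))) (at x)"
      by (rule has_derivative_compose[OF retraction_has_derivative[OF x] Cinf_on_has_derivative[OF f]])
        (rule smooth_retractionD(4)[OF ret x])
    then show ?thesis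
      using 0[OF smooth_retractionD(3,4)[OF ret x] retraction_deriv_tangent[OF x]]
        by (simp add: has_derivative_at_withinI)
  qed
  then have "\<exists>c. \<forall>x\<in>ball p e. f (\<rho> x) = c" by (rule has_derivative_zero_constant[OF convex_ball])
  then obtain c where c: "\<forall>x\<in>ball p e. f (\<rho> x) = c" by blast
  have "e > 0" using q(2) zero_le_dist[of p q] by (simp only: mem_ball)
  then have p: "p \<in> ball p e" by simp
  moreover have "\<rho> p = p" "\<rho> q = q"
    using smooth_retractionD(5)[OF ret] subsetD[OF b(1) p] subsetD[OF b(1) q(2)] b(2) q(1) by auto
  ultimately show ?thesis using c q(2) by metis
qed

end

section \<open>The second fundamental tensor of a Lagrangian submanifold\<close>

lemma closest_point_subspace_eqI:
  fixes S :: "'e::euclidean_space set"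
  assumes S: "subspace S" and y: "y \<in> S" and orth: "\<And>z. z \<in> S \<Longrightarrow> (a - y) \<bullet> z = 0"
  shows "closest_point S a = y"
proof (rule sym, rule closest_point_unique[OF subspace_imp_convex[OF S] closed_subspace[OF S] y])
  show "\<forall>z\<in>S. dist a y \<le> dist a z"
  proof
    fix z assume z: "z \<in> S"
    have o: "(a - y) \<bullet> (y - z) = 0" by (rule orth) (rule subspace_diff[OF S y z])
    have "(norm (a - z))\<^sup>2 = (norm (a - y))\<^sup>2 + (norm (y - z))\<^sup>2"
      using norm_add_Pythagorean[of "a - y" "y - z"] o by (simp add: orthogonal_def)
    then have "(norm (a - y))\<^sup>2 \<le> (norm (a - z))\<^sup>2" by simp
    then show "dist a y \<le> dist a z" unfolding dist_norm by (rule power2_le_imp_le) simp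
  qed
qed

lemma closest_point_subspace:
  fixes S :: "'e::euclidean_space set"
  assumes S: "subspace S"
  shows "closest_point S a \<in> S" "z \<in> S \<Longrightarrow> (a - closest_point S a) \<bullet> z = 0"
proof -
  obtain B where B: "finite B" "B \<subseteq> S" "\<And>x. x \<in> S \<Longrightarrow> (\<Sum>b\<in>B. (x \<bullet> b) *\<^sub>R b) = x"
    using subspace_orthonormal_expansion[OF S] by blast
  define y where "y = (\<Sum>b\<in>B. (a \<bullet> b) *\<^sub>R b)"
  have y: "y \<in> S" unfolding y_def using B(2) by (intro subspace_sum[OF S] subspace_scale[OF S]) auto
  have o: "(a - y) \<bullet> z = 0" if "z \<in> S" for z
  proof -
    have "a \<bullet> z = a \<bullet> (\<Sum>b\<in>B. (z \<bullet> b) *\<^sub>R b)" by (simp add: B(3)[OF that])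
    also have "\<dots> = y \<bullet> z" by (simp add: y_def inner_sum_right inner_sum_left inner_commute mult.commute)
    finally show ?thesis by (simp add: inner_diff_left)
  qed
  have "closest_point S a = y" by (rule closest_point_subspace_eqI[OF S y o])
  then show "closest_point S a \<in> S" "z \<in> S \<Longrightarrow> (a - closest_point S a) \<bullet> z = 0" using y o by auto
qed

lemma tangent_field_extension:
  assumes ret: "smooth_retraction V M \<rho>" and q: "q \<in> M" "q \<in> V" and y: "y \<in> tangent_space M q"
  shows "tangent_field (M \<inter> V) (\<lambda>x. deriv_at \<rho> x y) \<and> deriv_at \<rho> q y = y"
proof
  show "deriv_at \<rho> q y = y" using tangent_space_iff_retraction[OF ret q] y by simp
  show "tangent_field (M \<inter> V) (\<lambda>x. deriv_at \<rho> x y)"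
    unfolding tangent_field_def
  proof (intro conjI ballI)
    show "smooth_on (M \<inter> V) (\<lambda>x. deriv_at \<rho> x y)"
      by (rule Cinf_on_imp_smooth_on[OF Cinf_on_derivative[OF smooth_retractionD(1)[OF ret]]]) auto
    fix x assume "x \<in> M \<inter> V"
    then show "deriv_at \<rho> x y \<in> tangent_space (M \<inter> V) x"
      using retraction_deriv_tangent[OF ret, of x y] smooth_retractionD(5)[OF ret]
        tangent_space_Int_open[OF smooth_retractionD(2)[OF ret]] by auto
  qed
qed

text \<open>The tensor is defined by a description operator, so unique existence has to be shown.  Because the tangent
  space of \<open>N\<close> is the orthogonal sum of \<open>T\<close> and \<open>J T\<close>, the two covariant derivatives differ by the component of
  \<open>D\<^sub>x Y\<close> in \<open>J T\<close>.  This is \<open>J a\<close> for the vector \<open>a\<close> with \<open>a \<bullet> z = D\<^sub>x Y \<bullet> J z\<close>, and it is well defined as soon as the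
  right-hand side does not depend on the extension \<open>Y\<close> of \<open>y\<close>.\<close>

lemma lagr_A_characterization:
  fixes N M :: "'e::euclidean_space set"
  defines "T p \<equiv> tangent_space M p"
  assumes T: "subspace (T p)"
    and TN: "tangent_space N p = {u + J p v | u v. u \<in> T p \<and> v \<in> T p}"
    and add: "\<And>u v. u \<in> T p \<Longrightarrow> v \<in> T p \<Longrightarrow> J p (u + v) = J p u + J p v"
    and scale: "\<And>c v. v \<in> T p \<Longrightarrow> J p (c *\<^sub>R v) = c *\<^sub>R J p v"
    and iso: "\<And>u v. u \<in> T p \<Longrightarrow> v \<in> T p \<Longrightarrow> J p u \<bullet> J p v = u \<bullet> v"
    and orth: "\<And>u v. u \<in> T p \<Longrightarrow> v \<in> T p \<Longrightarrow> u \<bullet> J p v = 0"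
    and ext: "\<exists>W Y. open W \<and> p \<in> W \<and> tangent_field (M \<inter> W) Y \<and> Y p = y"
    and \<beta>: "\<And>W Y z. open W \<Longrightarrow> p \<in> W \<Longrightarrow> tangent_field (M \<inter> W) Y \<Longrightarrow> Y p = y \<Longrightarrow> z \<in> T p \<Longrightarrow>
              frechet_derivative Y (at p within M) x \<bullet> J p z = \<beta> z"
  shows "lagr_A N J M p x y \<in> T p" "z \<in> T p \<Longrightarrow> lagr_A N J M p x y \<bullet> z = \<beta> z"
proof -
  note TS = \<open>subspace (T p)\<close>
  have Jsum: "J p (\<Sum>b\<in>B. c b *\<^sub>R b) = (\<Sum>b\<in>B. c b *\<^sub>R J p b)" if "finite B" "B \<subseteq> T p" for B and c :: "'e \<Rightarrow> real"
    using that
  proof (induction B)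
    case empty
    show ?case using scale[OF subspace_0[OF TS], of 0] by simp
  next
    case (insert b B)
    have "J p (\<Sum>b\<in>insert b B. c b *\<^sub>R b) = J p (c b *\<^sub>R b + (\<Sum>b\<in>B. c b *\<^sub>R b))"
      using insert by simp
    also have "\<dots> = c b *\<^sub>R J p b + J p (\<Sum>b\<in>B. c b *\<^sub>R b)"
      using insert.prems by (subst add) (auto intro!: subspace_scale[OF TS] subspace_sum[OF TS] simp: scale)
    finally show ?case using insert by simp
  qed
  obtain B where B: "finite B" "B \<subseteq> T p" "\<And>x. x \<in> T p \<Longrightarrow> (\<Sum>b\<in>B. (x \<bullet> b) *\<^sub>R b) = x"
    using subspace_orthonormal_expansion[OF TS] by blast
  obtain W0 Y0 where Y0: "open W0" "p \<in> W0" "tangent_field (M \<inter> W0) Y0" "Y0 p = y" using ext by blast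
  note \<beta>0 = \<beta>[OF Y0]
  define a where "a = (\<Sum>b\<in>B. \<beta> b *\<^sub>R b)"
  have aT: "a \<in> T p" unfolding a_def using B(2) by (auto intro!: subspace_scale[OF TS] subspace_sum[OF TS])
  have a: "a \<bullet> z = \<beta> z" if z: "z \<in> T p" for z
  proof -
    let ?D = "frechet_derivative Y0 (at p within M) x"
    have "\<beta> z = ?D \<bullet> J p (\<Sum>b\<in>B. (z \<bullet> b) *\<^sub>R b)" using \<beta>0[OF z] by (simp add: B(3)[OF z])
    also have "\<dots> = (\<Sum>b\<in>B. (z \<bullet> b) * (?D \<bullet> J p b))"
      by (simp add: Jsum[OF B(1,2)] inner_sum_right)
    also have "\<dots> = (\<Sum>b\<in>B. (z \<bullet> b) * \<beta> b)" using \<beta>0 B(2) by (intro sum.cong) auto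
    also have "\<dots> = a \<bullet> z" unfolding a_def inner_sum_left inner_scaleR_left
      by (simp add: inner_commute[of z] mult.commute)
    finally show ?thesis by simp
  qed
  have TNS: "subspace (tangent_space N p)"
    unfolding TN subspace_def
  proof (intro conjI ballI allI)
    show "0 \<in> {u + J p v |u v. u \<in> T p \<and> v \<in> T p}"
      using subspace_0[OF TS] scale[OF subspace_0[OF TS], of 0] by force
    fix c x assume "x \<in> {u + J p v |u v. u \<in> T p \<and> v \<in> T p}"
    then obtain u v where u: "x = u + J p v" "u \<in> T p" "v \<in> T p" by blast
    then have "c *\<^sub>R x = c *\<^sub>R u + J p (c *\<^sub>R v)" by (simp add: scale scaleR_add_right)
    then show "c *\<^sub>R x \<in> {u + J p v |u v. u \<in> T p \<and> v \<in> T p}"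
      using u subspace_scale[OF TS] by blast
    fix x' assume "x' \<in> {u + J p v |u v. u \<in> T p \<and> v \<in> T p}"
    then obtain u' v' where u': "x' = u' + J p v'" "u' \<in> T p" "v' \<in> T p" by blast
    then have "x + x' = (u + u') + J p (v + v')" using u by (simp add: add)
    then show "x + x' \<in> {u + J p v |u v. u \<in> T p \<and> v \<in> T p}"
      using u u' subspace_add[OF TS] by blast
  qed
  have proj: "cov_deriv N M Y p x = cov_deriv M M Y p x + J p a"
    if Y: "open W" "p \<in> W" "tangent_field (M \<inter> W) Y" "Y p = y" for W Y
    unfolding cov_deriv_def T_def[symmetric]
  proof (rule closest_point_subspace_eqI[OF TNS])
    let ?D = "frechet_derivative Y (at p within M) x"
    note c = closest_point_subspace(1)[OF TS, of ?D] closest_point_subspace(2)[OF TS, where a = ?D]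
    show "closest_point (T p) ?D + J p a \<in> tangent_space N p" unfolding TN using c aT by blast
    fix z assume "z \<in> tangent_space N p"
    then obtain u v where uv: "z = u + J p v" "u \<in> T p" "v \<in> T p" unfolding TN by blast
    have "(?D - (closest_point (T p) ?D + J p a)) \<bullet> u = 0"
      using c(2)[OF uv(2)] orth[OF uv(2) aT] by (simp add: inner_diff_left inner_add_left inner_commute[of "J p a" u])
    moreover have "(?D - (closest_point (T p) ?D + J p a)) \<bullet> J p v = 0"
      using orth[OF c(1) uv(3)] iso[OF aT uv(3)] a[OF uv(3)] \<beta>[OF Y uv(3)]
      by (simp add: inner_diff_left inner_add_left)
    ultimately show "(?D - (closest_point (T p) ?D + J p a)) \<bullet> z = 0" by (simp add: uv inner_add_right)
  qed
  have "lagr_A N J M p x y = a"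
    unfolding lagr_A_def
  proof (rule the_equality)
    show "a \<in> tangent_space M p \<and> (\<forall>W Y. open W \<and> p \<in> W \<and> tangent_field (M \<inter> W) Y \<and> Y p = y \<longrightarrow>
           cov_deriv N M Y p x = cov_deriv M M Y p x + J p a)"
      using aT proj unfolding T_def by blast
    fix a' assume a': "a' \<in> tangent_space M p \<and> (\<forall>W Y. open W \<and> p \<in> W \<and> tangent_field (M \<inter> W) Y \<and> Y p = y \<longrightarrow>
           cov_deriv N M Y p x = cov_deriv M M Y p x + J p a')"
    then have a'T: "a' \<in> T p" by (simp add: T_def)
    have "cov_deriv N M Y0 p x = cov_deriv M M Y0 p x + J p a'" using a' Y0 by blast
    then have J: "J p a' = J p a" using proj[OF Y0] by simp
    have "(a' - a) \<bullet> (a' - a) = J p a' \<bullet> J p a' - J p a \<bullet> J p a' - J p a' \<bullet> J p a + J p a \<bullet> J p a"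
      by (simp add: iso aT a'T inner_diff_left inner_diff_right)
    then show "a' = a" by (simp add: J)
  qed
  then show "lagr_A N J M p x y \<in> T p" "z \<in> T p \<Longrightarrow> lagr_A N J M p x y \<bullet> z = \<beta> z" using aT a by auto
qed

section \<open>Unitary frames\<close>

abbreviation mult_i :: "complex^'n::finite \<Rightarrow> complex^'n" where
  "mult_i v \<equiv> \<i> *s v"

lemma inner_mult_i: "mult_i u \<bullet> mult_i v = u \<bullet> v" "mult_i u \<bullet> v = - (u \<bullet> mult_i v)"
  by (simp_all add: inner_vec_def inner_complex_def sum_negf[symmetric] add.commute del: sum_negf)

lemma bounded_linear_mult_i: "bounded_linear (mult_i :: complex^'n::finite \<Rightarrow> _)"
  unfolding linear_conv_bounded_linear[symmetric]
  by (auto intro!: linearI simp: vec_eq_iff algebra_simps)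

lemmas mult_i_simps =
  linear_add[OF bounded_linear.linear[OF bounded_linear_mult_i]]
  linear_diff[OF bounded_linear.linear[OF bounded_linear_mult_i]]
  linear_scale[OF bounded_linear.linear[OF bounded_linear_mult_i]]
  linear_sum[OF bounded_linear.linear[OF bounded_linear_mult_i]]

lemma inner_mult_i_self: "v \<bullet> mult_i v = 0"
  using inner_mult_i(2)[of v v] by (simp add: inner_commute)

lemma orthonormal_family_expansion:
  fixes S :: "'e::euclidean_space set"
  assumes S: "subspace S" and fin: "finite I" "card I = dim S" and f: "\<And>i. i \<in> I \<Longrightarrow> f i \<in> S"
    and on: "\<And>i j. i \<in> I \<Longrightarrow> j \<in> I \<Longrightarrow> f i \<bullet> f j = (if i = j then 1 else 0)" and v: "v \<in> S"
  shows "v = (\<Sum>i\<in>I. (v \<bullet> f i) *\<^sub>R f i)"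
proof -
  have inj: "inj_on f I"
  proof (rule inj_onI)
    fix i j assume "i \<in> I" "j \<in> I" "f i = f j"
    then show "i = j" using on[of i j] on[of i i] by (auto split: if_splits)
  qed
  have po: "pairwise orthogonal (f ` I)"
    unfolding pairwise_def orthogonal_def using on by force
  have n: "norm b = 1" if "b \<in> f ` I" for b using that on by (auto simp: norm_eq_1)
  have ind: "independent (f ` I)"
    by (rule pairwise_orthogonal_independent[OF po]) (use n in force)
  have "span (f ` I) = S"
  proof (rule subset_antisym)
    show "span (f ` I) \<subseteq> S" using f by (intro span_minimal[OF _ S]) auto
    show "S \<subseteq> span (f ` I)"
      by (rule card_ge_dim_independent[OF _ ind]) (use f fin card_image[OF inj] in auto)
  qed
  then have "v = (\<Sum>b\<in>f ` I. (v \<bullet> b) *\<^sub>R b)"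
    using orthonormal_basis_expand[OF po n, of v] v fin(1) by simp
  then show ?thesis by (simp add: sum.reindex[OF inj])
qed

text \<open>A real orthonormal basis of a Lagrangian subspace, together with its image under multiplication by \<open>\<i>\<close>, is an
  orthonormal basis of the complex span.\<close>

lemma unitary_frame_expansion:
  fixes f :: "'i \<Rightarrow> complex^'n::finite"
  assumes S: "subspace S" and fin: "finite I" "2 * card I = dim S"
    and f: "\<And>i. i \<in> I \<Longrightarrow> f i \<in> S" "\<And>i. i \<in> I \<Longrightarrow> mult_i (f i) \<in> S"
    and on: "\<And>i j. i \<in> I \<Longrightarrow> j \<in> I \<Longrightarrow> f i \<bullet> f j = (if i = j then 1 else 0)"
    and lag: "\<And>i j. i \<in> I \<Longrightarrow> j \<in> I \<Longrightarrow> f i \<bullet> mult_i (f j) = 0"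
    and v: "v \<in> S"
  shows "v = (\<Sum>i\<in>I. (v \<bullet> f i) *\<^sub>R f i) + (\<Sum>i\<in>I. (v \<bullet> mult_i (f i)) *\<^sub>R mult_i (f i))"
proof -
  \<comment> \<open>the flag \<open>b\<close> selects the vectors multiplied by \<open>\<i>\<close>\<close>
  define g where "g = (\<lambda>(b, i). if b then mult_i (f i) else f i)"
  have "v = (\<Sum>i\<in>{False, True} \<times> I. (v \<bullet> g i) *\<^sub>R g i)"
    by (rule orthonormal_family_expansion[OF S _ _ _ _ v])
      (use fin f on lag in \<open>auto simp: g_def inner_mult_i card_cartesian_product split: if_splits\<close>)
  also have "\<dots> = (\<Sum>b\<in>{False, True}. \<Sum>i\<in>I. (v \<bullet> g (b, i)) *\<^sub>R g (b, i))"
    by (simp only: sum.cartesian_product case_prod_unfold prod.collapse)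
  finally show ?thesis by (simp add: g_def)
qed

lemma inner_eq_0_span:
  assumes "finite B" "w \<in> span B" "\<And>b. b \<in> B \<Longrightarrow> v \<bullet> b = 0"
  shows "v \<bullet> w = 0"
  using orthogonal_to_span[OF assms(2), of v] assms(3) by (auto simp: orthogonal_def)

section \<open>Consequences of the symmetry of second derivatives\<close>

lemma has_derivative_deriv_apply:
  assumes f: "Cinf_on V f" and g: "Cinf_on V g" and x: "x \<in> V"
  shows "((\<lambda>y. deriv_at f y (g y)) has_derivative
    (\<lambda>u. deriv2_at f x u (g x) + deriv_at f x (deriv_at g x u))) (at x)"
proof -
  have l: "linear (deriv_at f y)" if "y \<in> V" for y
    by (rule has_derivative_linear[OF Cinf_on_has_derivative[OF f that]])
  have e: "(\<Sum>b\<in>Basis. (g y \<bullet> b) *\<^sub>R deriv_at f y b) = deriv_at f y (g y)" if "y \<in> V" for y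
    by (rule linear_basis_expand[OF l[OF that], symmetric])
  have b: "((\<lambda>y. (g y \<bullet> b) *\<^sub>R deriv_at f y b) has_derivative
      (\<lambda>u. (g x \<bullet> b) *\<^sub>R deriv2_at f x u b + (deriv_at g x u \<bullet> b) *\<^sub>R deriv_at f x b)) (at x)" for b
    unfolding deriv2_at_def
    by (rule has_derivative_scaleR[OF has_derivative_inner_left[OF Cinf_on_has_derivative[OF g x]]
        Cinf_on_has_derivative[OF Cinf_on_derivative[OF f] x]])
  have s: "((\<lambda>y. \<Sum>b\<in>Basis. (g y \<bullet> b) *\<^sub>R deriv_at f y b) has_derivative
      (\<lambda>u. \<Sum>b\<in>Basis. (g x \<bullet> b) *\<^sub>R deriv2_at f x u b + (deriv_at g x u \<bullet> b) *\<^sub>R deriv_at f x b)) (at x)"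
    by (rule has_derivative_sum) (rule b)
  have "(\<Sum>b\<in>Basis. (g x \<bullet> b) *\<^sub>R deriv2_at f x u b + (deriv_at g x u \<bullet> b) *\<^sub>R deriv_at f x b)
      = deriv2_at f x u (g x) + deriv_at f x (deriv_at g x u)" for u
  proof -
    have "linear (deriv2_at f x u)"
    proof -
      have "deriv2_at f x u = deriv_at (\<lambda>y. deriv_at f y u) x"
        using deriv2_at_symmetric[OF f x] by (auto simp: deriv2_at_def)
      then show ?thesis
        using has_derivative_linear[OF Cinf_on_has_derivative[OF Cinf_on_derivative[OF f] x]] by simp
    qed
    then show ?thesis
      using linear_basis_expand[of "deriv2_at f x u" "g x"] linear_basis_expand[OF l[OF x], of "deriv_at g x u"]
      by (simp add: sum.distrib)
  qed
  then show ?thesis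
    using has_derivative_transform_within_open[OF s Cinf_on_open[OF f] x e] by simp
qed

lemma deriv2_at_has_derivative:
  "Cinf_on V f \<Longrightarrow> x \<in> V \<Longrightarrow> ((\<lambda>y. deriv_at f y v) has_derivative (\<lambda>u. deriv2_at f x u v)) (at x)"
  unfolding deriv2_at_def by (rule Cinf_on_has_derivative[OF Cinf_on_derivative])

context
  fixes V M :: "'e::euclidean_space set" and \<rho>
  assumes ret: "smooth_retraction V M \<rho>"
begin

text \<open>The common source of the Codazzi equation and of \<open>kernel_valued_derivative\<close>.  Since \<open>f\<close> is invariant under the
  retraction, \<open>df(v) \<bullet> g = 0\<close> holds on \<open>M\<close> for every constant vector \<open>v\<close>.  Its derivative along \<open>x\<close> is
  \<open>D\<^sup>2f(x, v) \<bullet> g + df(v) \<bullet> dg(x) = 0\<close>, and the first term is symmetric.\<close>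

lemma annihilated_derivative_symmetric:
  fixes f g :: "'e \<Rightarrow> 'f::euclidean_space"
  assumes f: "Cinf_on V f" "\<And>x. x \<in> V \<Longrightarrow> f (\<rho> x) = f x" and g: "Cinf_on V g"
    and 0: "\<And>q x. q \<in> M \<Longrightarrow> q \<in> V \<Longrightarrow> x \<in> tangent_space M q \<Longrightarrow> deriv_at f q x \<bullet> g q = 0"
    and q: "q \<in> M" "q \<in> V" and x: "x \<in> tangent_space M q" and y: "y \<in> tangent_space M q"
  shows "deriv_at f q y \<bullet> deriv_at g q x = deriv_at f q x \<bullet> deriv_at g q y"
proof -
  have dr: "deriv_at f q' v = deriv_at f q' (deriv_at \<rho> q' v)" if q': "q' \<in> M" "q' \<in> V" for q' v
  proof -
    have "deriv_at f q' v = deriv_at (\<lambda>x. f (\<rho> x)) q' v"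
      using frechet_derivative_cong_open[OF smooth_retractionD(2)[OF ret] q'(2) f(2)] by simp
    also have "\<dots> = deriv_at f q' (deriv_at \<rho> q' v)"
      by (rule deriv_compose_retraction[OF ret Cinf_on_has_derivative[OF f(1) q'(2)] q'])
    finally show ?thesis .
  qed
  have z: "deriv_at f q' v \<bullet> g q' = 0" if q': "q' \<in> M" "q' \<in> V" for q' v
    using 0[OF q', of "deriv_at \<rho> q' v"] retraction_deriv_tangent[OF ret q'(2), of v] dr[OF q', of v]
      smooth_retractionD(5)[OF ret q'] by simp
  have d: "((\<lambda>q'. deriv_at f q' v \<bullet> g q') has_derivative
      (\<lambda>u. deriv_at f q v \<bullet> deriv_at g q u + deriv2_at f q u v \<bullet> g q)) (at q)" for v
    by (rule has_derivative_inner[OF deriv2_at_has_derivative[OF f(1) q(2)] Cinf_on_has_derivative[OF g q(2)]])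
  have e: "deriv_at f q v \<bullet> deriv_at g q u + deriv2_at f q u v \<bullet> g q = 0" if "u \<in> tangent_space M q" for u v
    by (rule tangent_derivative_along[OF that q(2) smooth_retractionD(2)[OF ret] d has_derivative_const z])
  show ?thesis
    using e[OF x, of y] e[OF y, of x] deriv2_at_symmetric[OF f(1) q(2), of x y] by simp
qed

text \<open>The Lie bracket of tangent fields is tangent: differentiate \<open>d\<rho>(f) = f\<close> along \<open>g\<close>, and conversely, and subtract;
  the second derivatives of \<open>\<rho>\<close> cancel.\<close>

lemma tangent_commutator:
  assumes f: "Cinf_on V f" "\<And>q. q \<in> M \<Longrightarrow> q \<in> V \<Longrightarrow> f q \<in> tangent_space M q"
    and g: "Cinf_on V g" "\<And>q. q \<in> M \<Longrightarrow> q \<in> V \<Longrightarrow> g q \<in> tangent_space M q"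
    and q: "q \<in> M" "q \<in> V"
  shows "deriv_at g q (f q) - deriv_at f q (g q) \<in> tangent_space M q"
proof -
  note \<rho> = smooth_retractionD(1)[OF ret]
  have 1: "deriv2_at \<rho> q u (f q) + deriv_at \<rho> q (deriv_at f q u) = deriv_at f q u"
    if f: "Cinf_on V f" "\<And>q. q \<in> M \<Longrightarrow> q \<in> V \<Longrightarrow> f q \<in> tangent_space M q" and u: "u \<in> tangent_space M q" for f u
    by (rule tangent_derivative_along[OF u q(2) smooth_retractionD(2)[OF ret]
        has_derivative_deriv_apply[OF \<rho> f(1) q(2)] Cinf_on_has_derivative[OF f(1) q(2)]])
      (use tangent_space_iff_retraction[OF ret] f in auto)
  have l: "linear (deriv_at \<rho> q)" by (rule has_derivative_linear[OF retraction_has_derivative[OF ret q(2)]])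
  show ?thesis
    unfolding tangent_space_iff_retraction[OF ret q] linear_diff[OF l]
  proof -
    have "deriv_at f q (g q) - deriv_at \<rho> q (deriv_at f q (g q)) =
        deriv_at g q (f q) - deriv_at \<rho> q (deriv_at g q (f q))"
      using 1[OF f g(2)[OF q]] 1[OF g f(2)[OF q]] deriv2_at_symmetric[OF \<rho> q(2), of "f q" "g q"]
      by (metis add_diff_cancel_right')
    then show "deriv_at \<rho> q (deriv_at g q (f q)) - deriv_at \<rho> q (deriv_at f q (g q)) =
        deriv_at g q (f q) - deriv_at f q (g q)"
      by (simp add: algebra_simps)
  qed
qed

end

section \<open>The structure equations of an adapted frame\<close>

text \<open>The frame is indexed by numerals; its first index is not to be rewritten to \<^term>\<open>Suc 0\<close>.\<close>

declare One_nat_def [simp del]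

lemma sum_1_4: "sum f {1..4::nat} = f 1 + f 2 + f 3 + f 4" for f :: "nat \<Rightarrow> 'b::ab_group_add"
  by (simp add: numeral_eq_Suc One_nat_def algebra_simps)

locale adapted_nbhd =
  fixes M W V :: "(complex^4) set" and X :: "nat \<Rightarrow> complex^4 \<Rightarrow> complex^4" and r \<rho>
  assumes lag: "lagrangian UNIV std_J M"
    and frame: "adapted_frame UNIV std_J M W X r"
    and integrable: "integrable_distribution 2 (M \<inter> W) (\<lambda>q. span {X 1 q, X 2 q})"
    and not_contained: "\<And>q. q \<in> M \<inter> W \<Longrightarrow> cov_deriv M M (X 1) q (X 1 q) \<notin> span {X 1 q, X 2 q}"
    and W: "open W" and ret: "smooth_retraction V M \<rho>" and VW: "V \<subseteq> W"
begin

abbreviation T :: "complex^4 \<Rightarrow> (complex^4) set" where "T q \<equiv> tangent_space M q"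

text \<open>The frame, extended from \<open>M\<close> to an open subset of the ambient space by means of the retraction.\<close>

definition Xr :: "nat \<Rightarrow> complex^4 \<Rightarrow> complex^4" where "Xr i = (\<lambda>x. X i (\<rho> x))"

abbreviation dX :: "nat \<Rightarrow> complex^4 \<Rightarrow> complex^4 \<Rightarrow> complex^4" where "dX i \<equiv> deriv_at (Xr i)"

lemma lagrangian_orth: "q \<in> M \<Longrightarrow> u \<in> T q \<Longrightarrow> v \<in> T q \<Longrightarrow> u \<bullet> mult_i v = 0"
  using lag by (simp add: lagrangian_def std_J_def)

lemma frame_at:
  assumes "q \<in> M" "q \<in> V"
  shows "(\<forall>i\<in>{1..4}. \<forall>j\<in>{1..4}. X i q \<bullet> X j q = (if i = j then 1 else 0)) \<and>
        r q > 0 \<and>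
        lagr_A UNIV std_J M q (X 1 q) (X 1 q) = r q *\<^sub>R X 1 q \<and>
        lagr_A UNIV std_J M q (X 1 q) (X 2 q) = - r q *\<^sub>R X 2 q \<and>
        lagr_A UNIV std_J M q (X 2 q) (X 1 q) = - r q *\<^sub>R X 2 q \<and>
        lagr_A UNIV std_J M q (X 2 q) (X 2 q) = - r q *\<^sub>R X 1 q \<and>
        (\<forall>i\<in>{1..4}. \<forall>j\<in>{1..4}. i \<in> {3,4} \<or> j \<in> {3,4} \<longrightarrow>
           lagr_A UNIV std_J M q (X i q) (X j q) = 0)"
  by (rule bspec[OF conjunct2[OF frame[unfolded adapted_frame_def]]]) (use assms VW in auto)

lemma frame_orthonormal:
  "q \<in> M \<Longrightarrow> q \<in> V \<Longrightarrow> i \<in> {1..4} \<Longrightarrow> j \<in> {1..4} \<Longrightarrow> X i q \<bullet> X j q = (if i = j then 1 else 0)"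
  by (rule bspec[OF bspec[OF conjunct1[OF frame_at]]])

lemma frame_tangent:
  assumes "q \<in> M" "q \<in> V" "i \<in> {1..4}" shows "X i q \<in> T q"
proof -
  have "q \<in> W" using assms VW by blast
  then show ?thesis
    using bspec[OF conjunct1[OF frame[unfolded adapted_frame_def]] assms(3)] assms(1)
      tangent_space_Int_open[OF W, of q M] by (auto simp: tangent_field_def)
qed

lemma frame_smooth:
  assumes "i \<in> {1..4}" shows "smooth_on (M \<inter> W) (X i)"
  using bspec[OF conjunct1[OF frame[unfolded adapted_frame_def]] assms] by (simp add: tangent_field_def)

lemmas retraction_facts = smooth_retractionD[OF ret]

lemma tangent_subspace: "q \<in> M \<Longrightarrow> q \<in> V \<Longrightarrow> subspace (T q)"
  by (rule subspace_tangent_space[OF ret])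

lemma Xr_Cinf: "i \<in> {1..4} \<Longrightarrow> Cinf_on V (Xr i)"
  unfolding Xr_def
  by (rule Cinf_on_smooth_compose[OF frame_smooth retraction_facts(1)]) (use retraction_facts VW in auto)

lemma Xr_eq: "q \<in> M \<Longrightarrow> q \<in> V \<Longrightarrow> Xr i q = X i q"
  by (simp add: Xr_def retraction_facts)

lemma Xr_ret: "x \<in> V \<Longrightarrow> Xr i (\<rho> x) = Xr i x"
  by (simp add: Xr_def retraction_facts)

lemma dX_has_derivative: "i \<in> {1..4} \<Longrightarrow> q \<in> V \<Longrightarrow> (Xr i has_derivative dX i q) (at q)"
  by (rule Cinf_on_has_derivative[OF Xr_Cinf])

lemma frame_expansion:
  assumes q: "q \<in> M" "q \<in> V"
  shows "v = (\<Sum>i\<in>{1..4}. (v \<bullet> X i q) *\<^sub>R X i q) + (\<Sum>i\<in>{1..4}. (v \<bullet> mult_i (X i q)) *\<^sub>R mult_i (X i q))"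
  by (rule unitary_frame_expansion[where S = UNIV])
    (use q frame_orthonormal frame_tangent lagrangian_orth in \<open>auto simp: dim_UNIV\<close>)

lemma tangent_expansion:
  assumes q: "q \<in> M" "q \<in> V" and v: "v \<in> T q"
  shows "v = (\<Sum>i\<in>{1..4}. (v \<bullet> X i q) *\<^sub>R X i q)"
  using frame_expansion[OF q, of v] lagrangian_orth[OF q(1) v frame_tangent[OF q]] by simp

lemma tangentI:
  assumes q: "q \<in> M" "q \<in> V" and v: "\<And>i. i \<in> {1..4} \<Longrightarrow> v \<bullet> mult_i (X i q) = 0"
  shows "v \<in> T q"
proof -
  have "v = (\<Sum>i\<in>{1..4}. (v \<bullet> X i q) *\<^sub>R X i q)" using frame_expansion[OF q, of v] v by simp
  also have "\<dots> \<in> T q"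
    using frame_tangent[OF q] by (intro subspace_sum subspace_scale tangent_subspace q) auto
  finally show ?thesis .
qed

lemma UNIV_decomposition:
  assumes q: "q \<in> M" "q \<in> V"
  shows "tangent_space UNIV q = {u + std_J q v | u v. u \<in> T q \<and> v \<in> T q}"
proof -
  have "\<exists>u v. x = u + std_J q v \<and> u \<in> T q \<and> v \<in> T q" for x
  proof (intro exI conjI)
    show "x = (\<Sum>i\<in>{1..4}. (x \<bullet> X i q) *\<^sub>R X i q) + std_J q (\<Sum>i\<in>{1..4}. (x \<bullet> mult_i (X i q)) *\<^sub>R X i q)"
      using frame_expansion[OF q, of x] by (simp add: std_J_def mult_i_simps)
  qed (use frame_tangent[OF q] in \<open>auto intro!: subspace_sum subspace_scale tangent_subspace q\<close>)
  then show ?thesis by (auto simp: tangent_space_UNIV)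
qed

text \<open>For a tangent field \<open>Y\<close> with value \<open>y\<close> the product \<open>Y \<bullet> \<i> X k\<close> vanishes on \<open>M\<close>.  Differentiating it along \<open>x\<close>
  expresses the normal component of \<open>D\<^sub>x Y\<close> by \<open>y\<close> and the derivative of the frame only.\<close>

lemma lagr_A_frame:
  assumes q: "q \<in> M" "q \<in> V" and x: "x \<in> T q" and y: "y \<in> T q" and k: "k \<in> {1..4}"
  shows "lagr_A UNIV std_J M q x y \<bullet> X k q = mult_i y \<bullet> dX k q x"
proof -
  \<comment> \<open>the linear form that takes the required values on the frame\<close>
  define \<beta> where "\<beta> z = (\<Sum>k\<in>{1..4}. (mult_i y \<bullet> dX k q x) * (z \<bullet> X k q))" for z
  have "lagr_A UNIV std_J M q x y \<bullet> X k q = \<beta> (X k q)"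
  proof (rule lagr_A_characterization(2)[where M = M and p = q and N = UNIV and J = std_J and \<beta> = \<beta>
        and x = x and y = y, OF tangent_subspace[OF q] UNIV_decomposition[OF q]])
    show "\<exists>W Y. open W \<and> q \<in> W \<and> tangent_field (M \<inter> W) Y \<and> Y q = y"
      using tangent_field_extension[OF ret q y] retraction_facts(2) q by blast
    fix W' Y z
    assume Y: "open W'" "q \<in> W'" "tangent_field (M \<inter> W') Y" "Y q = y" and z: "z \<in> T q"
    have sY: "smooth_on (M \<inter> W') Y" using Y(3) by (simp add: tangent_field_def)
    have tY: "Y q' \<in> T q'" if "q' \<in> M" "q' \<in> W'" for q'
      using Y(3) tangent_space_Int_open[OF Y(1) that(2)] that by (auto simp: tangent_field_def)
    let ?V = "V \<inter> \<rho> -` W'"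
    have oV: "open ?V" by (rule Cinf_on_open_preimage[OF retraction_facts(1) Y(1)])
    have qV: "q \<in> ?V" using q Y retraction_facts by auto
    have cY: "Cinf_on ?V (\<lambda>x. Y (\<rho> x))"
      by (rule Cinf_on_smooth_compose[OF sY Cinf_on_subset[OF retraction_facts(1) oV]]) (use retraction_facts in auto)
    let ?D = "deriv_at (\<lambda>x. Y (\<rho> x)) q x"
    have D: "frechet_derivative Y (at q within M) x = ?D"
      by (rule deriv_within_tangent[OF ret Y(1,2) q sY x])
    have DX: "?D \<bullet> mult_i (X k q) = mult_i y \<bullet> dX k q x" if k: "k \<in> {1..4}" for k
    proof -
      have d: "((\<lambda>q. Y (\<rho> q) \<bullet> mult_i (Xr k q)) has_derivative
          (\<lambda>u. Y (\<rho> q) \<bullet> mult_i (dX k q u) + deriv_at (\<lambda>x. Y (\<rho> x)) q u \<bullet> mult_i (Xr k q))) (at q)"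
        by (intro has_derivative_inner Cinf_on_has_derivative[OF cY qV]
            bounded_linear.has_derivative[OF bounded_linear_mult_i] dX_has_derivative k q(2))
      have e: "Y (\<rho> q') \<bullet> mult_i (Xr k q') = 0" if "q' \<in> M" "q' \<in> ?V" for q'
      proof -
        have "\<rho> q' = q'" "q' \<in> V" "q' \<in> W'" using that retraction_facts(5)[of q'] by auto
        then show ?thesis
          using lagrangian_orth[OF that(1) tY[OF that(1)] frame_tangent[OF that(1) _ k]] by (simp add: Xr_eq that(1))
      qed
      have "Y (\<rho> q) \<bullet> mult_i (dX k q x) + ?D \<bullet> mult_i (Xr k q) = 0"
        by (rule tangent_derivative_along[OF x qV oV d has_derivative_const e])
      then have "y \<bullet> mult_i (dX k q x) + ?D \<bullet> mult_i (X k q) = 0"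
        using Y(4) q by (simp add: retraction_facts Xr_eq)
      then show ?thesis by (simp add: inner_mult_i)
    qed
    have "?D \<bullet> mult_i z = ?D \<bullet> mult_i (\<Sum>k\<in>{1..4}. (z \<bullet> X k q) *\<^sub>R X k q)"
      using tangent_expansion[OF q z] by simp
    also have "\<dots> = (\<Sum>k\<in>{1..4}. (z \<bullet> X k q) * (?D \<bullet> mult_i (X k q)))"
      by (simp add: mult_i_simps inner_sum_right)
    also have "\<dots> = \<beta> z" unfolding \<beta>_def by (intro sum.cong) (auto simp: DX)
    finally show "frechet_derivative Y (at q within M) x \<bullet> std_J q z = \<beta> z"
      unfolding D std_J_def .
  qed (use lagrangian_orth[OF q(1)] frame_tangent[OF q k] in \<open>auto simp: std_J_def mult_i_simps inner_mult_i\<close>)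
  also have "\<dots> = (\<Sum>j\<in>{1..4}. if k = j then mult_i y \<bullet> dX j q x else 0)"
    unfolding \<beta>_def by (intro sum.cong) (auto simp: frame_orthonormal[OF q k])
  also have "\<dots> = mult_i y \<bullet> dX k q x" using k by (simp add: sum.delta)
  finally show ?thesis .
qed

lemma second_form_bilinear:
  assumes q: "q \<in> M" "q \<in> V" and x: "x \<in> T q" and z: "z \<in> T q" and k: "k \<in> {1..4}"
  shows "mult_i z \<bullet> dX k q x = (\<Sum>i\<in>{1..4}. \<Sum>j\<in>{1..4}. (x \<bullet> X i q) * (z \<bullet> X j q) *
    (lagr_A UNIV std_J M q (X i q) (X j q) \<bullet> X k q))"
proof -
  have l: "linear (dX k q)" by (rule has_derivative_linear[OF dX_has_derivative[OF k q(2)]])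
  have "mult_i z \<bullet> dX k q x = mult_i (\<Sum>j\<in>{1..4}. (z \<bullet> X j q) *\<^sub>R X j q) \<bullet> dX k q (\<Sum>i\<in>{1..4}. (x \<bullet> X i q) *\<^sub>R X i q)"
    using tangent_expansion[OF q x] tangent_expansion[OF q z] by simp
  also have "\<dots> = (\<Sum>i\<in>{1..4}. \<Sum>j\<in>{1..4}. (x \<bullet> X i q) * (z \<bullet> X j q) * (mult_i (X j q) \<bullet> dX k q (X i q)))"
    unfolding linear_sum[OF l] linear_scale[OF l] mult_i_simps inner_sum_left inner_sum_right
    by (intro sum.cong refl) (simp add: algebra_simps)
  also have "\<dots> = (\<Sum>i\<in>{1..4}. \<Sum>j\<in>{1..4}. (x \<bullet> X i q) * (z \<bullet> X j q) *
      (lagr_A UNIV std_J M q (X i q) (X j q) \<bullet> X k q))"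
    by (intro sum.cong refl) (simp add: lagr_A_frame[OF q frame_tangent[OF q] frame_tangent[OF q] k])
  finally show ?thesis .
qed

lemma second_form:
  assumes q: "q \<in> M" "q \<in> V" and x: "x \<in> T q" and z: "z \<in> T q"
  shows "mult_i z \<bullet> dX 1 q x = r q * ((x \<bullet> X 1 q) * (z \<bullet> X 1 q) - (x \<bullet> X 2 q) * (z \<bullet> X 2 q))"
    "mult_i z \<bullet> dX 2 q x = - r q * ((x \<bullet> X 1 q) * (z \<bullet> X 2 q) + (x \<bullet> X 2 q) * (z \<bullet> X 1 q))"
    "a \<in> {3, 4} \<Longrightarrow> mult_i z \<bullet> dX a q x = 0"
proof -
  have A: "lagr_A UNIV std_J M q (X 1 q) (X 1 q) = r q *\<^sub>R X 1 q"
        "lagr_A UNIV std_J M q (X 1 q) (X 2 q) = - r q *\<^sub>R X 2 q"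
        "lagr_A UNIV std_J M q (X 2 q) (X 1 q) = - r q *\<^sub>R X 2 q"
        "lagr_A UNIV std_J M q (X 2 q) (X 2 q) = - r q *\<^sub>R X 1 q"
    and A0: "\<And>i j. i \<in> {1..4} \<Longrightarrow> j \<in> {1..4} \<Longrightarrow> i \<in> {3,4} \<or> j \<in> {3,4} \<Longrightarrow>
           lagr_A UNIV std_J M q (X i q) (X j q) = 0"
    using frame_at[OF q] by blast+
  have A0': "lagr_A UNIV std_J M q (X i q) (X j q) = 0" if "i \<in> {1,2,3,4} \<and> j \<in> {3,4} \<or> i \<in> {3,4} \<and> j \<in> {1,2,3,4}" for i j
    by (rule A0) (use that in auto)
  note o = frame_orthonormal[OF q]
  have k: "(1::nat) \<in> {1..4}" "(2::nat) \<in> {1..4}" "(3::nat) \<in> {1..4}" "(4::nat) \<in> {1..4}" by auto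
  show "mult_i z \<bullet> dX 1 q x = r q * ((x \<bullet> X 1 q) * (z \<bullet> X 1 q) - (x \<bullet> X 2 q) * (z \<bullet> X 2 q))"
    unfolding second_form_bilinear[OF q x z k(1)] sum_1_4
    by (simp add: A A0' o algebra_simps)
  show "mult_i z \<bullet> dX 2 q x = - r q * ((x \<bullet> X 1 q) * (z \<bullet> X 2 q) + (x \<bullet> X 2 q) * (z \<bullet> X 1 q))"
    unfolding second_form_bilinear[OF q x z k(2)] sum_1_4
    by (simp add: A A0' o algebra_simps)
  assume "a \<in> {3, 4}"
  then have a: "a \<in> {1..4}" "a \<noteq> 1" "a \<noteq> 2" by auto
  show "mult_i z \<bullet> dX a q x = 0"
    unfolding second_form_bilinear[OF q x z a(1)] sum_1_4
    using a(2,3) by (simp add: A A0' o[OF k(1) a(1)] o[OF k(2) a(1)] algebra_simps)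
qed

lemma frame_derivative_antisym:
  assumes "q \<in> M" "q \<in> V" "i \<in> {1..4}" "j \<in> {1..4}"
  shows "dX i q v \<bullet> X j q = - (X i q \<bullet> dX j q v)"
proof -
  have d: "((\<lambda>x. Xr i x \<bullet> Xr j x) has_derivative (\<lambda>v. Xr i q \<bullet> dX j q v + dX i q v \<bullet> Xr j q)) (at q)"
    by (intro has_derivative_inner dX_has_derivative assms)
  have c: "((\<lambda>x. Xr i x \<bullet> Xr j x) has_derivative (\<lambda>v. 0)) (at q)"
    by (rule has_derivative_transform_within_open[OF has_derivative_const retraction_facts(2) assms(2)])
      (auto simp: Xr_def retraction_facts frame_orthonormal[OF _ _ assms(3,4)])
  show ?thesis using fun_cong[OF has_derivative_unique[OF d c], of v] by (simp add: Xr_eq assms)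
qed

text \<open>Fields in the kernel of \<open>A\<close> have no normal derivative.\<close>

lemma kernel_derivative_tangent:
  assumes q: "q \<in> M" "q \<in> V" and x: "x \<in> T q" and a: "a \<in> {3, 4}"
  shows "dX a q x \<in> T q"
  by (rule tangentI[OF q]) (use second_form(3)[OF q x frame_tangent[OF q] a] in \<open>auto simp: inner_commute\<close>)

text \<open>The derivative of \<open>X a\<close> is tangent, hence annihilated by \<open>\<i> X k\<close> on \<open>M\<close>; now second derivatives are symmetric.\<close>

lemma codazzi:
  assumes q: "q \<in> M" "q \<in> V" and x: "x \<in> T q" and y: "y \<in> T q" and a: "a \<in> {3, 4}" and k: "k \<in> {1..4}"
  shows "mult_i (dX a q y) \<bullet> dX k q x = mult_i (dX a q x) \<bullet> dX k q y"
proof -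
  have a': "a \<in> {1..4}" using a by auto
  have g: "Cinf_on V (\<lambda>x. mult_i (Xr k x))"
    by (rule Cinf_on_linear_compose[OF bounded_linear_mult_i Xr_Cinf[OF k]])
  have dg: "deriv_at (\<lambda>x. mult_i (Xr k x)) q v = mult_i (dX k q v)" for v
    using deriv_at_eq[OF bounded_linear.has_derivative[OF bounded_linear_mult_i dX_has_derivative[OF k q(2)]]] by simp
  have "dX a q y \<bullet> mult_i (dX k q x) = dX a q x \<bullet> mult_i (dX k q y)"
    unfolding dg[symmetric]
  proof (rule annihilated_derivative_symmetric[OF ret Xr_Cinf[OF a'] Xr_ret g _ q x y])
    fix q x assume "q \<in> M" "q \<in> V" "x \<in> T q"
    then show "dX a q x \<bullet> mult_i (Xr k q) = 0"
      using lagrangian_orth kernel_derivative_tangent[OF _ _ _ a] frame_tangent k by (simp add: Xr_eq)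
  qed
  then show ?thesis by (simp add: inner_mult_i)
qed

text \<open>The left factor is the Lie bracket of \<open>X 1\<close> and \<open>X 2\<close>, which is tangent to the integral surface through \<open>q\<close>.\<close>

lemma horizontal_torsion_free:
  assumes q: "q \<in> M" "q \<in> V" and a: "a \<in> {3, 4}"
  shows "(dX 2 q (X 1 q) - dX 1 q (X 2 q)) \<bullet> X a q = 0"
proof -
  obtain S where S: "submanifold 2 S" "q \<in> S" "S \<subseteq> M \<inter> W" "\<And>q'. q' \<in> S \<Longrightarrow> tangent_space S q' = span {X 1 q', X 2 q'}"
  proof -
    have "q \<in> M \<inter> W" using q VW by blast
    from bspec[OF integrable[unfolded integrable_distribution_def] this]
    obtain S where S: "submanifold 2 S" "q \<in> S" "S \<subseteq> M \<inter> W" "\<forall>q'\<in>S. tangent_space S q' = span {X 1 q', X 2 q'}"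
      by (elim exE conjE)
    show thesis by (rule that[OF S(1-3)]) (rule bspec[OF S(4)])
  qed
  obtain V' \<rho>' where V': "smooth_retraction V' S \<rho>'" "q \<in> V'" "V' \<subseteq> V"
    using submanifold_smooth_retraction[OF S(1,2) retraction_facts(2) q(2)] by metis
  have c: "Cinf_on V' (Xr i)" if "i \<in> {1..4}" for i
    by (rule Cinf_on_subset[OF Xr_Cinf[OF that] smooth_retractionD(2)[OF V'(1)] V'(3)])
  have t: "Xr i q' \<in> tangent_space S q'" if "i \<in> {1, 2}" "q' \<in> S" "q' \<in> V'" for i q'
    using that S(3) V'(3) Xr_eq[of q' i] unfolding S(4)[OF that(2)] by (auto intro: span_base)
  have "dX 2 q (Xr 1 q) - dX 1 q (Xr 2 q) \<in> tangent_space S q"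
    by (rule tangent_commutator[OF V'(1) c _ c _ S(2) V'(2)]) (use t in auto)
  then have w: "dX 2 q (X 1 q) - dX 1 q (X 2 q) \<in> span {X 1 q, X 2 q}"
    by (simp add: S(2,4) Xr_eq q)
  have "X a q \<bullet> (dX 2 q (X 1 q) - dX 1 q (X 2 q)) = 0"
    by (rule inner_eq_0_span[OF _ w]) (use frame_orthonormal[OF q] a in auto)
  then show ?thesis by (simp add: inner_commute)
qed

text \<open>The linear form \<open>\<lambda>\<close> on the kernel of \<open>A\<close>, evaluated at \<open>X a\<close>; by lemma \<open>kernel_derivative\<close> it is the factor by which
  the kernel field \<open>X a\<close> contracts the complementary plane.\<close>

definition lam :: "nat \<Rightarrow> complex^4 \<Rightarrow> real" where "lam a q = dX 1 q (X 1 q) \<bullet> X a q"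

text \<open>In the basis \<open>X 1, X 2\<close> the form \<open>A\<close> is the complex quadratic form \<open>r (x - \<i> y)\<^sup>2\<close> up to identification, and the
  Codazzi equation says that the derivative of \<open>X a\<close> is self-adjoint for it.  Such an endomorphism is multiplication by a
  complex number, and integrability makes this number real.\<close>

lemma kernel_derivative:
  assumes q: "q \<in> M" "q \<in> V" and a: "a \<in> {3, 4}" and x: "x \<in> T q"
  shows "dX a q x \<bullet> X 1 q = - lam a q * (x \<bullet> X 1 q)" "dX a q x \<bullet> X 2 q = - lam a q * (x \<bullet> X 2 q)"
proof -
  have a': "a \<in> {1..4}" using a by auto
  have k: "(1::nat) \<in> {1..4}" "(2::nat) \<in> {1..4}" "(3::nat) \<in> {1..4}" "(4::nat) \<in> {1..4}" by auto
  have r: "r q > 0" using frame_at[OF q] by blast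
  note tX = frame_tangent[OF q] note o = frame_orthonormal[OF q]
  note kt = kernel_derivative_tangent[OF q _ a]
  \<comment> \<open>Codazzi in coordinates\<close>
  have C1: "(dX a q y \<bullet> X 1 q) * (x \<bullet> X 1 q) - (dX a q y \<bullet> X 2 q) * (x \<bullet> X 2 q) =
        (dX a q x \<bullet> X 1 q) * (y \<bullet> X 1 q) - (dX a q x \<bullet> X 2 q) * (y \<bullet> X 2 q)"
    and C2: "(dX a q y \<bullet> X 2 q) * (x \<bullet> X 1 q) + (dX a q y \<bullet> X 1 q) * (x \<bullet> X 2 q) =
        (dX a q x \<bullet> X 2 q) * (y \<bullet> X 1 q) + (dX a q x \<bullet> X 1 q) * (y \<bullet> X 2 q)"
    if "x \<in> T q" "y \<in> T q" for x y
    using codazzi[OF q that a k(1)] codazzi[OF q that a k(2)] r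
    by (simp_all add: second_form[OF q that(1) kt[OF that(2)]] second_form[OF q that(2) kt[OF that(1)]] mult.commute)
  \<comment> \<open>along the kernel itself: test against \<open>x = X 1\<close>\<close>
  have K: "dX a q (X b q) \<bullet> X 1 q = 0" "dX a q (X b q) \<bullet> X 2 q = 0" if b: "b \<in> {3, 4}" for b
  proof -
    have b': "b \<in> {1..4}" using b by auto
    show "dX a q (X b q) \<bullet> X 1 q = 0" "dX a q (X b q) \<bullet> X 2 q = 0"
      using C1[OF tX[OF k(1)] tX[OF b']] C2[OF tX[OF k(1)] tX[OF b']] b
      by (auto simp: o)
  qed
  \<comment> \<open>on the plane \<open>N\<^sub>1\<close>: the matrix commutes with the rotation by a right angle\<close>
  have D: "dX a q (X 2 q) \<bullet> X 1 q = - (dX a q (X 1 q) \<bullet> X 2 q)" "dX a q (X 2 q) \<bullet> X 2 q = dX a q (X 1 q) \<bullet> X 1 q"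
    using C1[OF tX[OF k(1)] tX[OF k(2)]] C2[OF tX[OF k(1)] tX[OF k(2)]] by (simp_all add: o)
  \<comment> \<open>integrability: the matrix is symmetric, which together with the previous step leaves a multiple of the identity\<close>
  have E: "dX a q (X 2 q) \<bullet> X 1 q = dX a q (X 1 q) \<bullet> X 2 q"
    using horizontal_torsion_free[OF q a] frame_derivative_antisym[OF q a' k(1)] frame_derivative_antisym[OF q a' k(2)]
    by (simp add: inner_diff_left inner_diff_right inner_commute)
  have L: "dX a q (X 1 q) \<bullet> X 1 q = - lam a q"
    using frame_derivative_antisym[OF q a' k(1)] by (simp add: lam_def inner_commute)
  have l: "linear (dX a q)" by (rule has_derivative_linear[OF dX_has_derivative[OF a' q(2)]])
  have "dX a q x = dX a q (\<Sum>i\<in>{1..4}. (x \<bullet> X i q) *\<^sub>R X i q)" using tangent_expansion[OF q x] by simp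
  also have "\<dots> = (\<Sum>i\<in>{1..4}. (x \<bullet> X i q) *\<^sub>R dX a q (X i q))" by (simp add: linear_sum[OF l] linear_scale[OF l])
  finally have e: "dX a q x = (x \<bullet> X 1 q) *\<^sub>R dX a q (X 1 q) + (x \<bullet> X 2 q) *\<^sub>R dX a q (X 2 q) +
      (x \<bullet> X 3 q) *\<^sub>R dX a q (X 3 q) + (x \<bullet> X 4 q) *\<^sub>R dX a q (X 4 q)" by (simp only: sum_1_4)
  show "dX a q x \<bullet> X 1 q = - lam a q * (x \<bullet> X 1 q)" "dX a q x \<bullet> X 2 q = - lam a q * (x \<bullet> X 2 q)"
    unfolding e inner_add_left inner_scaleR_left using K D E L by simp_all
qed

text \<open>\<open>lam 3\<close> and \<open>lam 4\<close> are the components outside \<open>N\<^sub>1\<close> of the covariant derivative of \<open>X 1\<close> along itself.\<close>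

lemma lam_nonzero:
  assumes q: "q \<in> M" "q \<in> V"
  shows "(lam 3 q)\<^sup>2 + (lam 4 q)\<^sup>2 > 0"
proof (rule ccontr)
  assume "\<not> ?thesis"
  then have l: "lam 3 q = 0" "lam 4 q = 0" by (auto simp: sum_power2_gt_zero_iff)
  have k: "(1::nat) \<in> {1..4}" by auto
  let ?D = "frechet_derivative (X 1) (at q within M) (X 1 q)"
  have qW: "q \<in> W" using q VW by blast
  have D: "?D = dX 1 q (X 1 q)"
    unfolding Xr_def by (rule deriv_within_tangent[OF ret W qW q frame_smooth[OF k] frame_tangent[OF q k]])
  let ?c = "closest_point (T q) ?D"
  note c = closest_point_subspace(1)[OF tangent_subspace[OF q], of ?D]
    closest_point_subspace(2)[OF tangent_subspace[OF q], where a = ?D]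
  have "?c \<bullet> X a q = lam a q" if "a \<in> {1..4}" for a
    using c(2)[OF frame_tangent[OF q that]] by (simp add: inner_diff_left D lam_def)
  then have "?c = (?c \<bullet> X 1 q) *\<^sub>R X 1 q + (?c \<bullet> X 2 q) *\<^sub>R X 2 q"
    using tangent_expansion[OF q c(1)] l unfolding sum_1_4 by simp
  also have "\<dots> \<in> span {X 1 q, X 2 q}" by (intro span_add span_scale span_base) auto
  finally show False using not_contained[of q] q qW by (simp add: cov_deriv_def)
qed

end

section \<open>The local cone structure\<close>

context adapted_nbhd begin

lemma index_le_4: "(1::nat) \<in> {1..4}" "(2::nat) \<in> {1..4}" "(3::nat) \<in> {1..4}" "(4::nat) \<in> {1..4}"
  by auto

lemma kernel_expansion:
  assumes q: "q \<in> M" "q \<in> V" and w: "w \<bullet> X 1 q = 0" "w \<bullet> X 2 q = 0"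
    "\<And>k. k \<in> {1..4} \<Longrightarrow> w \<bullet> mult_i (X k q) = 0"
  shows "w = (w \<bullet> X 3 q) *\<^sub>R X 3 q + (w \<bullet> X 4 q) *\<^sub>R X 4 q"
  using frame_expansion[OF q, of w] unfolding sum_1_4 by (simp add: w index_le_4)

text \<open>The map \<open>f\<close> is annihilated by \<open>X 1\<close> and \<open>X 2\<close>, so second derivatives give
  \<open>df(y) \<bullet> dX j(x) = df(x) \<bullet> dX j(y)\<close>.  By \<open>kernel_derivative\<close> the left-hand side is \<open>\<lambda>(df(y)) (x \<bullet> X j)\<close>.  As \<open>N\<^sub>1\<close> has
  dimension two, a relation \<open>\<lambda>(df(y)) x = \<lambda>(df(x)) y\<close> between \<open>N\<^sub>1\<close>-components forces \<open>\<lambda>(df) = 0\<close>.\<close>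

lemma kernel_valued_derivative:
  assumes f: "Cinf_on V f" "\<And>x. x \<in> V \<Longrightarrow> f (\<rho> x) = f x"
    and k1: "\<And>q v j. q \<in> M \<Longrightarrow> q \<in> V \<Longrightarrow> v \<in> T q \<Longrightarrow> j \<in> {1, 2} \<Longrightarrow> deriv_at f q v \<bullet> X j q = 0"
    and k2: "\<And>q v k. q \<in> M \<Longrightarrow> q \<in> V \<Longrightarrow> v \<in> T q \<Longrightarrow> k \<in> {1..4} \<Longrightarrow> deriv_at f q v \<bullet> mult_i (X k q) = 0"
    and q: "q \<in> M" "q \<in> V" and y: "y \<in> T q"
  shows "lam 3 q * (deriv_at f q y \<bullet> X 3 q) + lam 4 q * (deriv_at f q y \<bullet> X 4 q) = 0"
proof -
  define L where "L y = lam 3 q * (deriv_at f q y \<bullet> X 3 q) + lam 4 q * (deriv_at f q y \<bullet> X 4 q)" for y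
  have L: "deriv_at f q y \<bullet> dX j q x = L y * (x \<bullet> X j q)"
    if j: "j \<in> {1, 2}" and x: "x \<in> T q" and y: "y \<in> T q" for j x y
  proof -
    have j': "j \<in> {1..4}" using j by auto
    let ?w = "deriv_at f q y"
    have a: "X a q \<bullet> dX j q x = lam a q * (x \<bullet> X j q)" if "a \<in> {3, 4}" for a
      using frame_derivative_antisym[OF q, of a j x] kernel_derivative[OF q that x] that j by auto
    have "?w = (?w \<bullet> X 3 q) *\<^sub>R X 3 q + (?w \<bullet> X 4 q) *\<^sub>R X 4 q"
      by (rule kernel_expansion[OF q]) (use k1[OF q y] k2[OF q y] in auto)
    then have "?w \<bullet> dX j q x = ((?w \<bullet> X 3 q) *\<^sub>R X 3 q + (?w \<bullet> X 4 q) *\<^sub>R X 4 q) \<bullet> dX j q x"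
      by (rule arg_cong)
    then show ?thesis by (simp add: inner_add_left a L_def algebra_simps)
  qed
  have S: "L y * (x \<bullet> X j q) = L x * (y \<bullet> X j q)" if j: "j \<in> {1, 2}" and x: "x \<in> T q" and y: "y \<in> T q" for j x y
  proof -
    have j': "j \<in> {1..4}" using j by auto
    have "deriv_at f q y \<bullet> dX j q x = deriv_at f q x \<bullet> dX j q y"
    proof (rule annihilated_derivative_symmetric[OF ret f Xr_Cinf[OF j'] _ q x y])
      fix q x assume q: "q \<in> M" "q \<in> V" "x \<in> T q"
      show "deriv_at f q x \<bullet> Xr j q = 0" unfolding Xr_eq[OF q(1,2)] by (rule k1[OF q j])
    qed
    then show ?thesis using L[OF j x y] L[OF j y x] by simp
  qed
  note t = frame_tangent[OF q] and o = frame_orthonormal[OF q]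
  have "L (X 1 q) = 0" using S[of 2 "X 2 q" "X 1 q"] t[OF index_le_4(1)] t[OF index_le_4(2)] by (simp add: o)
  then have "L y = 0" using S[of 1 "X 1 q" y] t[OF index_le_4(1)] y by (simp add: o)
  then show ?thesis by (simp add: L_def)
qed

text \<open>By the product rule the derivatives of the coefficients contribute kernel vectors only.\<close>

lemma kernel_section_derivative:
  assumes \<alpha>: "Cinf_on V \<alpha>" and \<beta>: "Cinf_on V \<beta>" and q: "q \<in> M" "q \<in> V" and v: "v \<in> T q"
  defines "D \<equiv> deriv_at (\<lambda>x. \<alpha> x *\<^sub>R Xr 3 x + \<beta> x *\<^sub>R Xr 4 x) q v"
  shows "D \<bullet> X 1 q = - (\<alpha> q * lam 3 q + \<beta> q * lam 4 q) * (v \<bullet> X 1 q)"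
    "D \<bullet> X 2 q = - (\<alpha> q * lam 3 q + \<beta> q * lam 4 q) * (v \<bullet> X 2 q)"
    "k \<in> {1..4} \<Longrightarrow> D \<bullet> mult_i (X k q) = 0"
proof -
  have "((\<lambda>x. \<alpha> x *\<^sub>R Xr 3 x + \<beta> x *\<^sub>R Xr 4 x) has_derivative
     (\<lambda>v. (\<alpha> q *\<^sub>R dX 3 q v + deriv_at \<alpha> q v *\<^sub>R Xr 3 q) + (\<beta> q *\<^sub>R dX 4 q v + deriv_at \<beta> q v *\<^sub>R Xr 4 q))) (at q)"
    by (intro has_derivative_add has_derivative_scaleR dX_has_derivative index_le_4 q
        Cinf_on_has_derivative[OF \<alpha>] Cinf_on_has_derivative[OF \<beta>])
  then have D: "D = (\<alpha> q *\<^sub>R dX 3 q v + deriv_at \<alpha> q v *\<^sub>R X 3 q) + (\<beta> q *\<^sub>R dX 4 q v + deriv_at \<beta> q v *\<^sub>R X 4 q)"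
    unfolding D_def by (simp add: deriv_at_eq Xr_eq q)
  note kd = kernel_derivative[OF q _ v]
  show "D \<bullet> X 1 q = - (\<alpha> q * lam 3 q + \<beta> q * lam 4 q) * (v \<bullet> X 1 q)"
    "D \<bullet> X 2 q = - (\<alpha> q * lam 3 q + \<beta> q * lam 4 q) * (v \<bullet> X 2 q)"
    unfolding D by (simp_all add: inner_add_left kd frame_orthonormal[OF q] algebra_simps)
  assume k: "k \<in> {1..4}"
  note l = lagrangian_orth[OF q(1) _ frame_tangent[OF q k]]
  show "D \<bullet> mult_i (X k q) = 0"
    unfolding D
    using l[OF kernel_derivative_tangent[OF q v, of 3]] l[OF kernel_derivative_tangent[OF q v, of 4]]
      l[OF frame_tangent[OF q index_le_4(3)]] l[OF frame_tangent[OF q index_le_4(4)]]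
    by (simp add: inner_add_left)
qed

text \<open>The components of \<open>\<lambda>\<close> and the square of its norm, extended to the ambient space by the retraction.\<close>

definition lamr :: "nat \<Rightarrow> complex^4 \<Rightarrow> real" where "lamr a = (\<lambda>x. lam a (\<rho> x))"

definition lam_sq :: "complex^4 \<Rightarrow> real" where "lam_sq = (\<lambda>x. (lamr 3 x)\<^sup>2 + (lamr 4 x)\<^sup>2)"

text \<open>The unit vector of the kernel of \<open>A\<close> on which \<open>\<lambda>\<close> vanishes.  It turns out to be the direction of the line factor.\<close>

definition ruling_axis :: "complex^4 \<Rightarrow> complex^4" where
  "ruling_axis = (\<lambda>x. (lamr 4 x / sqrt (lam_sq x)) *\<^sub>R Xr 3 x + (- lamr 3 x / sqrt (lam_sq x)) *\<^sub>R Xr 4 x)"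

text \<open>The vector \<open>Z\<close> orthogonal to \<open>ruling_axis\<close> with \<open>\<lambda>(Z) = 1\<close>.  It points from a point of \<open>M\<close> to the vertex line of the cone.\<close>

definition radius :: "complex^4 \<Rightarrow> complex^4" where
  "radius = (\<lambda>x. (lamr 3 x / lam_sq x) *\<^sub>R Xr 3 x + (lamr 4 x / lam_sq x) *\<^sub>R Xr 4 x)"

lemma lamr_Cinf:
  assumes a: "a \<in> {1..4}"
  shows "Cinf_on V (lamr a)"
proof -
  have "Cinf_on V (\<lambda>y. dX 1 y (Xr 1 y) \<bullet> Xr a y)"
    by (intro Cinf_on_inner Cinf_on_derivative_apply Xr_Cinf a index_le_4)
  then have "Cinf_on V (\<lambda>x. dX 1 (\<rho> x) (Xr 1 (\<rho> x)) \<bullet> Xr a (\<rho> x))"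
    by (rule Cinf_on_compose[OF _ retraction_facts(1)]) (use retraction_facts in auto)
  then show ?thesis
    by (rule Cinf_on_cong) (simp add: lamr_def lam_def Xr_eq retraction_facts)
qed

lemma lam_sq_pos: "x \<in> V \<Longrightarrow> lam_sq x > 0"
  using lam_nonzero[OF retraction_facts(3,4)] by (simp add: lam_sq_def lamr_def)

lemma lam_sq_Cinf: "Cinf_on V lam_sq"
  unfolding lam_sq_def power2_eq_square by (intro Cinf_on_add Cinf_on_mult lamr_Cinf index_le_4)

lemma coeff_Cinf:
  "Cinf_on V (\<lambda>x. lamr 4 x / sqrt (lam_sq x))" "Cinf_on V (\<lambda>x. - lamr 3 x / sqrt (lam_sq x))"
  "Cinf_on V (\<lambda>x. lamr 3 x / lam_sq x)" "Cinf_on V (\<lambda>x. lamr 4 x / lam_sq x)"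
  using lam_sq_pos by (force intro!: Cinf_on_divide Cinf_on_sqrt Cinf_on_minus lamr_Cinf lam_sq_Cinf)+

lemma ruling_axis_Cinf: "Cinf_on V ruling_axis" and radius_Cinf: "Cinf_on V radius"
  unfolding ruling_axis_def radius_def by (intro Cinf_on_add Cinf_on_scaleR coeff_Cinf Xr_Cinf index_le_4)+

lemma ruling_axis_ret: "x \<in> V \<Longrightarrow> ruling_axis (\<rho> x) = ruling_axis x" and radius_ret: "x \<in> V \<Longrightarrow> radius (\<rho> x) = radius x"
  by (simp_all add: ruling_axis_def radius_def lam_sq_def lamr_def Xr_def retraction_facts)

lemma lamr_eq: "q \<in> M \<Longrightarrow> q \<in> V \<Longrightarrow> lamr a q = lam a q"
  by (simp add: lamr_def retraction_facts)

lemma ruling_axis_unit_on: "q \<in> M \<Longrightarrow> q \<in> V \<Longrightarrow> ruling_axis q \<bullet> ruling_axis q = 1"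
proof -
  assume q: "q \<in> M" "q \<in> V"
  have "ruling_axis q \<bullet> ruling_axis q = (lamr 4 q / sqrt (lam_sq q))\<^sup>2 + (lamr 3 q / sqrt (lam_sq q))\<^sup>2"
    by (simp add: ruling_axis_def Xr_eq q frame_orthonormal[OF q] inner_diff_left inner_diff_right power2_eq_square)
  also have "\<dots> = lam_sq q / lam_sq q"
    using lam_sq_pos[OF q(2)] by (simp add: power_divide add_divide_distrib[symmetric] lam_sq_def add.commute)
  finally show ?thesis using lam_sq_pos[OF q(2)] by simp
qed

lemma ruling_axis_unit: "x \<in> V \<Longrightarrow> ruling_axis x \<bullet> ruling_axis x = 1"
  using ruling_axis_unit_on[of "\<rho> x"] ruling_axis_ret by (simp add: retraction_facts)

lemma inner_axis:
  assumes q: "q \<in> M" "q \<in> V"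
  shows "w \<bullet> ruling_axis q = (lam 4 q * (w \<bullet> X 3 q) - lam 3 q * (w \<bullet> X 4 q)) / sqrt (lam_sq q)"
  by (simp add: ruling_axis_def inner_diff_right Xr_eq q lamr_eq diff_divide_distrib)

text \<open>By \<open>kernel_section_derivative\<close> the differential takes values in the kernel of \<open>A\<close>.  There it is orthogonal to the unit
  vector itself and, by \<open>kernel_valued_derivative\<close>, also to the dual vector of \<open>\<lambda>\<close>.\<close>

lemma ruling_axis_parallel:
  assumes q: "q \<in> M" "q \<in> V" and v: "v \<in> T q"
  shows "deriv_at ruling_axis q v = 0"
proof -
  let ?w = "deriv_at ruling_axis q v"
  note d = Cinf_on_has_derivative[OF ruling_axis_Cinf]
  have k1: "deriv_at ruling_axis q v \<bullet> X j q = 0" if "q \<in> M" "q \<in> V" "v \<in> T q" "j \<in> {1, 2}" for q v j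
    using kernel_section_derivative(1,2)[OF coeff_Cinf(1,2) that(1-3)] that(4)
    unfolding ruling_axis_def[symmetric] by (auto simp: lamr_eq that)
  have k2: "deriv_at ruling_axis q v \<bullet> mult_i (X k q) = 0" if "q \<in> M" "q \<in> V" "v \<in> T q" "k \<in> {1..4}" for q v k
    using kernel_section_derivative(3)[OF coeff_Cinf(1,2) that(1-4)] unfolding ruling_axis_def[symmetric] by simp
  have e1: "lam 3 q * (?w \<bullet> X 3 q) + lam 4 q * (?w \<bullet> X 4 q) = 0"
    by (rule kernel_valued_derivative[OF ruling_axis_Cinf ruling_axis_ret k1 k2 q v])
  have "((\<lambda>x. ruling_axis x \<bullet> ruling_axis x) has_derivative (\<lambda>v. ruling_axis q \<bullet> deriv_at ruling_axis q v + deriv_at ruling_axis q v \<bullet> ruling_axis q)) (at q)"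
    by (intro has_derivative_inner d q)
  moreover have "((\<lambda>x. ruling_axis x \<bullet> ruling_axis x) has_derivative (\<lambda>v. 0)) (at q)"
    by (rule has_derivative_transform_within_open[OF has_derivative_const[of 1] retraction_facts(2) q(2)])
      (simp add: ruling_axis_unit)
  ultimately have "ruling_axis q \<bullet> ?w + ?w \<bullet> ruling_axis q = 0"
    using has_derivative_unique by (metis (no_types, lifting))
  then have "?w \<bullet> ruling_axis q = 0" by (simp add: inner_commute)
  then have "(lam 4 q * (?w \<bullet> X 3 q) - lam 3 q * (?w \<bullet> X 4 q)) / sqrt (lam_sq q) = 0"
    by (simp only: inner_axis[OF q])
  then have e2: "lam 4 q * (?w \<bullet> X 3 q) - lam 3 q * (?w \<bullet> X 4 q) = 0" using lam_sq_pos[OF q(2)] by simp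
  have n: "(lam 3 q)\<^sup>2 + (lam 4 q)\<^sup>2 \<noteq> 0" using lam_nonzero[OF q] by linarith
  have "((lam 3 q)\<^sup>2 + (lam 4 q)\<^sup>2) * (?w \<bullet> X 3 q) =
      lam 3 q * (lam 3 q * (?w \<bullet> X 3 q) + lam 4 q * (?w \<bullet> X 4 q)) + lam 4 q * (lam 4 q * (?w \<bullet> X 3 q) - lam 3 q * (?w \<bullet> X 4 q))"
    "((lam 3 q)\<^sup>2 + (lam 4 q)\<^sup>2) * (?w \<bullet> X 4 q) =
      lam 4 q * (lam 3 q * (?w \<bullet> X 3 q) + lam 4 q * (?w \<bullet> X 4 q)) - lam 3 q * (lam 4 q * (?w \<bullet> X 3 q) - lam 3 q * (?w \<bullet> X 4 q))"
    by (simp_all add: algebra_simps power2_eq_square)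
  then have "?w \<bullet> X 3 q = 0" "?w \<bullet> X 4 q = 0" using n unfolding e1 e2 by auto
  then show ?thesis
    using kernel_expansion[OF q, of ?w] k1[OF q v] k2[OF q v] by simp
qed

text \<open>The focal point on the affine kernel plane through a point of \<open>M\<close>.\<close>

definition centre :: "complex^4 \<Rightarrow> complex^4" where "centre x = \<rho> x + radius x"

text \<open>The normalisation \<open>\<lambda>(Z) = 1\<close> of \<open>radius\<close> makes the \<open>N\<^sub>1\<close>-components of \<open>dq\<close> and \<open>dZ\<close> cancel, so that
  \<open>kernel_valued_derivative\<close> applies.\<close>

lemma centre_moves_along_axis:
  assumes q: "q \<in> M" "q \<in> V" and v: "v \<in> T q"
  shows "deriv_at centre q v = (deriv_at centre q v \<bullet> ruling_axis q) *\<^sub>R ruling_axis q"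
proof -
  have C: "Cinf_on V centre" unfolding centre_def by (intro Cinf_on_add retraction_facts(1) radius_Cinf)
  have d: "deriv_at centre q v = v + deriv_at radius q v" if "q \<in> M" "q \<in> V" "v \<in> T q" for q v
  proof -
    have "deriv_at centre q v = deriv_at \<rho> q v + deriv_at radius q v"
      unfolding centre_def
      by (rule fun_cong[OF deriv_at_eq[OF has_derivative_add]])
        (intro retraction_has_derivative[OF ret] Cinf_on_has_derivative[OF radius_Cinf] that(2))+
    then show ?thesis using tangent_space_iff_retraction[OF ret that(1,2)] that(3) by simp
  qed
  have c: "lamr 3 q / lam_sq q * lam 3 q + lamr 4 q / lam_sq q * lam 4 q = 1" if "q \<in> M" "q \<in> V" for q
    using lam_sq_pos[OF that(2)]
    by (simp add: lamr_eq[OF that] add_divide_distrib[symmetric] power2_eq_square[symmetric])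
      (simp add: lam_sq_def lamr_eq[OF that])
  have k1: "deriv_at centre q v \<bullet> X j q = 0" if "q \<in> M" "q \<in> V" "v \<in> T q" "j \<in> {1, 2}" for q v j
    using kernel_section_derivative(1,2)[OF coeff_Cinf(3,4) that(1-3), unfolded c[OF that(1,2)]] that(4) d[OF that(1-3)]
    unfolding radius_def[symmetric] by (auto simp: inner_add_left)
  have k2: "deriv_at centre q v \<bullet> mult_i (X k q) = 0" if "q \<in> M" "q \<in> V" "v \<in> T q" "k \<in> {1..4}" for q v k
    using kernel_section_derivative(3)[OF coeff_Cinf(3,4) that(1-4)] d[OF that(1-3)]
      lagrangian_orth[OF that(1,3) frame_tangent[OF that(1,2,4)]]
    unfolding radius_def[symmetric] by (simp add: inner_add_left)
  let ?w = "deriv_at centre q v"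
  have e1: "lam 3 q * (?w \<bullet> X 3 q) + lam 4 q * (?w \<bullet> X 4 q) = 0"
    by (rule kernel_valued_derivative[OF C _ k1 k2 q v]) (simp add: centre_def retraction_facts radius_ret)
  define h where "h = sqrt (lam_sq q)"
  have h: "h > 0" "h * h = (lam 3 q)\<^sup>2 + (lam 4 q)\<^sup>2"
    using lam_sq_pos[OF q(2)] by (simp_all add: h_def lam_sq_def lamr_eq[OF q])
  define a b where "a = ?w \<bullet> X 3 q" and "b = ?w \<bullet> X 4 q"
  have w: "?w = a *\<^sub>R X 3 q + b *\<^sub>R X 4 q"
    unfolding a_def b_def by (rule kernel_expansion[OF q]) (use k1[OF q v] k2[OF q v] in auto)
  have ax: "ruling_axis q = (lam 4 q / h) *\<^sub>R X 3 q + (- lam 3 q / h) *\<^sub>R X 4 q"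
    by (simp add: ruling_axis_def Xr_eq q lamr_eq h_def)
  have wa: "?w \<bullet> ruling_axis q = (lam 4 q * a - lam 3 q * b) / h"
    unfolding ax inner_add_right inner_scaleR_right a_def[symmetric] b_def[symmetric]
    by (simp add: diff_divide_distrib)
  have "(lam 4 q * a - lam 3 q * b) * lam 4 q = a * (h * h) - lam 3 q * (lam 3 q * a + lam 4 q * b)"
    "(lam 4 q * a - lam 3 q * b) * (- lam 3 q) = b * (h * h) - lam 4 q * (lam 3 q * a + lam 4 q * b)"
    unfolding h(2) by (simp_all add: algebra_simps power2_eq_square)
  then have "(lam 4 q * a - lam 3 q * b) / h * (lam 4 q / h) = a" "(lam 4 q * a - lam 3 q * b) / h * (- lam 3 q / h) = b"
    using e1 h(1) unfolding a_def[symmetric] b_def[symmetric] times_divide_times_eq by (simp_all only: mult_zero_right diff_zero) simp_all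
  then show ?thesis unfolding wa unfolding w ax scaleR_add_right scaleR_scaleR by simp
qed

text \<open>All focal points lie on the line through \<open>c\<close> in the direction \<open>e\<close>; therefore the vector from this line to \<open>q\<close> is
  \<open>- radius q\<close>, which is a nonzero tangent vector orthogonal to \<open>N\<^sub>1\<close>.\<close>

lemma local_cone_structure:
  assumes p: "p \<in> M" "p \<in> V" and b: "ball p \<epsilon> \<subseteq> V"
  obtains e c where "norm e = 1" "c \<bullet> e = 0"
    "\<And>q. q \<in> M \<Longrightarrow> q \<in> ball p \<epsilon> \<Longrightarrow> e \<in> T q"
    "\<And>q. q \<in> M \<Longrightarrow> q \<in> ball p \<epsilon> \<Longrightarrow> q - c - (q \<bullet> e) *\<^sub>R e \<in> T q"
    "\<And>q. q \<in> M \<Longrightarrow> q \<in> ball p \<epsilon> \<Longrightarrow> q - c - (q \<bullet> e) *\<^sub>R e \<noteq> 0"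
    "\<And>q j. q \<in> M \<Longrightarrow> q \<in> ball p \<epsilon> \<Longrightarrow> j \<in> {1, 2} \<Longrightarrow> e \<bullet> X j q = 0"
    "\<And>q j. q \<in> M \<Longrightarrow> q \<in> ball p \<epsilon> \<Longrightarrow> j \<in> {1, 2} \<Longrightarrow> (q - c - (q \<bullet> e) *\<^sub>R e) \<bullet> X j q = 0"
proof -
  define f where "f x = centre x - (centre x \<bullet> ruling_axis x) *\<^sub>R ruling_axis x" for x
  have C: "Cinf_on V centre" unfolding centre_def by (intro Cinf_on_add retraction_facts(1) radius_Cinf)
  have f: "Cinf_on V f" unfolding f_def by (intro Cinf_on_diff Cinf_on_scaleR Cinf_on_inner C ruling_axis_Cinf)
  have fd: "deriv_at f q v = 0" if q: "q \<in> M" "q \<in> V" and v: "v \<in> T q" for q v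
  proof -
    have "(f has_derivative (\<lambda>v. deriv_at centre q v - ((centre q \<bullet> ruling_axis q) *\<^sub>R deriv_at ruling_axis q v +
        (centre q \<bullet> deriv_at ruling_axis q v + deriv_at centre q v \<bullet> ruling_axis q) *\<^sub>R ruling_axis q))) (at q)"
      unfolding f_def by (intro has_derivative_diff has_derivative_scaleR has_derivative_inner
          Cinf_on_has_derivative[OF C] Cinf_on_has_derivative[OF ruling_axis_Cinf] q)
    then have "deriv_at f q v = deriv_at centre q v - (deriv_at centre q v \<bullet> ruling_axis q) *\<^sub>R ruling_axis q"
      using ruling_axis_parallel[OF q v] by (simp add: deriv_at_eq)
    then show ?thesis using centre_moves_along_axis[OF q v] by simp
  qed
  define e where "e = ruling_axis p"
  define c where "c = f p"
  have ae: "ruling_axis q = e" "f q = c" if "q \<in> M" "q \<in> ball p \<epsilon>" for q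
    unfolding e_def c_def
    using tangent_constant_on_ball[OF ret ruling_axis_Cinf ruling_axis_parallel b p(1) that]
      tangent_constant_on_ball[OF ret f fd b p(1) that] by auto
  have ra: "radius q \<bullet> ruling_axis q = 0" if q: "q \<in> M" "q \<in> V" for q
    by (simp add: inner_axis[OF q] radius_def Xr_eq q lamr_eq frame_orthonormal[OF q] inner_add_left)
  have R: "q - c - (q \<bullet> e) *\<^sub>R e = - radius q" if q: "q \<in> M" "q \<in> ball p \<epsilon>" for q
  proof -
    have qV: "q \<in> V" using q b by blast
    have "c = q + radius q - ((q + radius q) \<bullet> e) *\<^sub>R e"
      using ae[OF q] retraction_facts(5)[OF q(1) qV] by (simp add: f_def centre_def)
    moreover have "radius q \<bullet> e = 0" using ra[OF q(1) qV] ae[OF q] by simp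
    ultimately show ?thesis by (simp add: inner_add_left)
  qed
  show thesis
  proof (rule that[of e c])
    show "norm e = 1" using ruling_axis_unit[OF p(2)] by (simp add: e_def norm_eq_1)
    show "c \<bullet> e = 0" using ruling_axis_unit[OF p(2)] by (simp add: c_def e_def f_def inner_diff_left)
    fix q assume q: "q \<in> M" "q \<in> ball p \<epsilon>"
    then have qV: "q \<in> V" using b by blast
    note s = tangent_subspace[OF q(1) qV]
    have t: "X 3 q \<in> T q" "X 4 q \<in> T q" using frame_tangent[OF q(1) qV] index_le_4 by auto
    show "e \<in> T q" unfolding ae(1)[OF q, symmetric] ruling_axis_def Xr_eq[OF q(1) qV]
      by (intro subspace_add subspace_scale s t)
    show "q - c - (q \<bullet> e) *\<^sub>R e \<in> T q" unfolding R[OF q] radius_def Xr_eq[OF q(1) qV]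
      by (intro subspace_neg subspace_add subspace_scale s t)
    have "radius q \<bullet> radius q = ((lamr 3 q)\<^sup>2 + (lamr 4 q)\<^sup>2) / (lam_sq q)\<^sup>2"
      by (simp add: radius_def Xr_eq q qV frame_orthonormal[OF q(1) qV] inner_add_left inner_add_right power2_eq_square add_divide_distrib)
    also have "\<dots> = lam_sq q / (lam_sq q)\<^sup>2" by (simp only: lam_sq_def)
    also have "\<dots> > 0" using lam_sq_pos[OF qV] by simp
    finally show "q - c - (q \<bullet> e) *\<^sub>R e \<noteq> 0" unfolding R[OF q] by auto
    fix j :: nat assume j: "j \<in> {1, 2}"
    then have "ruling_axis q \<bullet> X j q = 0" "radius q \<bullet> X j q = 0"
      by (auto simp: ruling_axis_def radius_def Xr_eq q qV frame_orthonormal[OF q(1) qV] inner_add_left inner_diff_left)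
    then show "e \<bullet> X j q = 0" "(q - c - (q \<bullet> e) *\<^sub>R e) \<bullet> X j q = 0"
      unfolding R[OF q] by (simp_all add: ae(1)[OF q, symmetric])
  qed
qed

end

section \<open>Straight segments in a submanifold\<close>

text \<open>At a maximum of \<open>norm \<circ> E\<close> the mean value inequality gives \<open>norm (E m) \<le> k * norm (E m)\<close>.\<close>

lemma self_bounded_derivative_vanishes:
  fixes E :: "real \<Rightarrow> 'e::euclidean_space"
  assumes d: "\<And>t. t \<in> {0..1} \<Longrightarrow> (E has_derivative (\<lambda>s. s *\<^sub>R E' t)) (at t)"
    and b: "\<And>t. t \<in> {0..1} \<Longrightarrow> norm (E' t) \<le> k * norm (E t)" and k: "0 \<le> k" "k < 1" and 0: "E 0 = 0"
    and t: "t \<in> {0..1}"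
  shows "E t = 0"
proof -
  have c: "continuous_on {0..1} (\<lambda>t. norm (E t))"
    using d has_derivative_continuous by (intro continuous_on_norm continuous_at_imp_continuous_on) blast
  obtain m where m: "m \<in> {0..1}" "\<And>t. t \<in> {0..1} \<Longrightarrow> norm (E t) \<le> norm (E m)"
    using continuous_attains_sup[OF _ _ c] by auto
  have "norm (E m - E 0) \<le> (k * norm (E m)) * norm (m - 0)"
  proof (rule differentiable_bound[of "{0..1}" E "\<lambda>t s. s *\<^sub>R E' t"])
    fix t assume t: "t \<in> {0..1::real}"
    show "onorm (\<lambda>s. s *\<^sub>R E' t) \<le> k * norm (E m)"
    proof (rule onorm_le)
      fix s :: real
      have "norm (E' t) \<le> k * norm (E m)" using b[OF t] m(2)[OF t] k(1) mult_left_mono order_trans by blast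
      then show "norm (s *\<^sub>R E' t) \<le> k * norm (E m) * norm s" by (simp add: mult.commute mult_left_mono)
    qed
    show "(E has_derivative (\<lambda>s. s *\<^sub>R E' t)) (at t within {0..1})" using d[OF t] by (rule has_derivative_at_withinI)
  qed (use m in auto)
  also have "\<dots> \<le> (k * norm (E m)) * 1" using m(1) k by (intro mult_left_mono) auto
  finally have "(1 - k) * norm (E m) \<le> 0" by (simp add: 0 algebra_simps)
  then have "norm (E m) = 0" using k(2) by (simp add: mult_le_0_iff)
  then show ?thesis using m(2)[OF t] by simp
qed

text \<open>Here \<open>R x\<close> is the vector to \<open>x\<close> from the line through \<open>c\<close> in the direction \<open>e\<close>, and \<open>e\<close> and \<open>R\<close> are tangent to \<open>M\<close>.
  Segments in their directions are integral curves of tangent fields, so they should not leave \<open>M\<close>.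
  The distance vector \<open>E = \<gamma> - \<rho>(\<gamma>)\<close> of the segment \<open>\<gamma>\<close> from \<open>M\<close> has derivative \<open>\<gamma>' - d\<rho>(\<gamma>')\<close>.
  This expression vanishes on \<open>M\<close> and is Lipschitz, hence is bounded by a small multiple of \<open>E\<close>, and \<open>E = 0\<close> follows.  The estimate
  is uniform in the initial point, which gives one \<open>\<delta>\<close> for all of them.\<close>

lemma ruled_segments:
  fixes M :: "'e::euclidean_space set" and e c
  defines "R x \<equiv> x - c - (x \<bullet> e) *\<^sub>R e"
  assumes ret: "smooth_retraction V M \<rho>" and p: "p \<in> M" and \<epsilon>: "\<epsilon> > 0" "ball p \<epsilon> \<subseteq> V"
    and e: "norm e = 1" "c \<bullet> e = 0"
    and t1: "\<And>q. q \<in> M \<Longrightarrow> q \<in> ball p \<epsilon> \<Longrightarrow> e \<in> tangent_space M q"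
    and t2: "\<And>q. q \<in> M \<Longrightarrow> q \<in> ball p \<epsilon> \<Longrightarrow> R q \<in> tangent_space M q"
  obtains \<delta> where "\<delta> > 0" "\<And>q a b. q \<in> M \<Longrightarrow> q \<in> ball p \<delta> \<Longrightarrow> \<bar>a\<bar> < \<delta> \<Longrightarrow> \<bar>b\<bar> < \<delta> \<Longrightarrow> q + a *\<^sub>R e + b *\<^sub>R R q \<in> M"
proof -
  have ee: "e \<bullet> e = 1" using e(1) by (simp add: norm_eq_1)
  have Re: "R x \<bullet> e = 0" for x using e(2) by (simp add: R_def inner_diff_left ee)
  have RC: "Cinf_on V R"
    unfolding R_def using smooth_retractionD(2)[OF ret]
    by (intro Cinf_on_diff Cinf_on_scaleR Cinf_on_inner Cinf_on_const Cinf_on_ident) auto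
  define H1 where "H1 x = e - deriv_at \<rho> x e" for x
  define H2 where "H2 x = R x - deriv_at \<rho> x (R x)" for x
  have pV: "p \<in> V" using \<epsilon> by auto
  have H: "Cinf_on V H1" "Cinf_on V H2"
    unfolding H1_def H2_def using smooth_retractionD(1,2)[OF ret] RC
    by (intro Cinf_on_diff Cinf_on_const Cinf_on_derivative Cinf_on_derivative_apply; simp)+
  have H0: "H1 q = 0" "H2 q = 0" if "q \<in> M" "q \<in> ball p \<epsilon>" for q
    unfolding H1_def H2_def using tangent_space_iff_retraction[OF ret that(1)] t1[OF that] t2[OF that] that \<epsilon>(2) by auto
  obtain d1 L1 where 1: "d1 > 0" "L1 \<ge> 0" "ball p d1 \<subseteq> V"
    "\<And>x y. x \<in> ball p d1 \<Longrightarrow> y \<in> ball p d1 \<Longrightarrow> norm (H1 x - H1 y) \<le> L1 * norm (x - y)"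
    using Cinf_on_locally_lipschitz[OF H(1) pV] by blast
  obtain d2 L2 where 2: "d2 > 0" "L2 \<ge> 0" "ball p d2 \<subseteq> V"
    "\<And>x y. x \<in> ball p d2 \<Longrightarrow> y \<in> ball p d2 \<Longrightarrow> norm (H2 x - H2 y) \<le> L2 * norm (x - y)"
    using Cinf_on_locally_lipschitz[OF H(2) pV] by blast
  define d where "d = min \<epsilon> (min d1 d2)"
  have d: "d > 0" using \<epsilon> 1 2 by (simp add: d_def)
  define L where "L = L1 + L2"
  have L: "L \<ge> 0" using 1 2 by (simp add: L_def)
  have "open (V \<inter> \<rho> -` ball p d)" by (rule Cinf_on_open_preimage[OF smooth_retractionD(1)[OF ret] open_ball])
  moreover have "p \<in> V \<inter> \<rho> -` ball p d" using pV d smooth_retractionD(5)[OF ret p pV] by simp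
  ultimately obtain d3 where d3: "d3 > 0" "ball p d3 \<subseteq> V \<inter> \<rho> -` ball p d"
    using open_contains_ball by blast
  define d4 where "d4 = min d d3"
  have d4: "d4 > 0" using d d3 by (simp add: d4_def)
  have HB: "norm (H1 x) \<le> L * norm (x - \<rho> x)" "norm (H2 x) \<le> L * norm (x - \<rho> x)" if x: "x \<in> ball p d4" for x
  proof -
    have xV: "x \<in> V" "\<rho> x \<in> ball p d" "x \<in> ball p d" using x d3(2) by (auto simp: d4_def)
    have z: "H1 (\<rho> x) = 0" "H2 (\<rho> x) = 0"
      using H0[OF smooth_retractionD(3)[OF ret xV(1)]] xV(2) by (auto simp: d_def)
    have "norm (H1 x - H1 (\<rho> x)) \<le> L1 * norm (x - \<rho> x)" "norm (H2 x - H2 (\<rho> x)) \<le> L2 * norm (x - \<rho> x)"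
      using xV by (auto intro!: 1(4) 2(4) simp: d_def)
    moreover have "L1 * norm (x - \<rho> x) \<le> L * norm (x - \<rho> x)" "L2 * norm (x - \<rho> x) \<le> L * norm (x - \<rho> x)"
      using 1(2) 2(2) by (auto intro!: mult_right_mono simp: L_def)
    ultimately show "norm (H1 x) \<le> L * norm (x - \<rho> x)" "norm (H2 x) \<le> L * norm (x - \<rho> x)" using z by auto
  qed
  define Q where "Q = norm (R p) + 2"
  have Q: "Q > 0" by (simp add: Q_def add_nonneg_pos)
  have RQ: "norm (R x) \<le> Q" if "x \<in> ball p 1" for x
  proof -
    have n: "norm (x - p) < 1" using that by (simp add: dist_norm norm_minus_commute)
    have "R x = R p + ((x - p) - ((x - p) \<bullet> e) *\<^sub>R e)" by (simp add: R_def inner_diff_left algebra_simps)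
    then have "norm (R x) \<le> norm (R p) + (norm (x - p) + \<bar>(x - p) \<bullet> e\<bar> * norm e)"
      by (metis norm_triangle_mono norm_triangle_ineq4 norm_scaleR order_refl)
    moreover have "\<bar>(x - p) \<bullet> e\<bar> \<le> norm (x - p)" using Cauchy_Schwarz_ineq2[of "x - p" e] e(1) by simp
    ultimately show ?thesis using n e(1) by (simp add: Q_def)
  qed
  \<comment> \<open>the bound 1/2 keeps the radial factor \<open>1 + t b\<close> away from 0, the next one keeps the segment in the ball, and the last one makes the constant of \<open>self_bounded_derivative_vanishes\<close> smaller than 1\<close>
  define \<delta> where "\<delta> = min (1 / 2) (min (d4 / (2 + Q)) (1 / (3 * L + 1)))"
  have \<delta>: "\<delta> > 0" "\<delta> \<le> 1 / 2" "\<delta> * (2 + Q) \<le> d4" "3 * \<delta> * L < 1"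
  proof -
    show "\<delta> > 0" using d4 Q L by (simp add: \<delta>_def)
    show "\<delta> \<le> 1 / 2" unfolding \<delta>_def by (rule min.cobounded1)
    have "\<delta> \<le> d4 / (2 + Q)" by (simp add: \<delta>_def)
    then show "\<delta> * (2 + Q) \<le> d4" using Q by (simp add: pos_le_divide_eq)
    have "\<delta> \<le> 1 / (3 * L + 1)" by (simp add: \<delta>_def)
    then have "\<delta> * (3 * L + 1) \<le> 1" using L by (simp add: pos_le_divide_eq)
    then show "3 * \<delta> * L < 1" using \<open>\<delta> > 0\<close> by (simp add: algebra_simps)
  qed
  show thesis
  proof (rule that[OF \<delta>(1)])
    fix q a b assume q: "q \<in> M" "q \<in> ball p \<delta>" and ab: "\<bar>a\<bar> < \<delta>" "\<bar>b\<bar> < \<delta>"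
    define v where "v = a *\<^sub>R e + b *\<^sub>R R q"
    define E where "E t = (q + t *\<^sub>R v) - \<rho> (q + t *\<^sub>R v)" for t
    have qR: "norm (R q) \<le> Q" using q \<delta>(2) by (intro RQ) auto
    have \<gamma>: "q + t *\<^sub>R v \<in> ball p d4" if t: "t \<in> {0..1}" for t
    proof -
      have "norm v \<le> \<bar>a\<bar> * norm e + \<bar>b\<bar> * norm (R q)"
        unfolding v_def by (metis norm_triangle_ineq norm_scaleR)
      also have "\<dots> \<le> \<delta> * 1 + \<delta> * Q" using ab qR e(1) \<delta>(1) by (intro add_mono mult_mono) auto
      finally have nv: "norm v \<le> \<delta> * (1 + Q)" by (simp add: algebra_simps)
      have "norm (t *\<^sub>R v) \<le> 1 * norm v" using t unfolding norm_scaleR by (intro mult_right_mono) auto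
      then have "norm (t *\<^sub>R v) \<le> \<delta> * (1 + Q)" using nv by simp
      moreover have "norm (q - p) < \<delta>" using q(2) by (simp add: dist_norm norm_minus_commute)
      moreover have "norm ((q - p) + t *\<^sub>R v) \<le> norm (q - p) + norm (t *\<^sub>R v)" by (rule norm_triangle_ineq)
      moreover have "\<delta> + \<delta> * (1 + Q) = \<delta> * (2 + Q)" by (simp add: algebra_simps)
      ultimately have "norm ((q - p) + t *\<^sub>R v) < d4" using \<delta>(3) by linarith
      moreover have "(q - p) + t *\<^sub>R v = (q + t *\<^sub>R v) - p" by simp
      ultimately show ?thesis by (simp only: mem_ball dist_norm norm_minus_commute)
    qed
    have \<gamma>V: "q + t *\<^sub>R v \<in> V" if t: "t \<in> {0..1}" for t
      using \<gamma>[OF t] d3(2) by (auto simp: d4_def)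
    define E' where "E' t = v - deriv_at \<rho> (q + t *\<^sub>R v) v" for t
    have dE: "(E has_derivative (\<lambda>s. s *\<^sub>R E' t)) (at t)" if t: "t \<in> {0..1}" for t
    proof -
      have l: "linear (deriv_at \<rho> (q + t *\<^sub>R v))"
        by (rule has_derivative_linear[OF retraction_has_derivative[OF ret \<gamma>V[OF t]]])
      have g: "((\<lambda>t. q + t *\<^sub>R v) has_derivative (\<lambda>s. s *\<^sub>R v)) (at t)" by (auto intro!: derivative_eq_intros)
      have "(E has_derivative (\<lambda>s. s *\<^sub>R v - deriv_at \<rho> (q + t *\<^sub>R v) (s *\<^sub>R v))) (at t)"
        unfolding E_def
        by (rule has_derivative_diff[OF g has_derivative_compose[OF g retraction_has_derivative[OF ret \<gamma>V[OF t]]]])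
      then show ?thesis by (simp add: linear_scale[OF l] E'_def scaleR_diff_right)
    qed
    have bE: "norm (E' t) \<le> 3 * \<delta> * L * norm (E t)" if t: "t \<in> {0..1}" for t
    proof -
      let ?x = "q + t *\<^sub>R v"
      have l: "linear (deriv_at \<rho> ?x)"
        by (rule has_derivative_linear[OF retraction_has_derivative[OF ret \<gamma>V[OF t]]])
      have "t * b \<ge> - (1 / 2)"
      proof -
        have "\<bar>t * b\<bar> \<le> 1 * \<bar>b\<bar>" using t unfolding abs_mult by (intro mult_right_mono) auto
        then show ?thesis using ab \<delta>(2) by linarith
      qed
      then have pos: "1 + t * b \<ge> 1 / 2" by simp
      have Rx: "R ?x = (1 + t * b) *\<^sub>R R q"
      proof -
        have "v \<bullet> e = a" by (simp add: v_def inner_add_left Re ee)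
        then have "R ?x = R q + t *\<^sub>R (v - a *\<^sub>R e)" by (simp add: R_def inner_add_left algebra_simps)
        then show ?thesis by (simp add: v_def algebra_simps)
      qed
      \<comment> \<open>along the segment \<open>R\<close> is rescaled, so the radial part of the direction is \<open>b'\<close> times the current value of \<open>R\<close>\<close>
      define b' where "b' = b / (1 + t * b)"
      have v: "v = a *\<^sub>R e + b' *\<^sub>R R ?x" unfolding Rx using pos by (simp add: v_def b'_def)
      have b': "\<bar>b'\<bar> \<le> 2 * \<delta>"
      proof -
        have "\<bar>b'\<bar> = \<bar>b\<bar> / (1 + t * b)" using pos by (simp add: b'_def)
        also have "\<dots> \<le> \<bar>b\<bar> / (1 / 2)" using pos by (intro divide_left_mono) auto
        finally show ?thesis using ab by simp
      qed
      have "E' t = a *\<^sub>R H1 ?x + b' *\<^sub>R H2 ?x"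
      proof -
        have "deriv_at \<rho> ?x v = a *\<^sub>R deriv_at \<rho> ?x e + b' *\<^sub>R deriv_at \<rho> ?x (R ?x)"
          by (subst v) (simp only: linear_add[OF l] linear_scale[OF l])
        then have "E' t = a *\<^sub>R e + b' *\<^sub>R R ?x - (a *\<^sub>R deriv_at \<rho> ?x e + b' *\<^sub>R deriv_at \<rho> ?x (R ?x))"
          unfolding E'_def using v by simp
        then show ?thesis unfolding H1_def H2_def scaleR_diff_right by (simp only: add_diff_add)
      qed
      then have "norm (E' t) \<le> \<bar>a\<bar> * norm (H1 ?x) + \<bar>b'\<bar> * norm (H2 ?x)"
        by (metis norm_triangle_ineq norm_scaleR)
      also have "\<dots> \<le> \<delta> * (L * norm (E t)) + (2 * \<delta>) * (L * norm (E t))"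
        using ab b' HB[OF \<gamma>[OF t]] \<delta>(1) unfolding E_def[symmetric] by (intro add_mono mult_mono) auto
      finally show ?thesis by (simp add: algebra_simps)
    qed
    have qV: "q \<in> V" using \<gamma>V[of 0] by simp
    have "E 1 = 0"
      by (rule self_bounded_derivative_vanishes[OF dE bE])
        (use \<delta>(1,4) L smooth_retractionD(5)[OF ret q(1) qV] in \<open>auto simp: E_def\<close>)
    then have "q + v = \<rho> (q + v)" by (simp add: E_def)
    then have "q + v \<in> M" using smooth_retractionD(3)[OF ret \<gamma>V[of 1]] by simp
    then show "q + a *\<^sub>R e + b *\<^sub>R R q \<in> M" by (simp add: v_def add.assoc)
  qed
qed

section \<open>Parametrised submanifolds\<close>

text \<open>The left inverse \<open>\<kappa>\<close> of \<open>\<psi>\<close> is defined on an open subset of the ambient space.  It provides at the same time a chart of the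
  image, a retraction \<open>\<psi> \<circ> \<kappa>\<close> onto it, and its tangent spaces.\<close>

locale parametrized =
  fixes U :: "'a::euclidean_space set" and \<psi> :: "'a \<Rightarrow> 'e::euclidean_space" and W \<kappa>
  assumes \<psi>: "Cinf_on U \<psi>" and \<kappa>: "Cinf_on W \<kappa>" and im: "\<psi> ` U \<subseteq> W" "\<kappa> ` W \<subseteq> U"
    and inv: "\<And>u. u \<in> U \<Longrightarrow> \<kappa> (\<psi> u) = u"
begin

lemma retraction: "smooth_retraction W (\<psi> ` U) (\<lambda>x. \<psi> (\<kappa> x))"
  unfolding smooth_retraction_def using Cinf_on_compose[OF \<psi> \<kappa> im(2)] im inv by auto

lemma deriv_left_inverse:
  assumes u: "u \<in> U" shows "deriv_at \<kappa> (\<psi> u) (deriv_at \<psi> u v) = v"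
proof -
  have "((\<lambda>u. \<kappa> (\<psi> u)) has_derivative (\<lambda>v. deriv_at \<kappa> (\<psi> u) (deriv_at \<psi> u v))) (at u)"
    by (rule has_derivative_compose[OF Cinf_on_has_derivative[OF \<psi> u] Cinf_on_has_derivative[OF \<kappa>]]) (use im u in auto)
  moreover have "((\<lambda>u. \<kappa> (\<psi> u)) has_derivative (\<lambda>v. v)) (at u)"
    by (rule has_derivative_transform_within_open[OF has_derivative_ident Cinf_on_open[OF \<psi>] u]) (simp add: inv)
  ultimately show ?thesis using has_derivative_unique by (metis (no_types, lifting))
qed

lemma tangent_space_image:
  assumes u: "u \<in> U" shows "tangent_space (\<psi> ` U) (\<psi> u) = range (deriv_at \<psi> u)"
proof -
  let ?\<rho> = "\<lambda>x. \<psi> (\<kappa> x)"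
  have W: "\<psi> u \<in> \<psi> ` U" "\<psi> u \<in> W" using u im by auto
  have d: "deriv_at ?\<rho> (\<psi> u) v = deriv_at \<psi> u (deriv_at \<kappa> (\<psi> u) v)" for v
    by (rule fun_cong[OF deriv_at_eq[OF has_derivative_compose[OF Cinf_on_has_derivative[OF \<kappa> W(2)]]]])
      (simp add: inv[OF u] Cinf_on_has_derivative[OF \<psi> u])
  note iff = tangent_space_iff_retraction[OF retraction W, unfolded d]
  show ?thesis
  proof (intro subset_antisym subsetI)
    fix v assume "v \<in> tangent_space (\<psi> ` U) (\<psi> u)"
    then have "v = deriv_at \<psi> u (deriv_at \<kappa> (\<psi> u) v)" using iff by simp
    then show "v \<in> range (deriv_at \<psi> u)" by (rule range_eqI)
  next
    fix v assume "v \<in> range (deriv_at \<psi> u)"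
    then show "v \<in> tangent_space (\<psi> ` U) (\<psi> u)" unfolding iff by (auto simp: deriv_left_inverse[OF u])
  qed
qed

text \<open>The model space has to be a subspace of the ambient space; the tangent space at \<open>p\<close> serves, identified with the parameter
  space by the derivatives of \<open>\<psi>\<close> and \<open>\<kappa>\<close>.\<close>

lemma submanifold_image: "submanifold DIM('a) (\<psi> ` U)"
  unfolding submanifold_def
proof
  fix p assume "p \<in> \<psi> ` U"
  then obtain u where u: "u \<in> U" "p = \<psi> u" by blast
  have pW: "p \<in> W" using u im by blast
  define \<iota> where "\<iota> = deriv_at \<psi> u"
  define \<pi> where "\<pi> = deriv_at \<kappa> p"
  have \<iota>: "bounded_linear \<iota>"
    unfolding \<iota>_def by (rule has_derivative_bounded_linear[OF Cinf_on_has_derivative[OF \<psi> u(1)]])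
  have \<pi>: "bounded_linear \<pi>"
    unfolding \<pi>_def by (rule has_derivative_bounded_linear[OF Cinf_on_has_derivative[OF \<kappa> pW]])
  have \<pi>\<iota>: "\<pi> (\<iota> v) = v" for v unfolding \<pi>_def \<iota>_def u(2) by (rule deriv_left_inverse[OF u(1)])
  have inj: "inj \<iota>" by (metis \<pi>\<iota> injI)
  have l: "linear \<iota>" by (rule bounded_linear.linear[OF \<iota>])
  have "dim (range \<iota>) = DIM('a)"
    using dim_image_eq[OF l, of UNIV] inj by (simp add: inj_on_def inj_def)
  moreover have "openin (top_of_set (range \<iota>)) (\<iota> ` U)"
  proof -
    have "\<iota> ` U = range \<iota> \<inter> \<pi> -` U" using \<pi>\<iota> by (auto simp: image_iff)
    moreover have "open (\<pi> -` U)"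
      using Cinf_on_open_preimage[OF Cinf_on_linear[OF open_UNIV \<pi>] Cinf_on_open[OF \<psi>]] by simp
    ultimately show ?thesis by (auto simp: openin_open)
  qed
  moreover have f: "smooth_on (\<psi> ` U \<inter> W) (\<lambda>x. \<iota> (\<kappa> x))"
    by (rule Cinf_on_imp_smooth_on[OF Cinf_on_linear_compose[OF \<iota> \<kappa>]]) auto
  moreover have g: "smooth_on (\<iota> ` U) (\<lambda>x. \<psi> (\<pi> x))"
  proof -
    have o: "open (\<pi> -` U)"
      using Cinf_on_open_preimage[OF Cinf_on_linear[OF open_UNIV \<pi>] Cinf_on_open[OF \<psi>]] by simp
    have "Cinf_on (\<pi> -` U) (\<lambda>x. \<psi> (\<pi> x))" by (rule Cinf_on_compose[OF \<psi> Cinf_on_linear[OF o \<pi>]]) auto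
    then show ?thesis by (rule Cinf_on_imp_smooth_on) (use \<pi>\<iota> in auto)
  qed
  moreover have "homeomorphism (\<psi> ` U \<inter> W) (\<iota> ` U) (\<lambda>x. \<iota> (\<kappa> x)) (\<lambda>x. \<psi> (\<pi> x))"
    by (rule homeomorphismI[OF smooth_on_continuous[OF f] smooth_on_continuous[OF g]])
      (use im inv \<pi>\<iota> in \<open>auto simp: image_subset_iff\<close>)
  ultimately show "\<exists>W T U' (f :: 'e \<Rightarrow> 'e) g. open W \<and> p \<in> W \<and> subspace T \<and> dim T = DIM('a) \<and>
      openin (top_of_set T) U' \<and> homeomorphism (\<psi> ` U \<inter> W) U' f g \<and> smooth_on (\<psi> ` U \<inter> W) f \<and> smooth_on U' g"
    using linear_subspace_image[OF l subspace_UNIV] Cinf_on_open[OF \<kappa>] pW by blast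
qed

end

section \<open>Complex projective space\<close>

lemma subspace_horizontal: "subspace (horizontal z)"
  by (simp add: subspace_def horizontal_def inner_add_left)

lemma dim_horizontal:
  fixes z :: "complex^'n::finite"
  assumes "norm z = 1"
  shows "dim (horizontal z) = 2 * CARD('n) - 2"
proof -
  have z: "z \<bullet> z = 1" "z \<noteq> 0" using assms by (auto simp: norm_eq_1)
  have o: "orthogonal z (mult_i z)" by (simp add: orthogonal_def inner_mult_i_self)
  have ne: "mult_i z \<noteq> 0" "z \<noteq> mult_i z" using z inner_mult_i(1)[of z z] inner_mult_i_self[of z] by auto
  have "independent {z, mult_i z}"
    by (rule pairwise_orthogonal_independent) (use o z ne in \<open>auto simp: pairwise_def orthogonal_commute\<close>)
  then have d: "dim (span {z, mult_i z}) = 2" using ne by (simp add: dim_span dim_eq_card_independent)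
  have "horizontal z = {v \<in> UNIV. \<forall>x\<in>span {z, mult_i z}. orthogonal x v}"
  proof -
    have "(\<forall>x\<in>span {z, mult_i z}. orthogonal x v) \<longleftrightarrow> v \<in> horizontal z" for v
    proof
      assume "\<forall>x\<in>span {z, mult_i z}. orthogonal x v"
      then have "orthogonal z v" "orthogonal (mult_i z) v" using span_base[of _ "{z, mult_i z}"] by auto
      then show "v \<in> horizontal z" by (simp add: horizontal_def orthogonal_def inner_commute)
    next
      assume v: "v \<in> horizontal z"
      then have "v \<bullet> x = 0" if "x \<in> span {z, mult_i z}" for x
        by (intro inner_eq_0_span[OF _ that]) (auto simp: horizontal_def)
      then show "\<forall>x\<in>span {z, mult_i z}. orthogonal x v" by (simp add: orthogonal_def inner_commute)
    qed
    then show ?thesis by blast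
  qed
  then have "dim (horizontal z) + 2 = DIM(complex^'n)"
    using dim_subspace_orthogonal_to_vectors[of "span {z, mult_i z}" UNIV] d by (simp add: dim_UNIV)
  then show ?thesis by simp
qed

text \<open>One of the two vectors may have components along \<open>z\<close> and \<open>\<i> z\<close>; their images under \<open>d\<pi>\<close> are orthogonal to those of
  horizontal vectors.\<close>

lemma inner_hopf_deriv:
  assumes "norm z = 1" "a \<in> horizontal z"
  shows "deriv_at hopf z a \<bullet> deriv_at hopf z e = a \<bullet> e"
proof -
  have h: "(\<Sum>i\<in>UNIV. a$i * cnj (z$i)) = 0" using assms horizontal_hermitian by blast
  have n: "(\<Sum>i\<in>UNIV. z$i * cnj (z$i)) = 1" using assms(1) by (simp only: hermitian_self) simp
  have "inner (outer z a + outer a z) (outer z e + outer e z) = 2 * Re (\<Sum>i\<in>UNIV. a$i * cnj (e$i))"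
    unfolding inner_add_left inner_add_right inner_outer h n by simp
  then have "inner (outer z a + outer a z) (outer z e + outer e z) = 2 * (a \<bullet> e)"
    unfolding inner_complex_vec .
  then show ?thesis by (simp add: frechet_derivative_hopf)
qed

text \<open>The second factor is, up to scale, the second derivative of the Hopf map in two horizontal directions.\<close>

lemma inner_hopf_deriv_outer:
  assumes "a \<in> horizontal z" "b \<in> horizontal z" "c \<in> horizontal z"
  shows "deriv_at hopf z a \<bullet> deriv_at hopf b c = 0"
proof -
  have h: "(\<Sum>i\<in>UNIV. b$i * cnj (z$i)) = 0" "(\<Sum>i\<in>UNIV. c$i * cnj (z$i)) = 0"
    using assms horizontal_hermitian by blast+
  have "cnj (\<Sum>i\<in>UNIV. b$i * cnj (z$i)) = (\<Sum>i\<in>UNIV. z$i * cnj (b$i))"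
    "cnj (\<Sum>i\<in>UNIV. c$i * cnj (z$i)) = (\<Sum>i\<in>UNIV. z$i * cnj (c$i))" by (simp_all add: mult.commute)
  then have h': "(\<Sum>i\<in>UNIV. z$i * cnj (b$i)) = 0" "(\<Sum>i\<in>UNIV. z$i * cnj (c$i)) = 0" unfolding h by simp_all
  show ?thesis
    by (simp add: frechet_derivative_hopf inner_add_left inner_add_right inner_outer h')
qed

lemma mult_i_horizontal: "v \<in> horizontal z \<Longrightarrow> mult_i v \<in> horizontal z"
  by (simp add: horizontal_def inner_mult_i)

lemma Cinf_on_hopf: "Cinf_on UNIV hopf"
  unfolding hopf_def[abs_def]
  by (intro Cinf_on_scaleR Cinf_on_const Cinf_on_bilinear[OF bounded_bilinear_outer] Cinf_on_ident) auto

lemma bounded_linear_hopf_deriv: "bounded_linear (deriv_at hopf z)"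
  by (rule has_derivative_bounded_linear[OF Cinf_on_has_derivative[OF Cinf_on_hopf]]) simp

lemma hopf_scaleR: "hopf (c *\<^sub>R z) = (c * c) *\<^sub>R hopf z"
  by (simp add: hopf_def outer_def vec_eq_iff)

lemma bounded_linear_apply: "bounded_linear (\<lambda>P :: complex^'n::finite^'m::finite. P *v z)"
  unfolding linear_conv_bounded_linear[symmetric]
  by (auto intro!: linearI simp: matrix_vector_mult_def vec_eq_iff sum.distrib algebra_simps scaleR_sum_right)

definition herm :: "complex^'n::finite \<Rightarrow> complex^'n \<Rightarrow> complex" where
  "herm z w = (\<Sum>i\<in>UNIV. z$i * cnj (w$i))"

lemma hopf_apply: "hopf y *v z = (1 / sqrt 2) *\<^sub>R (herm z y *s y)"
  by (simp add: hopf_def outer_def herm_def matrix_vector_mult_def vec_eq_iff sum_distrib_left sum_distrib_right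
      scaleR_sum_right mult_ac)

lemma herm_simps: "herm (c *s z) w = c * herm z w" "herm (z + z') w = herm z w + herm z' w"
  "herm (z - z') w = herm z w - herm z' w"
  "herm (r *\<^sub>R z) w = r *\<^sub>R herm z w" "herm z (r *\<^sub>R w) = r *\<^sub>R herm z w" "cnj (herm z w) = herm w z"
  "Re (herm z w) = z \<bullet> w" "norm z = 1 \<Longrightarrow> herm z z = 1"
  by (simp_all add: herm_def sum_distrib_left sum.distrib sum_subtractf algebra_simps scaleR_sum_right
      inner_complex_vec mult.commute hermitian_self)

lemma norm_complex_scale: "norm (c *s z) = cmod c * norm z" for z :: "complex^'n::finite"
  by (simp add: norm_vec_def L2_set_right_distrib norm_mult)

lemma unit_multiple_hopf:
  assumes "norm z = 1" "c \<noteq> 0"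
  shows "hopf ((1 / norm (c *s z)) *\<^sub>R (c *s z)) = hopf z"
proof -
  have "(1 / norm (c *s z)) *\<^sub>R (c *s z) = (c / cmod c) *s z"
    unfolding norm_complex_scale assms(1) vec_eq_iff vector_scaleR_component vector_smult_component
    by (simp add: scaleR_conv_of_real)
  moreover have "norm (c / cmod c) = 1" using assms by (simp add: norm_divide)
  ultimately show ?thesis
    using hopf_eq_iff[of z "(c / cmod c) *s z"] assms by (metis mult_1 norm_complex_scale)
qed


text \<open>A point \<open>y\<close> of the sphere is recovered up to phase from the matrix \<open>P = hopf y\<close> by applying \<open>P\<close> to a fixed vector \<open>z\<close>; dividing
  by the product with \<open>z\<close> gives the multiple of \<open>y\<close> whose component along \<open>z\<close> is 1.\<close>

lemma CP_chart_inverse: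
  fixes z y :: "complex^'n::finite"
  assumes "norm y = 1" "herm z y \<noteq> 0"
  defines "P \<equiv> hopf y"
  shows "Re (herm (P *v z) z) = (cmod (herm z y))\<^sup>2 / sqrt 2"
    "(1 / Re (herm (P *v z) z)) *\<^sub>R (P *v z) = (1 / herm y z) *s y"
proof -
  have c: "herm y z = cnj (herm z y)" by (simp add: herm_simps)
  have 1: "herm (P *v z) z = complex_of_real ((cmod (herm z y))\<^sup>2 / sqrt 2)"
    unfolding P_def hopf_apply herm_simps(1,4) of_real_divide complex_norm_square c
    by (simp add: scaleR_conv_of_real)
  show re: "Re (herm (P *v z) z) = (cmod (herm z y))\<^sup>2 / sqrt 2" unfolding 1 by simp
  have m: "(cmod (herm z y))\<^sup>2 \<noteq> 0" using assms(2) by simp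
  have a: "complex_of_real ((cmod (herm z y))\<^sup>2) = herm z y * herm y z" unfolding c complex_norm_square ..
  have "(1 / Re (herm (P *v z) z)) *\<^sub>R (P *v z) = (1 / (cmod (herm z y))\<^sup>2) *\<^sub>R (herm z y *s y)"
    unfolding re unfolding P_def hopf_apply by simp
  also have "\<dots> = (complex_of_real (1 / (cmod (herm z y))\<^sup>2) * herm z y) *s y"
    unfolding vec_eq_iff vector_scaleR_component vector_smult_component by (simp add: scaleR_conv_of_real)
  also have "complex_of_real (1 / (cmod (herm z y))\<^sup>2) * herm z y = 1 / herm y z"
    unfolding of_real_divide a using assms(2) c by simp
  finally show "(1 / Re (herm (P *v z) z)) *\<^sub>R (P *v z) = (1 / herm y z) *s y" .
qed

lemma horizontal_iff_herm: "w \<in> horizontal z \<longleftrightarrow> herm w z = 0"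
proof
  assume "w \<in> horizontal z" then show "herm w z = 0" unfolding herm_def by (rule horizontal_hermitian)
next
  assume h: "herm w z = 0"
  have "w \<bullet> mult_i z = Im (herm w z)" by (simp add: inner_complex_vec herm_def)
  then show "w \<in> horizontal z" using h herm_simps(7)[of w z] by (simp add: horizontal_def)
qed

text \<open>Affine charts: a line not orthogonal to \<open>z\<close> meets the affine space \<open>z + horizontal z\<close> in exactly one point.
  The chart \<open>f\<close> is given by \<open>CP_chart_inverse\<close>; \<open>\<iota>\<close> embeds horizontal vectors into the space of matrices.\<close>

lemma submanifold_CP: "submanifold (2 * CARD('n) - 2) (CP :: (complex^'n::finite^'n) set)"
  unfolding submanifold_def
proof
  fix p :: "complex^'n^'n" assume "p \<in> CP"
  then obtain z where z: "norm z = 1" "p = hopf z" by (auto simp: CP_def)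
  have hz: "herm z z = 1" using herm_simps(8)[OF z(1)] .
  \<comment> \<open>on the projective space the product is real, and with the real part the chart involves only division by real numbers\<close>
  define h where "h P = Re (herm (P *v z) z)" for P :: "complex^'n^'n"
  define W where "W = {P. h P \<noteq> 0}"
  define \<iota> where "\<iota> w = outer w z" for w
  define T where "T = \<iota> ` horizontal z"
  define f where "f P = \<iota> ((1 / h P) *\<^sub>R (P *v z) - z)" for P
  define g where "g A = hopf ((1 / norm (z + A *v z)) *\<^sub>R (z + A *v z))" for A
  have hC: "Cinf_on V h" if "open V" for V
    unfolding h_def herm_simps
    by (intro Cinf_on_inner Cinf_on_linear_compose[OF bounded_linear_apply] Cinf_on_ident Cinf_on_const that)
  have \<iota>: "bounded_linear \<iota>" unfolding \<iota>_def by (rule bounded_bilinear.bounded_linear_left[OF bounded_bilinear_outer])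
  have \<iota>z: "\<iota> w *v z = w" for w
  proof -
    have "\<iota> w *v z = herm z z *s w"
      by (simp add: \<iota>_def outer_def herm_def matrix_vector_mult_def vec_eq_iff sum_distrib_left mult_ac)
    then show ?thesis by (simp add: hz)
  qed
  have oW: "open W"
    unfolding W_def using Cinf_on_open_preimage[OF hC[OF open_UNIV] open_Compl[OF closed_singleton[of 0]]]
    by (simp add: vimage_def)
  have W: "hopf y \<in> W \<longleftrightarrow> herm z y \<noteq> 0" if "norm y = 1" for y
  proof (cases "herm z y = 0")
    case True then show ?thesis by (simp add: W_def h_def hopf_apply herm_simps)
  next
    case False then show ?thesis using CP_chart_inverse(1)[OF that False] by (simp add: W_def h_def)
  qed
  have pW: "p \<in> W" using W[OF z(1)] z(2) hz by simp
  have inj: "inj_on \<iota> (horizontal z)" by (metis \<iota>z inj_onI)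
  have T: "subspace T" "dim T = 2 * CARD('n) - 2"
    unfolding T_def using linear_subspace_image[OF bounded_linear.linear[OF \<iota>] subspace_horizontal]
      dim_image_eq[OF bounded_linear.linear[OF \<iota>], of "horizontal z"] inj dim_horizontal[OF z(1)]
      span_eq_iff[THEN iffD2, OF subspace_horizontal[of z]] by auto
  have fs: "smooth_on (CP \<inter> W) f"
  proof (rule Cinf_on_imp_smooth_on)
    show "Cinf_on W f" unfolding f_def
      by (intro Cinf_on_linear_compose[OF \<iota>] Cinf_on_diff Cinf_on_const Cinf_on_scaleR Cinf_on_divide hC
          Cinf_on_linear_compose[OF bounded_linear_apply] Cinf_on_ident oW) (auto simp: W_def)
  qed auto
  have nz: "z + w \<noteq> 0" if "w \<in> horizontal z" for w
  proof
    assume "z + w = 0"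
    then have "herm (z + w) z = 0" by (simp add: herm_def)
    then show False using that by (simp add: herm_simps hz horizontal_iff_herm)
  qed
  have gs: "smooth_on T g"
  proof (rule Cinf_on_imp_smooth_on)
    let ?V = "{A :: complex^'n^'n. z + A *v z \<noteq> 0}"
    have c: "Cinf_on UNIV (\<lambda>A :: complex^'n^'n. z + A *v z)"
      by (intro Cinf_on_add Cinf_on_const Cinf_on_linear_compose[OF bounded_linear_apply] Cinf_on_ident open_UNIV)
    have o: "open ?V"
      using Cinf_on_open_preimage[OF c open_Compl[OF closed_singleton[of 0]]] by (simp add: vimage_def)
    show "Cinf_on ?V g" unfolding g_def
      by (rule Cinf_on_compose[OF Cinf_on_hopf])
        (auto intro!: Cinf_on_scaleR Cinf_on_divide Cinf_on_norm Cinf_on_const o Cinf_on_subset[OF c o])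
    show "T \<subseteq> ?V" using nz \<iota>z by (auto simp: T_def)
  qed
  have gz: "norm ((1 / norm (z + w)) *\<^sub>R (z + w)) = 1" if "w \<in> horizontal z" for w using nz[OF that] by simp
  have gT: "g (\<iota> w) \<in> CP \<inter> W \<and> f (g (\<iota> w)) = \<iota> w" if w: "w \<in> horizontal z" for w
  proof -
    define y where "y = (1 / norm (z + w)) *\<^sub>R (z + w)"
    have y: "norm y = 1" using gz[OF w] by (simp add: y_def)
    have hy: "herm y z = 1 / norm (z + w)"
      unfolding y_def herm_simps(2,4) using w hz by (simp add: horizontal_iff_herm scaleR_conv_of_real)
    then have hy0: "herm z y \<noteq> 0" using nz[OF w] herm_simps(6)[of z y] by auto
    have gy: "g (\<iota> w) = hopf y" by (simp add: g_def \<iota>z y_def)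
    have "1 / herm y z = complex_of_real (norm (z + w))" by (simp add: hy)
    then have "(1 / herm y z) *s y = z + w"
      unfolding vec_eq_iff vector_smult_component unfolding y_def vector_scaleR_component
      using nz[OF w] by (simp add: scaleR_conv_of_real)
    then have "f (hopf y) = \<iota> w" using CP_chart_inverse(2)[OF y hy0] by (simp add: f_def h_def)
    then show ?thesis using gy y W[OF y] hy0 by (auto simp: CP_def)
  qed
  have fP: "f P \<in> T \<and> g (f P) = P" if P: "P \<in> CP \<inter> W" for P
  proof -
    obtain y where y: "norm y = 1" "P = hopf y" using P by (auto simp: CP_def)
    have hy0: "herm z y \<noteq> 0" using W[OF y(1)] P y(2) by auto
    have hy1: "herm y z \<noteq> 0" using hy0 herm_simps(6)[of z y] by auto
    define w where "w = (1 / herm y z) *s y - z"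
    have fw: "f P = \<iota> w" using CP_chart_inverse(2)[OF y(1) hy0] by (simp add: f_def h_def y(2) w_def)
    have w: "w \<in> horizontal z" using hy1 by (simp add: horizontal_iff_herm w_def herm_simps hz)
    have "g (f P) = hopf ((1 / norm ((1 / herm y z) *s y)) *\<^sub>R ((1 / herm y z) *s y))"
      by (simp add: fw g_def \<iota>z w_def)
    also have "\<dots> = P" unfolding y(2) using unit_multiple_hopf[OF y(1), of "1 / herm y z"] hy1 by simp
    finally show ?thesis using fw w by (simp add: T_def)
  qed
  have "homeomorphism (CP \<inter> W) T f g"
  proof (rule homeomorphismI[OF smooth_on_continuous[OF fs] smooth_on_continuous[OF gs]])
    show "f ` (CP \<inter> W) \<subseteq> T" using fP by blast
    show "g ` T \<subseteq> CP \<inter> W" using gT by (auto simp: T_def)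
    show "g (f P) = P" if "P \<in> CP \<inter> W" for P using fP that by blast
    show "f (g A) = A" if "A \<in> T" for A using gT that by (auto simp: T_def)
  qed
  then show "\<exists>W T U (f :: complex^'n^'n \<Rightarrow> complex^'n^'n) g. open W \<and> p \<in> W \<and> subspace T \<and> dim T = 2 * CARD('n) - 2 \<and>
      openin (top_of_set T) U \<and> homeomorphism (CP \<inter> W) U f g \<and> smooth_on (CP \<inter> W) f \<and> smooth_on U g"
    using oW pW T fs gs openin_subtopology_self by blast
qed

text \<open>A curve in the projective space lifts to the sphere by \<open>P \<mapsto> P z / norm (P z)\<close>, and the part of the velocity along the
  fibre is killed by the derivative of the Hopf map.\<close>

lemma tangent_space_CP:
  fixes z :: "complex^'n::finite"
  assumes z: "norm z = 1"
  shows "tangent_space CP (hopf z) = deriv_at hopf z ` horizontal z"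
proof (intro subset_antisym subsetI)
  fix x assume "x \<in> tangent_space CP (hopf z)"
  then obtain I \<gamma> where \<gamma>: "Cinf_on I \<gamma>" "(0::real) \<in> I" "\<gamma> ` I \<subseteq> CP" "\<gamma> 0 = hopf z"
    "(\<gamma> has_derivative (\<lambda>t. t *\<^sub>R x)) (at 0)"
    using tangent_spaceE by metis
  let ?V = "{P :: complex^'n^'n. P *v z \<noteq> 0}"
  define \<sigma> where "\<sigma> P = (1 / norm (P *v z)) *\<^sub>R (P *v z)" for P :: "complex^'n^'n"
  have c: "Cinf_on UNIV (\<lambda>P :: complex^'n^'n. P *v z)" by (intro Cinf_on_linear bounded_linear_apply open_UNIV)
  have o: "open ?V"
    using Cinf_on_open_preimage[OF c open_Compl[OF closed_singleton[of 0]]] by (simp add: vimage_def)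
  have \<sigma>: "Cinf_on ?V \<sigma>" unfolding \<sigma>_def
    by (auto intro!: Cinf_on_scaleR Cinf_on_divide Cinf_on_norm Cinf_on_const o Cinf_on_subset[OF c o])
  have hz: "herm z z = 1" by (rule herm_simps(8)[OF z])
  have pz: "hopf z *v z = (1 / sqrt 2) *\<^sub>R z" by (simp add: hopf_apply hz)
  have z0: "z \<noteq> 0" using z by auto
  have \<sigma>0: "\<sigma> (hopf z) = z" "hopf z \<in> ?V" using z z0 by (simp_all add: \<sigma>_def pz)
  have lift: "hopf (\<sigma> P) = P" if P: "P \<in> CP" "P \<in> ?V" for P
  proof -
    obtain y where y: "norm y = 1" "P = hopf y" using P(1) by (auto simp: CP_def)
    have Pz: "P *v z = (complex_of_real (1 / sqrt 2) * herm z y) *s y"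
      unfolding y(2) hopf_apply vec_eq_iff vector_scaleR_component vector_smult_component by (simp add: scaleR_conv_of_real)
    then have "complex_of_real (1 / sqrt 2) * herm z y \<noteq> 0" using P(2) by auto
    then have "hopf (\<sigma> P) = hopf y" unfolding \<sigma>_def Pz by (rule unit_multiple_hopf[OF y(1)])
    then show ?thesis by (simp add: y(2))
  qed
  define u where "u = deriv_at \<sigma> (hopf z) x"
  have I: "open (I \<inter> \<gamma> -` ?V)" by (rule Cinf_on_open_preimage[OF \<gamma>(1) o])
  have I0: "0 \<in> I \<inter> \<gamma> -` ?V" using \<gamma> \<sigma>0 by auto
  have ds: "((\<lambda>t. \<sigma> (\<gamma> t)) has_derivative (\<lambda>t. deriv_at \<sigma> (hopf z) (t *\<^sub>R x))) (at 0)"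
    by (rule has_derivative_compose[OF \<gamma>(5)]) (use Cinf_on_has_derivative[OF \<sigma> \<sigma>0(2)] \<gamma>(4) in simp)
  have "((\<lambda>t. hopf (\<sigma> (\<gamma> t))) has_derivative (\<lambda>t. deriv_at hopf z (deriv_at \<sigma> (hopf z) (t *\<^sub>R x)))) (at 0)"
    by (rule has_derivative_compose[OF ds]) (use Cinf_on_has_derivative[OF Cinf_on_hopf] \<gamma>(4) \<sigma>0 in simp)
  then have "(\<gamma> has_derivative (\<lambda>t. deriv_at hopf z (deriv_at \<sigma> (hopf z) (t *\<^sub>R x)))) (at 0)"
    by (rule has_derivative_transform_within_open[OF _ I I0]) (use lift \<gamma>(3) in auto)
  from fun_cong[OF has_derivative_unique[OF this \<gamma>(5)], of 1] have x: "x = deriv_at hopf z u" by (simp add: u_def)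
  have "((\<lambda>t. \<sigma> (\<gamma> t) \<bullet> \<sigma> (\<gamma> t)) has_derivative (\<lambda>t. \<sigma> (\<gamma> 0) \<bullet> deriv_at \<sigma> (hopf z) (t *\<^sub>R x) + deriv_at \<sigma> (hopf z) (t *\<^sub>R x) \<bullet> \<sigma> (\<gamma> 0))) (at 0)"
    by (rule has_derivative_inner[OF ds ds])
  note sd = this
  have "((\<lambda>t. \<sigma> (\<gamma> t) \<bullet> \<sigma> (\<gamma> t)) has_derivative (\<lambda>t. 0)) (at 0)"
  proof (rule has_derivative_transform_within_open[OF has_derivative_const[of 1] I I0])
    fix t assume "t \<in> I \<inter> \<gamma> -` ?V"
    then have "norm (\<sigma> (\<gamma> t)) = 1" by (simp add: \<sigma>_def)
    then show "1 = \<sigma> (\<gamma> t) \<bullet> \<sigma> (\<gamma> t)" by (simp add: norm_eq_1)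
  qed
  from fun_cong[OF has_derivative_unique[OF sd this], of 1] have "z \<bullet> u + u \<bullet> z = 0"
    by (simp add: u_def \<gamma>(4) \<sigma>0)
  then have uz: "u \<bullet> z = 0" by (simp add: inner_commute)
  define w where "w = u - (u \<bullet> mult_i z) *\<^sub>R mult_i z"
  have zz: "z \<bullet> z = 1" using z by (simp add: norm_eq_1)
  have "w \<in> horizontal z"
    using uz inner_mult_i_self[of z] by (simp add: w_def horizontal_def inner_diff_left inner_mult_i zz)
  moreover have "deriv_at hopf z w = x"
    unfolding w_def x
    by (simp add: linear_diff[OF bounded_linear.linear[OF bounded_linear_hopf_deriv]]
        linear_scale[OF bounded_linear.linear[OF bounded_linear_hopf_deriv]] hopf_deriv_vertical)
  ultimately show "x \<in> deriv_at hopf z ` horizontal z" by blast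
next
  fix x assume "x \<in> deriv_at hopf z ` horizontal z"
  then obtain v where v: "v \<in> horizontal z" "x = deriv_at hopf z v" by blast
  have vz: "v \<bullet> z = 0" "z \<bullet> z = 1" using v z by (simp_all add: horizontal_def norm_eq_1)
  have pos: "1 + t * t * (v \<bullet> v) > 0" for t :: real by (simp add: add_pos_nonneg)
  have n: "(norm (z + t *\<^sub>R v))\<^sup>2 = 1 + t * t * (v \<bullet> v)" for t
    by (simp add: power2_norm_eq_inner inner_add_left inner_add_right vz inner_commute[of z v])
  \<comment> \<open>the projection of \<open>(z + t v) / norm (z + t v)\<close>, written without square roots because the Hopf map is quadratic\<close>
  define \<gamma> where "\<gamma> t = (1 / (1 + t * t * (v \<bullet> v))) *\<^sub>R hopf (z + t *\<^sub>R v)" for t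
  have "\<gamma> t \<in> CP" for t
  proof -
    let ?n = "norm (z + t *\<^sub>R v)"
    have n0: "?n > 0" using n[of t] pos[of t] by (metis zero_less_norm_iff norm_zero power_zero_numeral less_irrefl)
    have "\<gamma> t = hopf ((1 / ?n) *\<^sub>R (z + t *\<^sub>R v))"
      unfolding hopf_scaleR \<gamma>_def n[symmetric] by (simp add: power2_eq_square)
    moreover have "norm ((1 / ?n) *\<^sub>R (z + t *\<^sub>R v)) = 1" using n0 by simp
    ultimately show ?thesis by (auto simp: CP_def)
  qed
  moreover have "Cinf_on UNIV \<gamma>"
    unfolding \<gamma>_def using pos less_irrefl
    by (intro Cinf_on_scaleR Cinf_on_divide Cinf_on_compose[OF Cinf_on_hopf] Cinf_on_add Cinf_on_const Cinf_on_mult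
        Cinf_on_ident open_UNIV) (auto dest: less_imp_neq[symmetric])
  moreover have "(\<gamma> has_derivative (\<lambda>t. deriv_at hopf z (t *\<^sub>R v))) (at 0)"
  proof -
    have 1: "((\<lambda>t. 1 / (1 + t * t * (v \<bullet> v))) has_derivative (\<lambda>t. 0)) (at 0)"
      by (auto intro!: derivative_eq_intros)
    have 2: "((\<lambda>t. hopf (z + t *\<^sub>R v)) has_derivative (\<lambda>t. deriv_at hopf z (t *\<^sub>R v))) (at 0)"
      by (rule has_derivative_compose[of "\<lambda>t. z + t *\<^sub>R v"])
        (use Cinf_on_has_derivative[OF Cinf_on_hopf] in \<open>auto intro!: derivative_eq_intros\<close>)
    show ?thesis unfolding \<gamma>_def using has_derivative_scaleR[OF 1 2] by simp
  qed
  ultimately have "deriv_at hopf z (1 *\<^sub>R v) \<in> tangent_space CP (\<gamma> 0)"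
    by (intro tangent_spaceI[of UNIV \<gamma>]) auto
  then show "x \<in> tangent_space CP (hopf z)" by (simp add: \<gamma>_def v)
qed

section \<open>Projections of minimal horizontal immersions\<close>

lemma orthonormal_plane:
  fixes D :: "real \<times> real \<Rightarrow> 'e::euclidean_space"
  assumes "linear D" "inj D"
  obtains k1 k2 where "D k1 \<bullet> D k1 = 1" "D k2 \<bullet> D k2 = 1" "D k1 \<bullet> D k2 = 0"
proof -
  have "dim (range D) = 2"
    using dim_image_eq[OF assms(1), of UNIV] assms(2) by (simp add: inj_on_def inj_def)
  moreover obtain B where B: "B \<subseteq> range D" "pairwise orthogonal B" "\<And>x. x \<in> B \<Longrightarrow> norm x = 1"
    "independent B" "card B = dim (range D)" "span B = range D"
    using orthonormal_basis_subspace[OF linear_subspace_image[OF assms(1) subspace_UNIV]] by blast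
  ultimately obtain b1 b2 where b: "B = {b1, b2}" "b1 \<noteq> b2" by (auto simp: card_2_iff)
  then obtain k1 k2 where "b1 = D k1" "b2 = D k2" using B(1) by auto
  then show thesis using that[of k1 k2] B(2,3) b by (auto simp: pairwise_def orthogonal_def norm_eq_1)
qed

text \<open>The assumption \<open>minimal\<close> says that the cubic form \<open>\<i> d\<phi>(k) \<bullet> D\<^sup>2\<phi>(w, k)\<close> is trace free in \<open>k\<close>; it is the second
  fundamental form of the projected surface by lemma \<open>lagr_A_L\<close>.\<close>

locale horizontal_surface =
  fixes U :: "(real \<times> real) set" and \<phi> :: "real \<times> real \<Rightarrow> complex^3" and W \<kappa>
  assumes \<phi>: "Cinf_on U \<phi>" and par: "parametrized U (\<lambda>u. hopf (\<phi> u)) W \<kappa>"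
    and unit: "\<And>u. u \<in> U \<Longrightarrow> norm (\<phi> u) = 1"
    and horizontal: "\<And>u v. u \<in> U \<Longrightarrow> deriv_at \<phi> u v \<in> horizontal (\<phi> u)"
    and lagrangian_deriv: "\<And>u v w. u \<in> U \<Longrightarrow> deriv_at \<phi> u v \<bullet> mult_i (deriv_at \<phi> u w) = 0"
    and minimal: "\<And>u w k1 k2. u \<in> U \<Longrightarrow> deriv_at \<phi> u k1 \<bullet> deriv_at \<phi> u k1 = 1 \<Longrightarrow>
      deriv_at \<phi> u k2 \<bullet> deriv_at \<phi> u k2 = 1 \<Longrightarrow> deriv_at \<phi> u k1 \<bullet> deriv_at \<phi> u k2 = 0 \<Longrightarrow>
      mult_i (deriv_at \<phi> u k1) \<bullet> deriv2_at \<phi> u w k1 + mult_i (deriv_at \<phi> u k2) \<bullet> deriv2_at \<phi> u w k2 = 0"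
begin

interpretation parametrized U "\<lambda>u. hopf (\<phi> u)" W \<kappa> by (rule par)

abbreviation "\<psi> \<equiv> \<lambda>u. hopf (\<phi> u)"
abbreviation "L \<equiv> \<psi> ` U"

lemma \<phi>_deriv: "u \<in> U \<Longrightarrow> (\<phi> has_derivative deriv_at \<phi> u) (at u)"
  by (rule Cinf_on_has_derivative[OF \<phi>])

lemma \<psi>_deriv: "u \<in> U \<Longrightarrow> deriv_at \<psi> u v = deriv_at hopf (\<phi> u) (deriv_at \<phi> u v)"
  by (rule fun_cong[OF deriv_at_eq[OF has_derivative_compose[OF \<phi>_deriv Cinf_on_has_derivative[OF Cinf_on_hopf]]]]) auto

lemma tangent_L: "u \<in> U \<Longrightarrow> tangent_space L (\<psi> u) = range (\<lambda>v. deriv_at hopf (\<phi> u) (deriv_at \<phi> u v))"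
  using tangent_space_image[of u] by (simp add: \<psi>_deriv)

lemma L_subset_CP: "L \<subseteq> CP" using unit by (auto simp: CP_def)

lemma CP_J_deriv:
  "u \<in> U \<Longrightarrow> CP_J (\<psi> u) (deriv_at hopf (\<phi> u) (deriv_at \<phi> u v)) = deriv_at hopf (\<phi> u) (mult_i (deriv_at \<phi> u v))"
  by (rule CP_J_hopf[OF unit horizontal])

lemmas hopf_linear = bounded_linear.linear[OF bounded_linear_hopf_deriv]

lemma deriv_linear: "u \<in> U \<Longrightarrow> linear (deriv_at \<phi> u)"
  by (rule has_derivative_linear[OF \<phi>_deriv])

lemma isometric: "u \<in> U \<Longrightarrow> deriv_at hopf (\<phi> u) (deriv_at \<phi> u v) \<bullet> deriv_at hopf (\<phi> u) (deriv_at \<phi> u w) =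
    deriv_at \<phi> u v \<bullet> deriv_at \<phi> u w"
  by (rule inner_hopf_deriv[OF unit horizontal])

lemma deriv_inj:
  assumes u: "u \<in> U" shows "inj (deriv_at \<phi> u)"
proof (rule injI)
  fix v w assume "deriv_at \<phi> u v = deriv_at \<phi> u w"
  then have "deriv_at \<psi> u v = deriv_at \<psi> u w" by (simp add: \<psi>_deriv u)
  then show "v = w" using deriv_left_inverse[OF u] by metis
qed

text \<open>An orthonormal basis of the image of \<open>d\<phi>\<close> is a unitary basis of the horizontal space, by the Lagrangian condition and
  dimension.\<close>

lemma tangent_CP_decomposition:
  assumes u: "u \<in> U"
  shows "tangent_space CP (\<psi> u) = {x + CP_J (\<psi> u) y | x y. x \<in> tangent_space L (\<psi> u) \<and> y \<in> tangent_space L (\<psi> u)}"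
proof -
  obtain k1 k2 where k: "deriv_at \<phi> u k1 \<bullet> deriv_at \<phi> u k1 = 1" "deriv_at \<phi> u k2 \<bullet> deriv_at \<phi> u k2 = 1"
    "deriv_at \<phi> u k1 \<bullet> deriv_at \<phi> u k2 = 0"
    using orthonormal_plane[OF deriv_linear[OF u] deriv_inj[OF u]] by blast
  define f where "f b = deriv_at \<phi> u (if b then k1 else k2)" for b
  let ?D = "deriv_at hopf (\<phi> u)"
  have e: "v = (\<Sum>b\<in>UNIV. (v \<bullet> f b) *\<^sub>R f b) + (\<Sum>b\<in>UNIV. (v \<bullet> mult_i (f b)) *\<^sub>R mult_i (f b))"
    if v: "v \<in> horizontal (\<phi> u)" for v
    by (rule unitary_frame_expansion[OF subspace_horizontal _ _ _ _ _ _ v])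
      (use k horizontal[OF u] mult_i_horizontal[OF horizontal[OF u]] lagrangian_deriv[OF u] dim_horizontal[OF unit[OF u]] in
        \<open>auto simp: f_def inner_commute\<close>)
  define F where "F v = deriv_at \<phi> u ((v \<bullet> f True) *\<^sub>R k1 + (v \<bullet> f False) *\<^sub>R k2)" for v
  have F: "(\<Sum>b\<in>UNIV. (v \<bullet> f b) *\<^sub>R f b) = F v" for v
    by (simp add: F_def f_def UNIV_bool linear_add[OF deriv_linear[OF u]] linear_scale[OF deriv_linear[OF u]])
  have F': "(\<Sum>b\<in>UNIV. (v \<bullet> mult_i (f b)) *\<^sub>R mult_i (f b)) = mult_i (F (- mult_i v))" for v
    unfolding F[symmetric] by (simp add: mult_i_simps inner_mult_i)
  show ?thesis
  proof (intro subset_antisym subsetI)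
    fix x assume "x \<in> tangent_space CP (\<psi> u)"
    then obtain v where v: "v \<in> horizontal (\<phi> u)" "x = ?D v" using tangent_space_CP[OF unit[OF u]] by auto
    have "x = ?D (F v) + ?D (mult_i (F (- mult_i v)))"
      using e[OF v(1)] unfolding F F' v(2) by (metis linear_add[OF hopf_linear])
    also have "?D (mult_i (F (- mult_i v))) = CP_J (\<psi> u) (?D (F (- mult_i v)))"
      unfolding F_def by (rule CP_J_deriv[OF u, symmetric])
    finally have "x = ?D (F v) + CP_J (\<psi> u) (?D (F (- mult_i v)))" .
    moreover have "?D (F v) \<in> tangent_space L (\<psi> u)" for v unfolding tangent_L[OF u] F_def by blast
    ultimately show "x \<in> {x + CP_J (\<psi> u) y | x y. x \<in> tangent_space L (\<psi> u) \<and> y \<in> tangent_space L (\<psi> u)}" by blast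
  next
    fix x assume "x \<in> {x + CP_J (\<psi> u) y | x y. x \<in> tangent_space L (\<psi> u) \<and> y \<in> tangent_space L (\<psi> u)}"
    then obtain v w where x: "x = ?D (deriv_at \<phi> u v) + CP_J (\<psi> u) (?D (deriv_at \<phi> u w))"
      unfolding tangent_L[OF u] by auto
    then have "x = ?D (deriv_at \<phi> u v + mult_i (deriv_at \<phi> u w))"
      by (simp add: CP_J_deriv[OF u] linear_add[OF hopf_linear])
    moreover have "deriv_at \<phi> u v + mult_i (deriv_at \<phi> u w) \<in> horizontal (\<phi> u)"
      by (intro subspace_add subspace_horizontal horizontal mult_i_horizontal u)
    ultimately show "x \<in> tangent_space CP (\<psi> u)" unfolding tangent_space_CP[OF unit[OF u]] by blast
  qed
qed

text \<open>A tangent field \<open>Y\<close> of \<open>L\<close> is orthogonal to \<open>d\<pi>(\<i> d\<phi>(m))\<close>.  The derivative of this relation along \<open>w\<close> contains the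
  second derivative of the Hopf map, which does not contribute by \<open>inner_hopf_deriv_outer\<close>, and
  \<open>d\<pi>(\<i> D\<^sup>2\<phi>(w, m))\<close>, which gives the right-hand side.\<close>

lemma lagr_A_L:
  assumes u: "u \<in> U"
  shows "lagr_A CP CP_J L (\<psi> u) (deriv_at \<psi> u w) (deriv_at \<psi> u y) \<bullet> deriv_at \<psi> u k =
    mult_i (deriv_at \<phi> u y) \<bullet> deriv2_at \<phi> u w k"
proof -
  let ?p = "\<psi> u" and ?x = "deriv_at \<psi> u w" and ?y = "deriv_at \<psi> u y"
  define \<beta> where "\<beta> z = mult_i (deriv_at \<phi> u y) \<bullet> deriv2_at \<phi> u w (deriv_at \<kappa> ?p z)" for z
  have p: "?p \<in> L" "?p \<in> W" using u im by auto
  note ret = retraction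
  have T: "tangent_space L ?p = range (deriv_at \<psi> u)" by (rule tangent_space_image[OF u])
  have J: "CP_J ?p (deriv_at \<psi> u v) = deriv_at hopf (\<phi> u) (mult_i (deriv_at \<phi> u v))" for v
    by (simp add: \<psi>_deriv u CP_J_deriv)
  have \<psi>l: "linear (deriv_at \<psi> u)" by (rule has_derivative_linear[OF Cinf_on_has_derivative[OF \<psi> u]])
  note hm = mult_i_horizontal[OF horizontal[OF u]]
  have "lagr_A CP CP_J L ?p ?x ?y \<bullet> deriv_at \<psi> u k = \<beta> (deriv_at \<psi> u k)"
  proof (rule lagr_A_characterization(2)[where M = L and p = ?p and N = CP and J = CP_J and \<beta> = \<beta> and x = ?x and y = ?y,
        OF subspace_tangent_space[OF ret p] tangent_CP_decomposition[OF u]])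
    fix a b assume "a \<in> tangent_space L ?p" "b \<in> tangent_space L ?p"
    then obtain v v' where v: "a = deriv_at \<psi> u v" "b = deriv_at \<psi> u v'" unfolding T by blast
    show "CP_J ?p (a + b) = CP_J ?p a + CP_J ?p b"
      unfolding v linear_add[OF \<psi>l, symmetric] J
      by (simp add: linear_add[OF deriv_linear[OF u]] mult_i_simps linear_add[OF hopf_linear])
    show "CP_J ?p a \<bullet> CP_J ?p b = a \<bullet> b"
      unfolding v J unfolding \<psi>_deriv[OF u] inner_hopf_deriv[OF unit[OF u] hm] inner_hopf_deriv[OF unit[OF u] horizontal[OF u]]
      by (simp add: inner_mult_i)
    show "a \<bullet> CP_J ?p b = 0"
      unfolding v J unfolding \<psi>_deriv[OF u] inner_hopf_deriv[OF unit[OF u] horizontal[OF u]] by (rule lagrangian_deriv[OF u])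
  next
    fix c a assume "a \<in> tangent_space L ?p"
    then obtain v where v: "a = deriv_at \<psi> u v" unfolding T by blast
    show "CP_J ?p (c *\<^sub>R a) = c *\<^sub>R CP_J ?p a"
      unfolding v linear_scale[OF \<psi>l, symmetric] J
      by (simp add: linear_scale[OF deriv_linear[OF u]] mult_i_simps linear_scale[OF hopf_linear])
  next
    have "?y \<in> tangent_space L ?p" unfolding T by blast
    then show "\<exists>W Y. open W \<and> ?p \<in> W \<and> tangent_field (L \<inter> W) Y \<and> Y ?p = ?y"
      using tangent_field_extension[OF ret p] smooth_retractionD(2)[OF ret] p by blast
  next
    fix W' Y z
    assume Y: "open W'" "?p \<in> W'" "tangent_field (L \<inter> W') Y" "Y ?p = ?y" and z: "z \<in> tangent_space L ?p"
    define m where "m = deriv_at \<kappa> ?p z"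
    have zm: "z = deriv_at \<psi> u m"
      using z deriv_left_inverse[OF u] unfolding T m_def by auto
    have sY: "smooth_on (L \<inter> W') Y" using Y(3) by (simp add: tangent_field_def)
    let ?U = "U \<inter> \<psi> -` W'"
    have oU: "open ?U" by (rule Cinf_on_open_preimage[OF \<psi> Y(1)])
    have uU: "u \<in> ?U" using u Y(2) by auto
    have cY: "Cinf_on ?U (\<lambda>u. Y (\<psi> u))"
      by (rule Cinf_on_smooth_compose[OF sY Cinf_on_subset[OF \<psi> oU]]) auto
    define D where "D = deriv_at (\<lambda>u. Y (\<psi> u)) u w"
    have D: "frechet_derivative Y (at ?p within L) ?x = D"
    proof -
      let ?V = "W \<inter> (\<lambda>x. \<psi> (\<kappa> x)) -` W'"
      have oV: "open ?V" by (rule Cinf_on_open_preimage[OF smooth_retractionD(1)[OF ret] Y(1)])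
      have pV: "?p \<in> ?V" using p inv[OF u] Y(2) by simp
      have c: "Cinf_on ?V (\<lambda>x. Y (\<psi> (\<kappa> x)))"
        by (rule Cinf_on_smooth_compose[OF sY Cinf_on_subset[OF smooth_retractionD(1)[OF ret] oV]]) (use im in auto)
      have "((\<lambda>u. Y (\<psi> (\<kappa> (\<psi> u)))) has_derivative (\<lambda>v. deriv_at (\<lambda>x. Y (\<psi> (\<kappa> x))) ?p (deriv_at \<psi> u v))) (at u)"
        by (rule has_derivative_compose[OF Cinf_on_has_derivative[OF \<psi> u] Cinf_on_has_derivative[OF c pV]])
      then have "((\<lambda>u. Y (\<psi> u)) has_derivative (\<lambda>v. deriv_at (\<lambda>x. Y (\<psi> (\<kappa> x))) ?p (deriv_at \<psi> u v))) (at u)"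
        by (rule has_derivative_transform_within_open[OF _ Cinf_on_open[OF \<phi>] u]) (simp add: inv)
      then have "D = deriv_at (\<lambda>x. Y (\<psi> (\<kappa> x))) ?p ?x" unfolding D_def by (simp add: deriv_at_eq)
      moreover have "frechet_derivative Y (at ?p within L) ?x = deriv_at (\<lambda>x. Y (\<psi> (\<kappa> x))) ?p ?x"
        by (rule deriv_within_tangent[OF ret Y(1,2) p sY]) (simp add: T)
      ultimately show ?thesis by simp
    qed
    \<comment> \<open>the derivative of the Hopf map as a bilinear map in base point and vector\<close>
    define B where "B z v = (1 / sqrt 2) *\<^sub>R (outer z v + outer v z)" for z v :: "complex^3"
    have B: "bounded_bilinear B"
    proof -
      have "bilinear B"
        unfolding bilinear_def B_def
        by (auto intro!: linearI simp: bounded_bilinear.add_left[OF bounded_bilinear_outer]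
            bounded_bilinear.add_right[OF bounded_bilinear_outer] bounded_bilinear.scaleR_left[OF bounded_bilinear_outer]
            bounded_bilinear.scaleR_right[OF bounded_bilinear_outer] algebra_simps)
      then show ?thesis by (simp add: bilinear_conv_bounded_bilinear)
    qed
    have Bh: "deriv_at hopf z v = B z v" for z v by (simp add: B_def frechet_derivative_hopf)
    have d1: "((\<lambda>u. B (\<phi> u) (mult_i (deriv_at \<phi> u m))) has_derivative
        (\<lambda>w. B (\<phi> u) (mult_i (deriv2_at \<phi> u w m)) + B (deriv_at \<phi> u w) (mult_i (deriv_at \<phi> u m)))) (at u)"
      by (rule bounded_bilinear.FDERIV[OF B \<phi>_deriv[OF u]
          bounded_linear.has_derivative[OF bounded_linear_mult_i deriv2_at_has_derivative[OF \<phi> u]]])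
    have d2: "((\<lambda>u. Y (\<psi> u) \<bullet> B (\<phi> u) (mult_i (deriv_at \<phi> u m))) has_derivative
        (\<lambda>w. Y (\<psi> u) \<bullet> (B (\<phi> u) (mult_i (deriv2_at \<phi> u w m)) + B (deriv_at \<phi> u w) (mult_i (deriv_at \<phi> u m)))
          + deriv_at (\<lambda>u. Y (\<psi> u)) u w \<bullet> B (\<phi> u) (mult_i (deriv_at \<phi> u m)))) (at u)"
      by (rule has_derivative_inner[OF Cinf_on_has_derivative[OF cY uU] d1])
    have 0: "Y (\<psi> u') \<bullet> B (\<phi> u') (mult_i (deriv_at \<phi> u' m)) = 0" if u': "u' \<in> ?U" for u'
    proof -
      have U: "u' \<in> U" "\<psi> u' \<in> W'" using u' by auto
      have "Y (\<psi> u') \<in> tangent_space L (\<psi> u')"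
        using Y(3) U tangent_space_Int_open[OF Y(1) U(2), of L] by (auto simp: tangent_field_def)
      then obtain n where "Y (\<psi> u') = B (\<phi> u') (deriv_at \<phi> u' n)" unfolding tangent_L[OF U(1)] Bh by blast
      then show ?thesis
        unfolding Bh[symmetric] by (simp add: inner_hopf_deriv[OF unit horizontal] U lagrangian_deriv)
    qed
    have "((\<lambda>u. Y (\<psi> u) \<bullet> B (\<phi> u) (mult_i (deriv_at \<phi> u m))) has_derivative (\<lambda>w. 0)) (at u)"
      by (rule has_derivative_transform_within_open[OF has_derivative_const oU uU]) (simp add: 0)
    from fun_cong[OF has_derivative_unique[OF d2 this], of w]
    have e: "?y \<bullet> (B (\<phi> u) (mult_i (deriv2_at \<phi> u w m)) + B (deriv_at \<phi> u w) (mult_i (deriv_at \<phi> u m)))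
        + D \<bullet> B (\<phi> u) (mult_i (deriv_at \<phi> u m)) = 0"
      by (simp add: D_def Y(4))
    have "?y \<bullet> B (\<phi> u) (mult_i (deriv2_at \<phi> u w m)) = deriv_at \<phi> u y \<bullet> mult_i (deriv2_at \<phi> u w m)"
      unfolding \<psi>_deriv[OF u] Bh[symmetric] by (rule inner_hopf_deriv[OF unit[OF u] horizontal[OF u]])
    moreover have "?y \<bullet> B (deriv_at \<phi> u w) (mult_i (deriv_at \<phi> u m)) = 0"
      unfolding \<psi>_deriv[OF u] Bh[symmetric] by (intro inner_hopf_deriv_outer horizontal u mult_i_horizontal)
    ultimately have "D \<bullet> B (\<phi> u) (mult_i (deriv_at \<phi> u m)) = mult_i (deriv_at \<phi> u y) \<bullet> deriv2_at \<phi> u w m"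
      using e by (simp add: inner_add_right inner_mult_i)
    then show "frechet_derivative Y (at ?p within L) ?x \<bullet> CP_J ?p z = \<beta> z"
      unfolding D zm J Bh \<beta>_def deriv_left_inverse[OF u] .
  qed (simp add: T)
  then show ?thesis by (simp add: \<beta>_def deriv_left_inverse[OF u])
qed

lemma special_lagrangian_L: "special_lagrangian CP CP_J L"
  unfolding special_lagrangian_def lagrangian_def
proof (intro conjI exI ballI allI impI)
  show "L \<subseteq> CP" by (rule L_subset_CP)
  show "submanifold (2 * 2) (CP :: (complex^3^3) set)" using submanifold_CP[where 'n = 3] by simp
  show "submanifold 2 L" using submanifold_image by (simp add: numeral_2_eq_2)
  fix p assume p: "p \<in> L"
  then obtain u where u: "u \<in> U" "p = \<psi> u" by blast
  note T = tangent_space_image[OF u(1), folded u(2)]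
  fix x assume "x \<in> tangent_space L p"
  then obtain w where x: "x = deriv_at \<psi> u w" unfolding T by blast
  {
    fix y assume "y \<in> tangent_space L p"
    then obtain v where y: "y = deriv_at \<psi> u v" unfolding T by blast
    show "x \<bullet> CP_J p y = 0"
      unfolding x y u(2) \<psi>_deriv[OF u(1)] CP_J_deriv[OF u(1)] inner_hopf_deriv[OF unit[OF u(1)] horizontal[OF u(1)]]
      by (rule lagrangian_deriv[OF u(1)])
  }
  fix B assume "orthonormal_basis_of (tangent_space L p) B"
  then have B: "B \<subseteq> range (deriv_at \<psi> u)" "span B = range (deriv_at \<psi> u)" "pairwise orthogonal B" "\<And>b. b \<in> B \<Longrightarrow> norm b = 1"
    by (auto simp: orthonormal_basis_of_def T)
  have "0 \<notin> B" using B(4) by force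
  then have "independent B" using B(3) by (intro pairwise_orthogonal_independent)
  then have "card B = dim (range (deriv_at \<psi> u))" using B(2) by (metis dim_eq_card_independent dim_span)
  also have "\<dots> = 2"
  proof -
    have l: "linear (deriv_at \<psi> u)" by (rule has_derivative_linear[OF Cinf_on_has_derivative[OF \<psi> u(1)]])
    have "inj (deriv_at \<psi> u)" by (metis injI deriv_left_inverse[OF u(1)])
    then show ?thesis using dim_image_eq[OF l, of UNIV] by (simp add: inj_on_def inj_def)
  qed
  finally obtain b1 b2 where b: "B = {b1, b2}" "b1 \<noteq> b2" by (auto simp: card_2_iff)
  then obtain k1 k2 where k: "b1 = deriv_at \<psi> u k1" "b2 = deriv_at \<psi> u k2" using B(1) by auto
  have o: "b1 \<bullet> b1 = 1" "b2 \<bullet> b2 = 1" "b1 \<bullet> b2 = 0"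
    using B(3,4) b by (auto simp: pairwise_def orthogonal_def norm_eq_1)
  have "(\<Sum>b\<in>B. lagr_A CP CP_J L p x b \<bullet> b) = lagr_A CP CP_J L p x b1 \<bullet> b1 + lagr_A CP CP_J L p x b2 \<bullet> b2"
    using b by simp
  also have "\<dots> = mult_i (deriv_at \<phi> u k1) \<bullet> deriv2_at \<phi> u w k1 + mult_i (deriv_at \<phi> u k2) \<bullet> deriv2_at \<phi> u w k2"
    unfolding k x u(2) by (simp only: lagr_A_L[OF u(1)])
  also have "\<dots> = 0"
    by (rule minimal[OF u(1)]) (use o in \<open>simp_all add: k \<psi>_deriv[OF u(1)] isometric[OF u(1)]\<close>)
  finally show "(\<Sum>b\<in>B. lagr_A CP CP_J L p x b \<bullet> b) = 0" .
qed

lemma horizontal_lift_L: "horizontal_lift U \<phi> L"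
  unfolding horizontal_lift_def immersion_on_def
proof (intro conjI ballI allI)
  show "open U" by (rule Cinf_on_open[OF \<phi>])
  show "smooth_on U \<phi>" by (rule Cinf_on_imp_smooth_on[OF \<phi>]) simp
  show "inj (deriv_at \<phi> u)" if "u \<in> U" for u by (rule deriv_inj[OF that])
  show "\<phi> ` U \<subseteq> sphere 0 1" using unit by auto
  show "mult_i (\<phi> u) \<bullet> deriv_at \<phi> u v = 0" if "u \<in> U" for u v
    using horizontal[OF that, of v] by (simp add: horizontal_def inner_commute)
  show "inj_on (hopf \<circ> \<phi>) U" by (rule inj_on_inverseI[of _ \<kappa>]) (simp add: inv)
  show "(hopf \<circ> \<phi>) ` U = L" by auto
  show "deriv_at (hopf \<circ> \<phi>) u v \<bullet> deriv_at (hopf \<circ> \<phi>) u w = deriv_at \<phi> u v \<bullet> deriv_at \<phi> u w" if "u \<in> U" for u v w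
    unfolding comp_def \<psi>_deriv[OF that] by (rule isometric[OF that])
qed

end

section \<open>Charts and open images\<close>

text \<open>A chart of \<open>S\<close>, with its model space identified with a type of the right dimension.\<close>

lemma submanifold_parametrization:
  fixes S :: "'e::euclidean_space set"
  assumes S: "submanifold DIM('a::euclidean_space) S" "p \<in> S" and Q: "open Q" "p \<in> Q"
  obtains U and \<psi> :: "'a::euclidean_space \<Rightarrow> 'e::euclidean_space" and W \<kappa> u0 where "parametrized U \<psi> W \<kappa>" "u0 \<in> U" "\<psi> u0 = p" "W \<subseteq> Q" "\<psi> ` U = S \<inter> W"
proof -
  obtain W0 T U0 and f :: "'e \<Rightarrow> 'e" and g where W0: "open W0" "p \<in> W0" "subspace T" "dim T = DIM('a)"
    "openin (top_of_set T) U0" "homeomorphism (S \<inter> W0) U0 f g" "smooth_on (S \<inter> W0) f" "smooth_on U0 g"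
    by (rule submanifoldE[OF S]) (rule that; assumption)
  note hom = W0(6)[unfolded homeomorphism_def]
  obtain U' where U': "open U'" "U0 = T \<inter> U'" using W0(5) by (auto simp: openin_open)
  obtain l :: "'a \<Rightarrow> 'e" and k where l: "linear l" "linear k" "l ` UNIV = T" "\<And>x. k (l x) = x" "\<And>y. y \<in> T \<Longrightarrow> l (k y) = y"
  proof -
    have "dim (UNIV :: 'a set) = dim T" using W0(4) by (simp add: dim_UNIV)
    from isometries_subspaces[OF subspace_UNIV W0(3) this] show thesis using that by (metis UNIV_I)
  qed
  have bl: "bounded_linear l" "bounded_linear k" using l(1,2) by (simp_all add: linear_linear)
  obtain V1 F where F: "Cinf_on V1 F" "p \<in> V1" "\<And>x. x \<in> V1 \<Longrightarrow> x \<in> S \<inter> W0 \<Longrightarrow> F x = f x"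
    using smooth_onE[OF W0(7), of p] S(2) W0(2) by (metis IntI)
  define U1 where "U1 = l -` U'"
  have oU1: "open U1"
    unfolding U1_def using Cinf_on_open_preimage[OF Cinf_on_linear[OF open_UNIV bl(1)] U'(1)] by simp
  have lU: "l u \<in> U0" if "u \<in> U1" for u using that l(3) U' by (auto simp: U1_def)
  define \<psi> where "\<psi> u = g (l u)" for u
  define \<kappa> where "\<kappa> x = k (F x)" for x
  have \<psi>C: "Cinf_on U1 \<psi>" unfolding \<psi>_def
    by (rule Cinf_on_smooth_compose[OF W0(8) Cinf_on_linear[OF oU1 bl(1)]]) (use lU in auto)
  have \<kappa>C: "Cinf_on V1 \<kappa>" unfolding \<kappa>_def by (rule Cinf_on_linear_compose[OF bl(2) F(1)])
  let ?O = "V1 \<inter> (W0 \<inter> Q)"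
  have oO: "open ?O" using Cinf_on_open[OF F(1)] W0(1) Q(1) by (intro open_Int)
  define U where "U = U1 \<inter> \<psi> -` ?O"
  have oU: "open U" unfolding U_def by (rule Cinf_on_open_preimage[OF \<psi>C oO])
  define W where "W = ?O \<inter> \<kappa> -` U"
  have oW: "open W" unfolding W_def
    by (rule Cinf_on_open_preimage[OF Cinf_on_subset[OF \<kappa>C oO] oU]) auto
  have inv: "\<kappa> (\<psi> u) = u" if "u \<in> U" for u
  proof -
    have "\<psi> u \<in> S \<inter> W0" "f (\<psi> u) = l u" using lU[of u] that hom by (auto simp: U_def \<psi>_def)
    then show ?thesis using F(3)[of "\<psi> u"] that l(4) by (simp add: \<kappa>_def U_def)
  qed
  have inv': "\<psi> (\<kappa> x) = x" if "x \<in> S" "x \<in> ?O" for x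
  proof -
    have x: "F x = f x" "f x \<in> U0" "g (f x) = x" using F(3)[of x] that hom by auto
    then have "l (k (f x)) = f x" using l(5) U' by auto
    then show ?thesis using x by (simp add: \<psi>_def \<kappa>_def)
  qed
  have im: "\<psi> ` U \<subseteq> W" "\<kappa> ` W \<subseteq> U" using inv by (auto simp: W_def U_def)
  show thesis
  proof (rule that[of U \<psi> W \<kappa> "\<kappa> p"])
    show "parametrized U \<psi> W \<kappa>"
      using Cinf_on_subset[OF \<psi>C oU] Cinf_on_subset[OF \<kappa>C oW] im inv by unfold_locales (auto simp: U_def W_def)
    have p: "p \<in> ?O" using F(2) W0(2) Q(2) by auto
    show "\<psi> (\<kappa> p) = p" by (rule inv'[OF S(2) p])
    have "f p \<in> U0" using S(2) W0(2) hom by auto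
    then have "l (\<kappa> p) \<in> U'" using F(3)[OF F(2)] S(2) W0(2) l(5) U' by (auto simp: \<kappa>_def)
    then show "\<kappa> p \<in> U" using inv'[OF S(2) p] p by (auto simp: U_def U1_def)
    show "W \<subseteq> Q" by (auto simp: W_def)
    show "\<psi> ` U = S \<inter> W"
    proof
      show "\<psi> ` U \<subseteq> S \<inter> W" using im lU hom by (auto simp: U_def \<psi>_def)
      show "S \<inter> W \<subseteq> \<psi> ` U"
      proof
        fix x assume x: "x \<in> S \<inter> W"
        then have "\<psi> (\<kappa> x) = x" "\<kappa> x \<in> U" using inv'[of x] by (auto simp: W_def)
        then show "x \<in> \<psi> ` U" by (metis imageI)
      qed
    qed
  qed
qed

text \<open>Invariance of dimension; it identifies the dimension left open in the definition of a Lagrangian submanifold.\<close>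

lemma submanifold_UNIV_dim:
  assumes "submanifold k (UNIV :: 'e::euclidean_space set)"
  shows "k = DIM('e)"
proof -
  obtain W T U and f :: "'e \<Rightarrow> 'e" and g where W: "open W" "0 \<in> W" "subspace T" "dim T = k"
    "openin (top_of_set T) U" "homeomorphism (UNIV \<inter> W) U f g" "smooth_on (UNIV \<inter> W) f" "smooth_on U g"
    by (rule submanifoldE[OF assms UNIV_I]) (rule that; assumption)
  have h: "homeomorphism W U f g" using W(6) by simp
  have "U \<subseteq> T" using W(5) by (rule openin_imp_subset)
  then have f: "f \<in> W \<rightarrow> T" using h by (auto simp: homeomorphism_def)
  have inj: "inj_on f W" using h by (metis homeomorphism_def inj_on_inverseI)
  have "dim (UNIV :: 'e set) \<le> dim T"
    by (rule invariance_of_dimension_subspaces[OF _ subspace_UNIV W(3) homeomorphism_cont1[OF h] f inj]) (use W in auto)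
  then show ?thesis using W(4) dim_subset_UNIV[of T] by (simp add: dim_UNIV)
qed

text \<open>In a chart of \<open>M\<close> this is invariance of domain.\<close>

lemma injective_continuous_image_open:
  fixes M :: "'e::euclidean_space set" and h :: "'a::euclidean_space \<Rightarrow> 'e"
  assumes M: "submanifold DIM('a) M" and D: "open D" "x0 \<in> D"
    and h: "continuous_on D h" "inj_on h D" "h ` D \<subseteq> M"
  obtains D' W where "open D'" "x0 \<in> D'" "D' \<subseteq> D" "open W" "h ` D' = M \<inter> W"
proof -
  have x0: "h x0 \<in> M" using h(3) D(2) by blast
  obtain W T U and f :: "'e \<Rightarrow> 'e" and g where W: "open W" "h x0 \<in> W" "subspace T" "dim T = DIM('a)"
    "openin (top_of_set T) U" "homeomorphism (M \<inter> W) U f g" "smooth_on (M \<inter> W) f" "smooth_on U g"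
    by (rule submanifoldE[OF M x0]) (rule that; assumption)
  define D' where "D' = D \<inter> h -` W"
  have oD: "open D'" unfolding D'_def by (rule continuous_open_preimage[OF h(1) D(1) W(1)])
  have hD: "h ` D' \<subseteq> M \<inter> W" using h(3) by (auto simp: D'_def)
  have inj: "inj_on f (M \<inter> W)" using W(6) by (metis homeomorphism_def inj_on_inverseI)
  have UT: "U \<subseteq> T" using W(5) by (rule openin_imp_subset)
  have fU: "f ` (M \<inter> W) = U" using W(6) by (simp add: homeomorphism_def)
  have "openin (top_of_set T) ((\<lambda>x. f (h x)) ` D')"
  proof (rule invariance_of_domain_subspaces[of UNIV])
    show "continuous_on D' (\<lambda>x. f (h x))"
      by (rule continuous_on_compose2[OF homeomorphism_cont1[OF W(6)] continuous_on_subset[OF h(1)] hD]) (auto simp: D'_def)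
    show "(\<lambda>x. f (h x)) \<in> D' \<rightarrow> T" using hD fU UT by blast
    show "inj_on (\<lambda>x. f (h x)) D'"
      using comp_inj_on[of h D' f] inj_on_subset[OF h(2), of D'] inj_on_subset[OF inj hD] by (auto simp: D'_def comp_def)
  qed (use W oD in \<open>auto simp: dim_UNIV\<close>)
  moreover have "(\<lambda>x. f (h x)) ` D' \<subseteq> U" using hD fU by blast
  ultimately have "openin (top_of_set U) ((\<lambda>x. f (h x)) ` D')"
    by (metis UT openin_subset_trans)
  then have "openin (top_of_set (M \<inter> W)) (g ` (\<lambda>x. f (h x)) ` D')"
    using homeomorphism_imp_open_map[OF homeomorphism_symD[OF W(6)]] by blast
  moreover have "g ` (\<lambda>x. f (h x)) ` D' = h ` D'"
    using hD W(6) unfolding homeomorphism_def image_image by (intro image_cong) auto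
  ultimately obtain O1 where "open O1" "h ` D' = (M \<inter> W) \<inter> O1" by (auto simp: openin_open)
  then show thesis
    using that[of D' "W \<inter> O1"] oD D(2) W(1,2) by (auto simp: D'_def Int_assoc)
qed

section \<open>Unitary coordinates\<close>

text \<open>The map \<open>L\<close> takes the standard basis to the unitary basis \<open>F\<close>; its inverse takes Hermitian products with \<open>F\<close>.\<close>

lemma unitary_frame:
  fixes F :: "'n::finite \<Rightarrow> complex^'n"
  assumes on: "\<And>i j. F i \<bullet> F j = (if i = j then 1 else 0)" and lag: "\<And>i j. F i \<bullet> mult_i (F j) = 0"
  defines "L \<equiv> \<lambda>z. \<Sum>i\<in>UNIV. z$i *s F i"
  shows "orthogonal_transformation L" "L (c *s z) = c *s L z" "L (\<chi> i. herm v (F i)) = v"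
    "(\<chi> i. herm v (F i)) \<bullet> (\<chi> i. herm w (F i)) = v \<bullet> w"
proof -
  have h: "herm v w = complex_of_real (v \<bullet> w) + \<i> * complex_of_real (v \<bullet> mult_i w)" for v w :: "complex^'n"
    by (rule complex_eqI) (simp_all add: herm_def inner_complex_vec)
  have hF: "herm (F i) (F j) = (if i = j then 1 else 0)" for i j by (simp add: h on lag)
  show L3: "L (\<chi> i. herm v (F i)) = v" for v
  proof -
    have "v = (\<Sum>i\<in>UNIV. (v \<bullet> F i) *\<^sub>R F i) + (\<Sum>i\<in>UNIV. (v \<bullet> mult_i (F i)) *\<^sub>R mult_i (F i))"
      by (rule unitary_frame_expansion[OF subspace_UNIV]) (use on lag in \<open>auto simp: dim_UNIV\<close>)
    also have "\<dots> = (\<Sum>i\<in>UNIV. herm v (F i) *s F i)"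
      unfolding sum.distrib[symmetric]
    proof (rule sum.cong[OF refl])
      fix i
      show "(v \<bullet> F i) *\<^sub>R F i + (v \<bullet> mult_i (F i)) *\<^sub>R mult_i (F i) = herm v (F i) *s F i"
        unfolding h vec_eq_iff vector_add_component vector_scaleR_component vector_smult_component
        by (simp add: scaleR_conv_of_real algebra_simps)
    qed
    finally show ?thesis by (simp add: L_def)
  qed
  have hs: "herm (\<Sum>i\<in>A. f i) w = (\<Sum>i\<in>A. herm (f i) w)" "herm w (\<Sum>i\<in>A. f i) = (\<Sum>i\<in>A. herm w (f i))"
    if "finite A" for A :: "'n set" and f w
    using that by (induction A) (auto simp: herm_def algebra_simps sum.distrib)
  have hr: "herm w (c *s z) = cnj c * herm w z" for c and w z :: "complex^'n"
    by (simp add: herm_def sum_distrib_left algebra_simps)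
  have LL: "L z \<bullet> L w = z \<bullet> w" for z w
  proof -
    have "herm (L z) (L w) = (\<Sum>i\<in>UNIV. \<Sum>j\<in>UNIV. z$j * (cnj (w$i) * herm (F j) (F i)))"
      by (simp add: L_def hs herm_simps(1) hr sum_distrib_left algebra_simps)
    also have "\<dots> = (\<Sum>i\<in>UNIV. z$i * cnj (w$i))"
      by (simp add: hF if_distrib[of "\<lambda>x. _ * x"] sum.delta cong: if_cong)
    finally have "herm (L z) (L w) = herm z w" by (simp add: herm_def)
    then show ?thesis by (metis herm_simps(7))
  qed
  show LC: "L (c *s z) = c *s L z" for c z
    by (simp add: L_def vec_eq_iff sum_distrib_left mult.assoc)
  have "linear L"
  proof (rule linearI)
    show "L (z + w) = L z + L w" for z w by (simp add: L_def vec_eq_iff sum.distrib algebra_simps)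
    show "L (r *\<^sub>R z) = r *\<^sub>R L z" for r z
      by (simp add: L_def vec_eq_iff scaleR_sum_right)
  qed
  then show "orthogonal_transformation L" by (simp add: orthogonal_transformation_def LL)
  show "(\<chi> i. herm v (F i)) \<bullet> (\<chi> i. herm w (F i)) = v \<bullet> w"
    using LL[of "\<chi> i. herm v (F i)" "\<chi> i. herm w (F i)"] by (simp add: L3)
qed

text \<open>Used to take a trace over an orthonormal pair in coordinates.  After multiplication by \<open>s\<close> both claims are polynomial
  consequences of the assumptions.\<close>

lemma orthogonal_matrix_rows_columns:
  fixes a b c d s :: real
  assumes "a\<^sup>2 + b\<^sup>2 = s" "c\<^sup>2 + d\<^sup>2 = s" "a * c + b * d = 0" "s > 0"
  shows "a\<^sup>2 + c\<^sup>2 = b\<^sup>2 + d\<^sup>2" "a * b + c * d = 0"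
proof -
  have "s * c\<^sup>2 = (a * c)\<^sup>2 + b\<^sup>2 * c\<^sup>2" using assms(1) by (auto simp: power2_eq_square algebra_simps)
  also have "a * c = - (b * d)" using assms(3) by simp
  also have "(- (b * d))\<^sup>2 + b\<^sup>2 * c\<^sup>2 = s * b\<^sup>2" using assms(2) by (auto simp: power2_eq_square algebra_simps)
  finally have cb: "c\<^sup>2 = b\<^sup>2" using assms(4) by simp
  then show "a\<^sup>2 + c\<^sup>2 = b\<^sup>2 + d\<^sup>2" using assms(1,2) by simp
  have "s * (a * b + c * d) = (a * c + b * d) * (a * d + b * c)"
  proof -
    have "s * (a * b + c * d) = (c\<^sup>2 + d\<^sup>2) * (a * b) + (a\<^sup>2 + b\<^sup>2) * (c * d)" using assms(1,2) by (simp add: algebra_simps)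
    then show ?thesis by (simp add: power2_eq_square algebra_simps)
  qed
  then show "a * b + c * d = 0" using assms(3,4) by simp
qed

section \<open>The cone over an integral surface\<close>

text \<open>The conclusion of \<open>local_cone_structure\<close>, together with a parametrisation \<open>\<psi>\<close> of an integral surface of \<open>N\<^sub>1\<close> on which height
  \<open>t0\<close> and distance \<open>s0\<close> with respect to the vertex line are constant.\<close>

locale cone_nbhd = adapted_nbhd +
  fixes e c :: "complex^4" and p0 \<epsilon> and O1 :: "(real \<times> real) set" and \<psi> W\<psi> \<kappa>\<psi> u0 and s0 t0 :: real
  assumes p0: "p0 \<in> M" and ball: "\<epsilon> > 0" "ball p0 \<epsilon> \<subseteq> V"
    and e: "norm e = 1" "c \<bullet> e = 0"
    and e_tangent: "\<And>q. q \<in> M \<Longrightarrow> q \<in> ball p0 \<epsilon> \<Longrightarrow> e \<in> T q"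
    and R_tangent: "\<And>q. q \<in> M \<Longrightarrow> q \<in> ball p0 \<epsilon> \<Longrightarrow> q - c - (q \<bullet> e) *\<^sub>R e \<in> T q"
    and e_orth: "\<And>q j. q \<in> M \<Longrightarrow> q \<in> ball p0 \<epsilon> \<Longrightarrow> j \<in> {1, 2} \<Longrightarrow> e \<bullet> X j q = 0"
    and R_orth: "\<And>q j. q \<in> M \<Longrightarrow> q \<in> ball p0 \<epsilon> \<Longrightarrow> j \<in> {1, 2} \<Longrightarrow> (q - c - (q \<bullet> e) *\<^sub>R e) \<bullet> X j q = 0"
    and par: "parametrized O1 \<psi> W\<psi> \<kappa>\<psi>" and u0: "u0 \<in> O1" "\<psi> u0 = p0"
    and \<psi>M: "\<And>u. u \<in> O1 \<Longrightarrow> \<psi> u \<in> M" "\<And>u. u \<in> O1 \<Longrightarrow> \<psi> u \<in> ball p0 \<epsilon>"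
    and \<psi>_range: "\<And>u. u \<in> O1 \<Longrightarrow> range (deriv_at \<psi> u) = span {X 1 (\<psi> u), X 2 (\<psi> u)}"
    and s0: "s0 > 0" "\<And>u. u \<in> O1 \<Longrightarrow> norm (\<psi> u - c - (\<psi> u \<bullet> e) *\<^sub>R e) = s0"
    and t0: "\<And>u. u \<in> O1 \<Longrightarrow> \<psi> u \<bullet> e = t0"
begin

interpretation parametrized O1 \<psi> W\<psi> \<kappa>\<psi> by (rule par)

text \<open>The vector from the vertex line to \<open>x\<close>.\<close>

definition R :: "complex^4 \<Rightarrow> complex^4" where "R x = x - c - (x \<bullet> e) *\<^sub>R e"

lemma \<psi>V: "u \<in> O1 \<Longrightarrow> \<psi> u \<in> V" using \<psi>M ball by blast

lemma ee: "e \<bullet> e = 1" using e(1) by (simp add: norm_eq_1)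

lemma R_e: "R x \<bullet> e = 0" using e(2) by (simp add: R_def inner_diff_left ee)

lemma R_norm: "u \<in> O1 \<Longrightarrow> R (\<psi> u) \<bullet> R (\<psi> u) = s0\<^sup>2"
  using s0(2) by (simp add: R_def power2_norm_eq_inner[symmetric])

lemma R_tan: "u \<in> O1 \<Longrightarrow> R (\<psi> u) \<in> T (\<psi> u)" unfolding R_def by (rule R_tangent[OF \<psi>M])

lemma d\<psi>_span: "u \<in> O1 \<Longrightarrow> deriv_at \<psi> u v \<in> span {X 1 (\<psi> u), X 2 (\<psi> u)}" using \<psi>_range by blast

lemma d\<psi>_tan:
  assumes u: "u \<in> O1" shows "deriv_at \<psi> u v \<in> T (\<psi> u)"
proof -
  have "span {X 1 (\<psi> u), X 2 (\<psi> u)} \<subseteq> T (\<psi> u)"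
    using frame_tangent[OF \<psi>M(1)[OF u] \<psi>V[OF u]] index_le_4
    by (intro span_minimal tangent_subspace[OF \<psi>M(1)[OF u] \<psi>V[OF u]]) auto
  then show ?thesis using d\<psi>_span[OF u] by blast
qed

lemma d\<psi>_orth:
  assumes u: "u \<in> O1" and w: "w \<bullet> X 1 (\<psi> u) = 0" "w \<bullet> X 2 (\<psi> u) = 0"
  shows "deriv_at \<psi> u v \<bullet> w = 0"
proof -
  have "w \<bullet> deriv_at \<psi> u v = 0"
    by (rule inner_eq_0_span[OF _ d\<psi>_span[OF u]]) (use w in auto)
  then show ?thesis by (simp add: inner_commute)
qed

lemma d\<psi>_e: "u \<in> O1 \<Longrightarrow> deriv_at \<psi> u v \<bullet> e = 0"
  by (intro d\<psi>_orth e_orth \<psi>M) auto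

lemma d\<psi>_R: "u \<in> O1 \<Longrightarrow> deriv_at \<psi> u v \<bullet> R (\<psi> u) = 0"
  unfolding R_def by (intro d\<psi>_orth R_orth \<psi>M) auto

lemma d\<psi>_expansion:
  assumes u: "u \<in> O1"
  shows "deriv_at \<psi> u v = (deriv_at \<psi> u v \<bullet> X 1 (\<psi> u)) *\<^sub>R X 1 (\<psi> u) + (deriv_at \<psi> u v \<bullet> X 2 (\<psi> u)) *\<^sub>R X 2 (\<psi> u)"
proof -
  note o = frame_orthonormal[OF \<psi>M(1)[OF u] \<psi>V[OF u]]
  have "deriv_at \<psi> u v \<bullet> X a (\<psi> u) = 0" if "a \<in> {3, 4}" for a
    by (rule d\<psi>_orth[OF u]) (use o that in auto)
  then have "deriv_at \<psi> u v \<bullet> X 3 (\<psi> u) = 0" "deriv_at \<psi> u v \<bullet> X 4 (\<psi> u) = 0" by simp_all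
  then show ?thesis
    using tangent_expansion[OF \<psi>M(1)[OF u] \<psi>V[OF u] d\<psi>_tan[OF u], of v] unfolding sum_1_4 by simp
qed

lemma \<psi>_eq: "u \<in> O1 \<Longrightarrow> \<psi> u = c + t0 *\<^sub>R e + R (\<psi> u)" using t0 by (simp add: R_def)

text \<open>Differentiate \<open>d\<psi>(k) \<bullet> \<i> X j = 0\<close> along the surface: the second derivative of \<open>\<psi>\<close> is expressed by the second fundamental
  form of \<open>M\<close>, whose values on the frame are known.\<close>

lemma surface_second_form:
  assumes u: "u \<in> O1"
  defines "z \<equiv> \<lambda>k. deriv_at \<psi> u k \<bullet> X 1 (\<psi> u)" and "y \<equiv> \<lambda>k. deriv_at \<psi> u k \<bullet> X 2 (\<psi> u)"
  shows "mult_i (deriv_at \<psi> u k) \<bullet> deriv2_at \<psi> u w k =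
    r (\<psi> u) * (z w * ((z k)\<^sup>2 - (y k)\<^sup>2) - 2 * y w * z k * y k)"
proof -
  note q = \<psi>M(1)[OF u] \<psi>V[OF u]
  have j: "mult_i (X j (\<psi> u)) \<bullet> deriv2_at \<psi> u w k = mult_i (deriv_at \<psi> u k) \<bullet> dX j (\<psi> u) (deriv_at \<psi> u w)"
    if j: "j \<in> {1..4}" for j
  proof -
    have d: "((\<lambda>u. deriv_at \<psi> u k \<bullet> mult_i (Xr j (\<psi> u))) has_derivative
        (\<lambda>w. deriv_at \<psi> u k \<bullet> mult_i (dX j (\<psi> u) (deriv_at \<psi> u w)) + deriv2_at \<psi> u w k \<bullet> mult_i (Xr j (\<psi> u)))) (at u)"
      by (rule has_derivative_inner[OF deriv2_at_has_derivative[OF \<psi> u]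
            bounded_linear.has_derivative[OF bounded_linear_mult_i
              has_derivative_compose[OF Cinf_on_has_derivative[OF \<psi> u] dX_has_derivative[OF j q(2)]]]])
    have "((\<lambda>u. deriv_at \<psi> u k \<bullet> mult_i (Xr j (\<psi> u))) has_derivative (\<lambda>w. 0)) (at u)"
    proof (rule has_derivative_transform_within_open[OF has_derivative_const Cinf_on_open[OF \<psi>] u])
      fix u assume u: "u \<in> O1"
      show "0 = deriv_at \<psi> u k \<bullet> mult_i (Xr j (\<psi> u))"
        using lagrangian_orth[OF \<psi>M(1)[OF u] d\<psi>_tan[OF u] frame_tangent[OF \<psi>M(1)[OF u] \<psi>V[OF u] j], of k]
        by (simp add: Xr_eq[OF \<psi>M(1)[OF u] \<psi>V[OF u]])
    qed
    from fun_cong[OF has_derivative_unique[OF d this], of w]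
    have "deriv_at \<psi> u k \<bullet> mult_i (dX j (\<psi> u) (deriv_at \<psi> u w)) + deriv2_at \<psi> u w k \<bullet> mult_i (X j (\<psi> u)) = 0"
      by (simp only: Xr_eq[OF q])
    then show ?thesis
      unfolding inner_mult_i(2)[of "deriv_at \<psi> u k"] inner_commute[of "mult_i (X j (\<psi> u))"] by linarith
  qed
  have "mult_i (deriv_at \<psi> u k) \<bullet> deriv2_at \<psi> u w k =
      (z k *\<^sub>R mult_i (X 1 (\<psi> u)) + y k *\<^sub>R mult_i (X 2 (\<psi> u))) \<bullet> deriv2_at \<psi> u w k"
    by (subst d\<psi>_expansion[OF u]) (simp add: mult_i_simps z_def y_def)
  also have "\<dots> = z k * (mult_i (deriv_at \<psi> u k) \<bullet> dX 1 (\<psi> u) (deriv_at \<psi> u w)) +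
      y k * (mult_i (deriv_at \<psi> u k) \<bullet> dX 2 (\<psi> u) (deriv_at \<psi> u w))"
    by (simp add: inner_add_left j index_le_4)
  also have "\<dots> = r (\<psi> u) * (z w * ((z k)\<^sup>2 - (y k)\<^sup>2) - 2 * y w * z k * y k)"
    unfolding second_form(1,2)[OF q d\<psi>_tan[OF u] d\<psi>_tan[OF u]]
    by (simp add: z_def y_def power2_eq_square algebra_simps)
  finally show ?thesis .
qed

text \<open>At \<open>p0\<close> the line direction, the radial direction and \<open>N\<^sub>1\<close> span the Lagrangian tangent space, so this is a unitary basis
  of \<open>\<complex>\<^sup>4\<close>.  The coordinates with respect to it split off the line factor.\<close>

definition frame0 :: "4 \<Rightarrow> complex^4" where
  "frame0 i = (if i = 1 then e else if i = 2 then (1 / s0) *\<^sub>R R p0 else if i = 3 then X 1 p0 else X 2 p0)"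

lemma frame0_simps: "frame0 1 = e" "frame0 2 = (1 / s0) *\<^sub>R R p0" "frame0 3 = X 1 p0" "frame0 4 = X 2 p0"
  by (simp_all add: frame0_def)

lemma frame0_tangent: "frame0 i \<in> T p0"
proof -
  have p: "p0 \<in> V" "p0 \<in> ball p0 \<epsilon>" using ball by auto
  show ?thesis
    unfolding frame0_def using p0 p frame_tangent[OF p0 p(1)] index_le_4 e_tangent R_tan[OF u0(1)] u0(2)
    by (auto intro!: subspace_scale tangent_subspace)
qed

lemma frame0_lagrangian: "frame0 i \<bullet> mult_i (frame0 j) = 0"
  by (rule lagrangian_orth[OF p0 frame0_tangent frame0_tangent])

lemma frame0_orthonormal: "frame0 i \<bullet> frame0 j = (if i = j then 1 else 0)"
proof -
  have p: "p0 \<in> V" "p0 \<in> ball p0 \<epsilon>" using ball by auto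
  note o = frame_orthonormal[OF p0 p(1)]
  have n: "R p0 \<bullet> R p0 = s0 * s0" using R_norm[OF u0(1)] u0(2) by (simp add: power2_eq_square)
  have z: "e \<bullet> X 1 p0 = 0" "e \<bullet> X 2 p0 = 0" "R p0 \<bullet> X 1 p0 = 0" "R p0 \<bullet> X 2 p0 = 0"
    using e_orth[OF p0 p(2)] R_orth[OF p0 p(2)] by (auto simp: R_def)
  have "\<forall>i j. frame0 i \<bullet> frame0 j = (if i = j then 1 else 0)"
    unfolding forall_4 frame0_simps using s0(1) n z o R_e[of p0] ee by (simp add: inner_commute)
  then show ?thesis by blast
qed

definition from_coords :: "complex^4 \<Rightarrow> complex^4" where "from_coords z = (\<Sum>i\<in>UNIV. z$i *s frame0 i)"

definition coords :: "complex^4 \<Rightarrow> complex^4" where "coords v = (\<chi> i. herm v (frame0 i))"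

lemma from_coords: "orthogonal_transformation from_coords" "from_coords (a *s z) = a *s from_coords z" "from_coords (coords v) = v" "coords v \<bullet> coords w = v \<bullet> w"
  using unitary_frame[of frame0, OF frame0_orthonormal frame0_lagrangian] unfolding from_coords_def coords_def by auto

text \<open>The coordinates in the complement \<open>\<complex>\<^sup>3\<close> of the line factor.\<close>

definition coords3 :: "complex^4 \<Rightarrow> complex^3" where "coords3 v = vector [herm v (frame0 2), herm v (frame0 3), herm v (frame0 4)]"

lemma coords3_nth: "coords3 v $ 1 = herm v (frame0 2)" "coords3 v $ 2 = herm v (frame0 3)" "coords3 v $ 3 = herm v (frame0 4)"
  by (simp_all add: coords3_def)

lemma bounded_linear_coords: "bounded_linear coords"
  unfolding linear_conv_bounded_linear[symmetric] coords_def
  by (auto intro!: linearI simp: vec_eq_iff herm_simps)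

lemma bounded_linear_coords3: "bounded_linear coords3"
  unfolding linear_conv_bounded_linear[symmetric]
  by (auto intro!: linearI simp: vec_eq_iff forall_3 coords3_nth herm_simps)

lemma coords3_mult_i: "coords3 (mult_i v) = mult_i (coords3 v)"
  by (simp add: vec_eq_iff forall_3 coords3_nth herm_simps)

lemma inner_coords3:
  assumes "herm v e = 0" shows "coords3 v \<bullet> coords3 w = v \<bullet> w"
proof -
  have "v \<bullet> w = coords v \<bullet> coords w" by (simp add: from_coords)
  also have "\<dots> = coords3 v \<bullet> coords3 w"
    by (simp add: inner_vec_def sum_4 sum_3 coords_def coords3_nth frame0_simps(1) assms)
  finally show ?thesis by simp
qed

lemma herm_e: "v \<bullet> e = 0 \<Longrightarrow> v \<in> T q \<Longrightarrow> q \<in> M \<Longrightarrow> q \<in> ball p0 \<epsilon> \<Longrightarrow> herm v e = 0"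
  using lagrangian_orth[OF _ _ e_tangent] horizontal_iff_herm[of v e] by (auto simp: horizontal_def)

lemma herm_d\<psi>: "u \<in> O1 \<Longrightarrow> herm (deriv_at \<psi> u v) e = 0"
  by (rule herm_e[OF d\<psi>_e d\<psi>_tan \<psi>M])

lemma herm_R: "u \<in> O1 \<Longrightarrow> herm (R (\<psi> u)) e = 0"
  by (rule herm_e[OF R_e R_tan \<psi>M])

text \<open>The spherical surface: the integral surface as seen from the vertex line, scaled to unit distance.\<close>

definition \<phi> :: "real \<times> real \<Rightarrow> complex^3" where "\<phi> u = (1 / s0) *\<^sub>R coords3 (R (\<psi> u))"

lemma R\<psi>_deriv: "u \<in> O1 \<Longrightarrow> ((\<lambda>u. R (\<psi> u)) has_derivative deriv_at \<psi> u) (at u)"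
proof -
  assume u: "u \<in> O1"
  have "((\<lambda>u. R (\<psi> u)) has_derivative (\<lambda>v. deriv_at \<psi> u v - 0 - (deriv_at \<psi> u v \<bullet> e) *\<^sub>R e)) (at u)"
    unfolding R_def
    by (intro has_derivative_diff Cinf_on_has_derivative[OF \<psi> u] has_derivative_const has_derivative_scaleR_left
        has_derivative_inner_left)
  then show ?thesis by (simp add: d\<psi>_e u)
qed

lemma R\<psi>_Cinf: "Cinf_on O1 (\<lambda>u. R (\<psi> u))"
  unfolding R_def by (intro Cinf_on_diff \<psi> Cinf_on_const Cinf_on_scaleR Cinf_on_inner Cinf_on_open[OF \<psi>])

lemma \<phi>_Cinf: "Cinf_on O1 \<phi>"
  unfolding \<phi>_def
  by (intro Cinf_on_scaleR Cinf_on_const Cinf_on_linear_compose[OF bounded_linear_coords3 R\<psi>_Cinf] Cinf_on_open[OF \<psi>])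

lemma \<phi>_deriv: "u \<in> O1 \<Longrightarrow> deriv_at \<phi> u v = (1 / s0) *\<^sub>R coords3 (deriv_at \<psi> u v)"
  unfolding \<phi>_def
  by (rule fun_cong[OF deriv_at_eq[OF has_derivative_scaleR_right[OF
        bounded_linear.has_derivative[OF bounded_linear_coords3 R\<psi>_deriv]]]])

lemma \<phi>_deriv2: 
  assumes u: "u \<in> O1" shows "deriv2_at \<phi> u w k = (1 / s0) *\<^sub>R coords3 (deriv2_at \<psi> u w k)"
proof -
  have "((\<lambda>u. (1 / s0) *\<^sub>R coords3 (deriv_at \<psi> u k)) has_derivative (\<lambda>w. (1 / s0) *\<^sub>R coords3 (deriv2_at \<psi> u w k))) (at u)"
    by (rule has_derivative_scaleR_right[OF bounded_linear.has_derivative[OF bounded_linear_coords3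
          deriv2_at_has_derivative[OF \<psi> u]]])
  then have "((\<lambda>u. deriv_at \<phi> u k) has_derivative (\<lambda>w. (1 / s0) *\<^sub>R coords3 (deriv2_at \<psi> u w k))) (at u)"
    by (rule has_derivative_transform_within_open[OF _ Cinf_on_open[OF \<psi>] u]) (simp add: \<phi>_deriv)
  then show ?thesis unfolding deriv2_at_def by (simp add: deriv_at_eq)
qed

lemma \<phi>_unit: "u \<in> O1 \<Longrightarrow> norm (\<phi> u) = 1"
  unfolding norm_eq_1 \<phi>_def inner_scaleR_left inner_scaleR_right
  using s0(1) R_norm by (simp add: inner_coords3 herm_R power2_eq_square)

lemma \<phi>_inner:
  assumes u: "u \<in> O1"
  shows "deriv_at \<phi> u v \<bullet> deriv_at \<phi> u w = (deriv_at \<psi> u v \<bullet> deriv_at \<psi> u w) / s0\<^sup>2"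
  using s0(1) by (simp add: \<phi>_deriv u inner_coords3 herm_d\<psi> power2_eq_square)

text \<open>On the integral surface the radial vector and \<open>d\<psi>(v)\<close> are both tangent to \<open>M\<close>, hence orthogonal to each other's multiples
  by \<open>\<i>\<close>.\<close>

lemma \<phi>_horizontal: 
  assumes u: "u \<in> O1" shows "deriv_at \<phi> u v \<in> horizontal (\<phi> u)"
proof -
  have "deriv_at \<psi> u v \<bullet> mult_i (R (\<psi> u)) = 0" by (rule lagrangian_orth[OF \<psi>M(1)[OF u] d\<psi>_tan[OF u] R_tan[OF u]])
  then show ?thesis
    using d\<psi>_R[OF u, of v]
    by (simp add: horizontal_def \<phi>_deriv u \<phi>_def mult_i_simps coords3_mult_i[symmetric] inner_coords3 herm_d\<psi>)
qed

lemma \<phi>_lagrangian: 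
  assumes u: "u \<in> O1" shows "deriv_at \<phi> u v \<bullet> mult_i (deriv_at \<phi> u w) = 0"
  using lagrangian_orth[OF \<psi>M(1)[OF u] d\<psi>_tan[OF u] d\<psi>_tan[OF u], of v w]
  by (simp add: \<phi>_deriv u mult_i_simps coords3_mult_i[symmetric] inner_coords3 herm_d\<psi>)

text \<open>The cubic form of \<open>surface_second_form\<close> is the real part of a complex cube, and the sum over an orthonormal pair replaces
  the quadratic expressions in \<open>k\<close> by a trace, which vanishes.\<close>

lemma \<phi>_minimal:
  assumes u: "u \<in> O1" and k: "deriv_at \<phi> u k1 \<bullet> deriv_at \<phi> u k1 = 1" "deriv_at \<phi> u k2 \<bullet> deriv_at \<phi> u k2 = 1"
    "deriv_at \<phi> u k1 \<bullet> deriv_at \<phi> u k2 = 0"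
  shows "mult_i (deriv_at \<phi> u k1) \<bullet> deriv2_at \<phi> u w k1 + mult_i (deriv_at \<phi> u k2) \<bullet> deriv2_at \<phi> u w k2 = 0"
proof -
  define z y where "z k = deriv_at \<psi> u k \<bullet> X 1 (\<psi> u)" and "y k = deriv_at \<psi> u k \<bullet> X 2 (\<psi> u)" for k
  have s: "s0\<^sup>2 > 0" using s0(1) by simp
  have zy: "deriv_at \<psi> u k \<bullet> deriv_at \<psi> u l = z k * z l + y k * y l" for k l
    unfolding z_def y_def by (subst d\<psi>_expansion[OF u, of k]) (simp add: inner_add_left inner_commute[of "X _ _"])
  have n: "deriv_at \<psi> u k1 \<bullet> deriv_at \<psi> u k1 = s0\<^sup>2" "deriv_at \<psi> u k2 \<bullet> deriv_at \<psi> u k2 = s0\<^sup>2"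
    "deriv_at \<psi> u k1 \<bullet> deriv_at \<psi> u k2 = 0"
    using k s unfolding \<phi>_inner[OF u] by auto
  have o: "(z k1)\<^sup>2 + (z k2)\<^sup>2 = (y k1)\<^sup>2 + (y k2)\<^sup>2" "z k1 * y k1 + z k2 * y k2 = 0"
    using orthogonal_matrix_rows_columns[of "z k1" "y k1" "s0\<^sup>2" "z k2" "y k2"] n s unfolding zy by (auto simp: power2_eq_square)
  have c: "mult_i (deriv_at \<phi> u k) \<bullet> deriv2_at \<phi> u w k =
      (1 / s0\<^sup>2) * (r (\<psi> u) * (z w * ((z k)\<^sup>2 - (y k)\<^sup>2) - 2 * y w * (z k * y k)))" for k
    using surface_second_form[OF u, of k w, folded z_def y_def]
    by (simp add: \<phi>_deriv \<phi>_deriv2 u mult_i_simps coords3_mult_i[symmetric] inner_coords3 herm_d\<psi> herm_simps power2_eq_square mult.assoc)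
  have "mult_i (deriv_at \<phi> u k1) \<bullet> deriv2_at \<phi> u w k1 + mult_i (deriv_at \<phi> u k2) \<bullet> deriv2_at \<phi> u w k2 =
      (1 / s0\<^sup>2) * (r (\<psi> u) * (z w * (((z k1)\<^sup>2 + (z k2)\<^sup>2) - ((y k1)\<^sup>2 + (y k2)\<^sup>2)) - 2 * y w * (z k1 * y k1 + z k2 * y k2)))"
    unfolding c by (simp add: algebra_simps)
  then show ?thesis unfolding o by simp
qed

lemma \<phi>_deriv_inj:
  assumes u: "u \<in> O1" shows "inj (deriv_at \<phi> u)"
proof -
  have l: "linear (deriv_at \<phi> u)" by (rule has_derivative_linear[OF Cinf_on_has_derivative[OF \<phi>_Cinf u]])
  have l': "linear (deriv_at \<psi> u)" by (rule has_derivative_linear[OF Cinf_on_has_derivative[OF \<psi> u]])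
  have "v = 0" if "deriv_at \<phi> u v = 0" for v
  proof -
    have "deriv_at \<psi> u v \<bullet> deriv_at \<psi> u v = 0" using \<phi>_inner[OF u, of v v] that s0(1) by simp
    then have "deriv_at \<psi> u v = deriv_at \<psi> u 0" by (simp add: linear_0[OF l'])
    then show ?thesis using deriv_left_inverse[OF u] by metis
  qed
  then show ?thesis using linear_injective_0[OF l] by blast
qed

text \<open>The projection of \<open>\<phi>\<close> is an immersion because \<open>d\<phi>\<close> is horizontal; the parameter domain is shrunk until it is an embedding.\<close>

lemma horizontal_surface_near:
  obtains U W\<phi> \<kappa>\<phi> where "open U" "u0 \<in> U" "U \<subseteq> O1" "horizontal_surface U \<phi> W\<phi> \<kappa>\<phi>"
proof -
  have C: "Cinf_on O1 (\<lambda>u. hopf (\<phi> u))" by (rule Cinf_on_compose[OF Cinf_on_hopf \<phi>_Cinf]) simp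
  have d: "deriv_at (\<lambda>u. hopf (\<phi> u)) u0 v = deriv_at hopf (\<phi> u0) (deriv_at \<phi> u0 v)" for v
    by (rule fun_cong[OF deriv_at_eq[OF has_derivative_compose[OF Cinf_on_has_derivative[OF \<phi>_Cinf u0(1)]
          Cinf_on_has_derivative[OF Cinf_on_hopf]]]]) simp
  have l: "linear (deriv_at (\<lambda>u. hopf (\<phi> u)) u0)" by (rule has_derivative_linear[OF Cinf_on_has_derivative[OF C u0(1)]])
  have l': "linear (deriv_at \<phi> u0)" by (rule has_derivative_linear[OF Cinf_on_has_derivative[OF \<phi>_Cinf u0(1)]])
  have "v = 0" if "deriv_at (\<lambda>u. hopf (\<phi> u)) u0 v = 0" for v
  proof -
    have "deriv_at \<phi> u0 v \<bullet> deriv_at \<phi> u0 v = 0"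
      using inner_hopf_deriv[OF \<phi>_unit[OF u0(1)] \<phi>_horizontal[OF u0(1)], of v "deriv_at \<phi> u0 v"] that by (simp add: d)
    then have "deriv_at \<phi> u0 v = deriv_at \<phi> u0 0" by (simp add: linear_0[OF l'])
    then show ?thesis using \<phi>_deriv_inj[OF u0(1)] by (metis injD)
  qed
  then have "inj (deriv_at (\<lambda>u. hopf (\<phi> u)) u0)" using linear_injective_0[OF l] by blast
  from immersion_local_left_inverse[OF C u0(1) this]
  obtain U W\<phi> \<kappa>\<phi> where U: "open U" "u0 \<in> U" "U \<subseteq> O1" "Cinf_on W\<phi> \<kappa>\<phi>" "(\<lambda>u. hopf (\<phi> u)) ` U \<subseteq> W\<phi>" "\<kappa>\<phi> ` W\<phi> \<subseteq> U"
    "\<And>u. u \<in> U \<Longrightarrow> \<kappa>\<phi> (hopf (\<phi> u)) = u" by blast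
  have "horizontal_surface U \<phi> W\<phi> \<kappa>\<phi>"
  proof (unfold_locales)
    show "Cinf_on U \<phi>" by (rule Cinf_on_subset[OF \<phi>_Cinf U(1,3)])
    show "Cinf_on U (\<lambda>u. hopf (\<phi> u))" by (rule Cinf_on_subset[OF C U(1,3)])
  qed (use U \<phi>_unit \<phi>_horizontal \<phi>_lagrangian \<phi>_minimal in \<open>auto dest: subsetD[OF U(3)]\<close>)
  then show thesis using that U by blast
qed

text \<open>The model immersion before the choice of unitary coordinates; see \<open>cone_eq\<close>.\<close>

definition cone_point :: "real \<times> real \<times> real \<times> real \<Rightarrow> complex^4" where
  "cone_point x = fst x *\<^sub>R e + (fst (snd x) / s0) *\<^sub>R R (\<psi> (snd (snd x)))"

text \<open>The vector \<open>e\<close> is the first basis vector and \<open>R\<close> has no component along it, so the first coordinate is \<open>t\<close> and the others are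
  \<open>s\<close> times those of \<open>\<phi>\<close>.\<close>

lemma cone_eq: "snd (snd x) \<in> O1 \<Longrightarrow> cone_times_line \<phi> x = coords (cone_point x)"
proof -
  obtain t s u v where x: "x = (t, s, u, v)" by (cases x)
  assume "snd (snd x) \<in> O1"
  then have hR: "herm (R (\<psi> (u, v))) e = 0" using herm_R by (simp add: x)
  have herm_frame: "herm e (frame0 i) = (if i = 1 then 1 else 0)" for i
  proof -
    have "herm (frame0 1) (frame0 i) = complex_of_real (frame0 1 \<bullet> frame0 i) + \<i> * complex_of_real (frame0 1 \<bullet> mult_i (frame0 i))"
      by (rule complex_eqI) (simp_all add: herm_def inner_complex_vec)
    also have "\<dots> = (if i = 1 then 1 else 0)"
      by (cases "i = 1") (simp_all add: frame0_orthonormal frame0_lagrangian)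
    finally show ?thesis by (simp only: frame0_simps(1))
  qed
  have AH: "coords (cone_point (t, s, u, v)) $ i = t *\<^sub>R herm e (frame0 i) + (s / s0) *\<^sub>R herm (R (\<psi> (u, v))) (frame0 i)" for i
    by (simp add: coords_def cone_point_def herm_simps(2,4))
  show "cone_times_line \<phi> x = coords (cone_point x)"
    unfolding x vec_eq_iff forall_4 cone_times_line_nth AH herm_frame \<phi>_def vector_scaleR_component coords3_nth
    by (simp add: scaleR_conv_of_real frame0_simps(1) hR)
qed

lemma cone_point_Cinf: "open U \<Longrightarrow> U \<subseteq> O1 \<Longrightarrow> Cinf_on (UNIV \<times> UNIV \<times> U) cone_point"
  unfolding cone_point_def
  by (intro Cinf_on_add Cinf_on_scaleR Cinf_on_divide Cinf_on_const Cinf_on_compose[OF R\<psi>_Cinf] Cinf_on_linear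
      open_Times open_UNIV bounded_linear_fst bounded_linear_compose[OF bounded_linear_fst bounded_linear_snd]
      bounded_linear_compose[OF bounded_linear_snd bounded_linear_snd])
    (use s0 in auto)

lemma cone_point_deriv:
  assumes "open U" "U \<subseteq> O1" "snd (snd x) \<in> U"
  shows "(cone_point has_derivative (\<lambda>d. fst d *\<^sub>R e + ((fst (snd x) / s0) *\<^sub>R deriv_at \<psi> (snd (snd x)) (snd (snd d)) +
      (fst (snd d) / s0) *\<^sub>R R (\<psi> (snd (snd x)))))) (at x)"
proof -
  have u: "snd (snd x) \<in> O1" using assms by blast
  have 1: "((\<lambda>x. R (\<psi> (snd (snd x)))) has_derivative (\<lambda>d. deriv_at \<psi> (snd (snd x)) (snd (snd d)))) (at x)"
    by (rule has_derivative_compose[of "\<lambda>x. snd (snd x)" "\<lambda>d. snd (snd d)" x UNIV "\<lambda>u. R (\<psi> u)"])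
      (use R\<psi>_deriv[OF u] in \<open>auto intro!: derivative_eq_intros\<close>)
  have 2: "((\<lambda>x. fst (snd x) / s0) has_derivative (\<lambda>d. fst (snd d) / s0)) (at x)"
    using s0 by (auto intro!: derivative_eq_intros)
  have 3: "((\<lambda>x. fst x *\<^sub>R e) has_derivative (\<lambda>d. fst d *\<^sub>R e)) (at x)" by (auto intro!: derivative_eq_intros)
  show ?thesis unfolding cone_point_def by (rule has_derivative_add[OF 3 has_derivative_scaleR[OF 2 1]])
qed

lemma cone_point_inj:
  assumes "snd (snd x) \<in> O1" "snd (snd x') \<in> O1" "fst (snd x) > 0" "fst (snd x') > 0" "cone_point x = cone_point x'"
  shows "x = x'"
proof -
  obtain t s u where x: "x = (t, s, u)" by (cases x)
  obtain t' s' u' where x': "x' = (t', s', u')" by (cases x')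
  have u: "u \<in> O1" "u' \<in> O1" "s > 0" "s' > 0" using assms by (simp_all add: x x')
  have eq: "t *\<^sub>R e + (s / s0) *\<^sub>R R (\<psi> u) = t' *\<^sub>R e + (s' / s0) *\<^sub>R R (\<psi> u')" using assms(5) by (simp add: cone_point_def x x')
  from arg_cong[OF this, of "\<lambda>y. y \<bullet> e"] have t: "t = t'" by (simp add: inner_add_left R_e ee)
  with eq have R: "(s / s0) *\<^sub>R R (\<psi> u) = (s' / s0) *\<^sub>R R (\<psi> u')" by simp
  have n: "norm (R (\<psi> u)) = s0" if "u \<in> O1" for u using s0(2)[OF that] by (simp add: R_def)
  from arg_cong[OF R, of norm] have s: "s = s'" using u s0(1) by (simp add: n)
  with R have "R (\<psi> u) = R (\<psi> u')" using u s0(1) by simp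
  then have "\<psi> u = \<psi> u'" using \<psi>_eq[OF u(1)] \<psi>_eq[OF u(2)] by simp
  then have "u = u'" using inv u by metis
  with t s show ?thesis by (simp add: x x')
qed

lemma cone_immersion:
  assumes U: "open U" "U \<subseteq> O1" and D: "open D" "D \<subseteq> UNIV \<times> UNIV \<times> U" "\<And>x. x \<in> D \<Longrightarrow> fst (snd x) > 0"
  shows "immersion_on D (cone_times_line \<phi>)"
proof -
  have C: "Cinf_on D (\<lambda>x. coords (cone_point x))"
    by (rule Cinf_on_linear_compose[OF bounded_linear_coords Cinf_on_subset[OF cone_point_Cinf[OF U] D(1,2)]])
  have C': "Cinf_on D (cone_times_line \<phi>)"
    by (rule Cinf_on_cong[OF C]) (use D(2) U(2) cone_eq in auto)
  have "inj (deriv_at (cone_times_line \<phi>) x)" if x: "x \<in> D" for x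
  proof -
    have u: "snd (snd x) \<in> U" using subsetD[OF D(2) x] by (simp add: mem_Times_iff)
    then have u: "snd (snd x) \<in> U" "snd (snd x) \<in> O1" using U(2) by auto
    let ?u = "snd (snd x)"
    have l: "linear (deriv_at (cone_times_line \<phi>) x)" by (rule has_derivative_linear[OF Cinf_on_has_derivative[OF C' x]])
    have "((\<lambda>x. coords (cone_point x)) has_derivative (\<lambda>d. coords (fst d *\<^sub>R e + ((fst (snd x) / s0) *\<^sub>R deriv_at \<psi> ?u (snd (snd d)) +
      (fst (snd d) / s0) *\<^sub>R R (\<psi> ?u))))) (at x)"
      by (rule bounded_linear.has_derivative[OF bounded_linear_coords cone_point_deriv[OF U u(1)]])
    then have "(cone_times_line \<phi> has_derivative (\<lambda>d. coords (fst d *\<^sub>R e + ((fst (snd x) / s0) *\<^sub>R deriv_at \<psi> ?u (snd (snd d)) +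
      (fst (snd d) / s0) *\<^sub>R R (\<psi> ?u))))) (at x)"
      by (rule has_derivative_transform_within_open[OF _ D(1) x]) (use D(2) U(2) cone_eq in auto)
    note d = deriv_at_eq[OF this]
    have "d = 0" if 0: "deriv_at (cone_times_line \<phi>) x d = 0" for d
    proof -
      let ?w = "fst d *\<^sub>R e + ((fst (snd x) / s0) *\<^sub>R deriv_at \<psi> ?u (snd (snd d)) + (fst (snd d) / s0) *\<^sub>R R (\<psi> ?u))"
      have "?w \<bullet> ?w = coords ?w \<bullet> coords ?w" by (simp only: from_coords)
      also have "\<dots> = 0" using 0 by (simp add: d)
      finally have w: "?w = 0" by simp
      have "?w \<bullet> e = fst d" by (simp add: inner_add_left ee R_e d\<psi>_e u)
      with w have 1: "fst d = 0" by simp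
      have "?w \<bullet> R (\<psi> ?u) = fst (snd d) * s0"
        using s0(1) by (simp add: inner_add_left d\<psi>_R u R_norm inner_commute[of e] R_e power2_eq_square)
      with w have 2: "fst (snd d) = 0" using s0(1) by simp
      have "deriv_at \<psi> ?u (snd (snd d)) = 0" using w 1 2 s0(1) D(3)[OF x] by simp
      then have "deriv_at \<psi> ?u (snd (snd d)) = deriv_at \<psi> ?u 0"
        using linear_0[OF has_derivative_linear[OF Cinf_on_has_derivative[OF \<psi> u(2)]]] by simp
      then have "snd (snd d) = 0" using deriv_left_inverse[OF u(2)] by metis
      with 1 2 show ?thesis by (simp add: prod_eq_iff)
    qed
    then show ?thesis using linear_injective_0[OF l] by blast
  qed
  then show ?thesis
    unfolding immersion_on_def using D(1) Cinf_on_imp_smooth_on[OF C'] by blast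
qed

text \<open>The assumption \<open>seg\<close> puts the image of the model immersion into \<open>M\<close>, and \<open>injective_continuous_image_open\<close> shows that it
  fills a neighbourhood of \<open>p0\<close>.\<close>

lemma cone_structure:
  assumes M: "submanifold 4 M" and \<delta>: "\<delta> > 0"
    and seg: "\<And>u a b. u \<in> O1 \<Longrightarrow> \<bar>a\<bar> < \<delta> \<Longrightarrow> \<bar>b\<bar> < \<delta> \<Longrightarrow> \<psi> u + a *\<^sub>R e + b *\<^sub>R R (\<psi> u) \<in> M"
  shows "\<exists>W G L U (\<phi> :: real \<times> real \<Rightarrow> complex^3) D.
           open W \<and> p0 \<in> W \<and> unitary_congruence G \<and>
           special_lagrangian CP CP_J L \<and> horizontal_lift U \<phi> L \<and>
           D \<subseteq> UNIV \<times> UNIV \<times> U \<and>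
           immersion_on D (cone_times_line \<phi>) \<and> inj_on (cone_times_line \<phi>) D \<and>
           M \<inter> W = G ` cone_times_line \<phi> ` D"
proof -
  obtain U W\<phi> \<kappa>\<phi> where U: "open U" "u0 \<in> U" "U \<subseteq> O1" and hs: "horizontal_surface U \<phi> W\<phi> \<kappa>\<phi>"
    by (rule horizontal_surface_near)
  \<comment> \<open>the bound 1 keeps the distance parameter positive\<close>
  define \<eta> where "\<eta> = min \<delta> 1"
  have \<eta>: "\<eta> > 0" "\<eta> \<le> \<delta>" "\<eta> \<le> 1" using \<delta> by (auto simp: \<eta>_def)
  define D0 where "D0 = {t0 - \<eta> <..< t0 + \<eta>} \<times> {s0 * (1 - \<eta>) <..< s0 * (1 + \<eta>)} \<times> U"
  have oD0: "open D0" unfolding D0_def using U(1) by (intro open_Times) auto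
  have D0: "D0 \<subseteq> UNIV \<times> UNIV \<times> U" by (auto simp: D0_def)
  have D0_pos: "fst (snd x) > 0" if "x \<in> D0" for x
  proof -
    have "0 \<le> s0 * (1 - \<eta>)" using s0(1) \<eta> by simp
    then show ?thesis using that by (auto simp: D0_def)
  qed
  define h where "h x = c + cone_point x" for x
  have hM: "h x \<in> M" if x: "x \<in> D0" for x
  proof -
    obtain t s u where xx: "x = (t, s, u)" by (cases x)
    have u: "u \<in> O1" "\<bar>t - t0\<bar> < \<delta>" using x U(3) \<eta> by (auto simp: D0_def xx)
    have "s / s0 - 1 < \<eta>" "- \<eta> < s / s0 - 1"
      using x s0(1) by (auto simp: D0_def xx field_simps)
    then have s: "\<bar>s / s0 - 1\<bar> < \<delta>" using \<eta> by (simp add: abs_less_iff)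
    have "h x = \<psi> u + (t - t0) *\<^sub>R e + (s / s0 - 1) *\<^sub>R R (\<psi> u)"
      by (subst \<psi>_eq[OF u(1)]) (simp add: h_def cone_point_def xx algebra_simps)
    then show ?thesis using seg[OF u s] by simp
  qed
  have hinj: "inj_on h D0"
  proof (rule inj_onI)
    fix x y assume xy: "x \<in> D0" "y \<in> D0" "h x = h y"
    have "snd (snd x) \<in> O1" "snd (snd y) \<in> O1" using xy(1,2) U(3) by (auto simp: D0_def)
    then show "x = y" using cone_point_inj[OF _ _ D0_pos[OF xy(1)] D0_pos[OF xy(2)]] xy(3) by (simp add: h_def)
  qed
  have hcont: "continuous_on D0 h"
    unfolding h_def by (intro continuous_intros continuous_on_subset[OF Cinf_on_continuous[OF cone_point_Cinf[OF U(1,3)]] D0])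
  have x0: "(t0, s0, u0) \<in> D0" using U(2) \<eta> s0(1) by (auto simp: D0_def algebra_simps)
  have hx0: "h (t0, s0, u0) = p0"
    using \<psi>_eq[OF u0(1)] s0(1) u0(2) by (simp add: h_def cone_point_def add.assoc)
  have M': "submanifold DIM(real \<times> real \<times> real \<times> real) M" using M by (simp add: numeral_eq_Suc)
  obtain D W where D: "open D" "(t0, s0, u0) \<in> D" "D \<subseteq> D0" "open W" "h ` D = M \<inter> W"
    by (rule injective_continuous_image_open[OF M' oD0 x0 hcont hinj]) (use hM in auto)
  define G where "G z = from_coords z + c" for z
  have GD: "G (cone_times_line \<phi> x) = h x" if "x \<in> D" for x
  proof -
    have "x \<in> UNIV \<times> UNIV \<times> U" using that D(3) D0 by blast
    then have "snd (snd x) \<in> O1" using U(3) by (auto simp: mem_Times_iff)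
    then show ?thesis by (simp add: cone_eq G_def from_coords h_def)
  qed
  have ucong: "unitary_congruence G"
    unfolding unitary_congruence_def G_def using from_coords by blast
  have "inj_on (cone_times_line \<phi>) D"
    by (rule inj_on_imageI2[of G]) (use hinj D(3) GD in \<open>auto simp: inj_on_def\<close>)
  moreover have "immersion_on D (cone_times_line \<phi>)"
    by (rule cone_immersion[OF U(1,3) D(1)]) (use D(3) D0 D0_pos in auto)
  moreover have "M \<inter> W = G ` cone_times_line \<phi> ` D"
    unfolding D(5)[symmetric] image_image using GD by (intro image_cong) auto
  moreover have "p0 \<in> W" using D(2,5) hx0 by (metis IntD2 imageI)
  moreover have "D \<subseteq> UNIV \<times> UNIV \<times> U" using D(3) D0 by blast
  ultimately show ?thesis
    using D(4) ucong horizontal_surface.special_lagrangian_L[OF hs] horizontal_surface.horizontal_lift_L[OF hs] by blast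
qed

end

section \<open>Local congruence with the model\<close>

theorem theorem3p1:
  fixes M :: "(complex^4) set"
  assumes "special_lagrangian UNIV std_J M"
    and "\<And>p. p \<in> M \<Longrightarrow> \<exists>W X r. open W \<and> p \<in> W \<and>
           adapted_frame UNIV std_J M W X r \<and>
           integrable_distribution 2 (M \<inter> W) (\<lambda>q. span {X 1 q, X 2 q}) \<and>
           (\<forall>q\<in>M \<inter> W. cov_deriv M M (X 1) q (X 1 q) \<notin> span {X 1 q, X 2 q})"
  shows "\<forall>p\<in>M. \<exists>W G L U (\<phi> :: real \<times> real \<Rightarrow> complex^3) D.
           open W \<and> p \<in> W \<and> unitary_congruence G \<and>
           special_lagrangian CP CP_J L \<and> horizontal_lift U \<phi> L \<and>
           D \<subseteq> UNIV \<times> UNIV \<times> U \<and>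
           immersion_on D (cone_times_line \<phi>) \<and> inj_on (cone_times_line \<phi>) D \<and>
           M \<inter> W = G ` cone_times_line \<phi> ` D"
proof
  fix p assume p: "p \<in> M"
  have lag: "lagrangian UNIV std_J M" using assms(1) by (simp add: special_lagrangian_def)
  obtain n where n: "submanifold (2 * n) (UNIV :: (complex^4) set)" "submanifold n M"
    using lag by (auto simp: lagrangian_def)
  have M4: "submanifold 4 M" using n submanifold_UNIV_dim[OF n(1)] by simp
  obtain W X r where W: "open W" "p \<in> W" "adapted_frame UNIV std_J M W X r"
    "integrable_distribution 2 (M \<inter> W) (\<lambda>q. span {X 1 q, X 2 q})"
    "\<forall>q\<in>M \<inter> W. cov_deriv M M (X 1) q (X 1 q) \<notin> span {X 1 q, X 2 q}"
    using assms(2)[OF p] by (elim exE conjE)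
  obtain V \<rho> where V: "smooth_retraction V M \<rho>" "p \<in> V" "V \<subseteq> W"
    by (rule submanifold_smooth_retraction[OF M4 p W(1,2)]) (rule that; assumption)
  have pW: "p \<in> M \<inter> W" using p W(2) by blast
  note integrable_near = W(4)
  interpret adapted_nbhd M W V X r \<rho>
    by unfold_locales (use lag W V in auto)
  obtain \<epsilon> where \<epsilon>: "\<epsilon> > 0" "ball p \<epsilon> \<subseteq> V" using V(2) retraction_facts(2) open_contains_ball by blast
  obtain e c where e: "norm e = 1" "c \<bullet> e = 0"
    and e_tan: "\<And>q. q \<in> M \<Longrightarrow> q \<in> ball p \<epsilon> \<Longrightarrow> e \<in> T q"
    and R_tan: "\<And>q. q \<in> M \<Longrightarrow> q \<in> ball p \<epsilon> \<Longrightarrow> q - c - (q \<bullet> e) *\<^sub>R e \<in> T q"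
    and R_nz: "\<And>q. q \<in> M \<Longrightarrow> q \<in> ball p \<epsilon> \<Longrightarrow> q - c - (q \<bullet> e) *\<^sub>R e \<noteq> 0"
    and e_orth: "\<And>q j. q \<in> M \<Longrightarrow> q \<in> ball p \<epsilon> \<Longrightarrow> j \<in> {1, 2} \<Longrightarrow> e \<bullet> X j q = 0"
    and R_orth: "\<And>q j. q \<in> M \<Longrightarrow> q \<in> ball p \<epsilon> \<Longrightarrow> j \<in> {1, 2} \<Longrightarrow> (q - c - (q \<bullet> e) *\<^sub>R e) \<bullet> X j q = 0"
    by (rule local_cone_structure[OF p V(2) \<epsilon>(2)]) (assumption | rule that)+
  obtain \<delta> where \<delta>: "\<delta> > 0" and seg: "\<And>q a b. q \<in> M \<Longrightarrow> q \<in> ball p \<delta> \<Longrightarrow> \<bar>a\<bar> < \<delta> \<Longrightarrow> \<bar>b\<bar> < \<delta> \<Longrightarrow>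
      q + a *\<^sub>R e + b *\<^sub>R (q - c - (q \<bullet> e) *\<^sub>R e) \<in> M"
    by (rule ruled_segments[OF V(1) p \<epsilon> e e_tan R_tan]) (assumption | rule that)+
  obtain S where S: "submanifold 2 S" "p \<in> S" "S \<subseteq> M \<inter> W" and TS: "\<forall>q\<in>S. tangent_space S q = span {X 1 q, X 2 q}"
    using bspec[OF integrable_near[unfolded integrable_distribution_def] pW] by (elim exE conjE)
  have S': "submanifold DIM(real \<times> real) S" using S(1) by (simp add: numeral_2_eq_2)
  define b where "b = min \<epsilon> \<delta>"
  have pb: "p \<in> ball p b" using \<epsilon>(1) \<delta> by (simp add: b_def)
  obtain U and \<psi> :: "real \<times> real \<Rightarrow> complex^4" and Q \<kappa> u0 where U: "parametrized U \<psi> Q \<kappa>" "u0 \<in> U" "\<psi> u0 = p"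
    "Q \<subseteq> ball p b" "\<psi> ` U = S \<inter> Q"
    by (rule submanifold_parametrization[OF S' S(2) open_ball pb]) (rule that; assumption)
  interpret P: parametrized U \<psi> Q \<kappa> by (rule U(1))
  have \<psi>S: "\<psi> u \<in> S" "\<psi> u \<in> Q" "\<psi> u \<in> M" "\<psi> u \<in> ball p \<epsilon>" "\<psi> u \<in> ball p \<delta>" if "u \<in> U" for u
  proof -
    have "\<psi> u \<in> S \<inter> Q" using U(5) that by blast
    then show "\<psi> u \<in> S" "\<psi> u \<in> Q" "\<psi> u \<in> M" "\<psi> u \<in> ball p \<epsilon>" "\<psi> u \<in> ball p \<delta>"
      using S(3) U(4) by (auto simp: b_def)
  qed
  have range: "range (deriv_at \<psi> u) = span {X 1 (\<psi> u), X 2 (\<psi> u)}" if u: "u \<in> U" for u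
    using P.tangent_space_image[OF u] tangent_space_Int_open[OF Cinf_on_open[OF P.\<kappa>] \<psi>S(2)[OF u], of S] TS \<psi>S(1)[OF u]
    unfolding U(5) by simp
  define R where "R x = x - c - (x \<bullet> e) *\<^sub>R e" for x
  have orth: "deriv_at \<psi> u v \<bullet> w = 0"
    if "u \<in> U" "w \<bullet> X 1 (\<psi> u) = 0" "w \<bullet> X 2 (\<psi> u) = 0" for u v w
  proof -
    have "w \<bullet> deriv_at \<psi> u v = 0"
      by (rule inner_eq_0_span[of "{X 1 (\<psi> u), X 2 (\<psi> u)}"]) (use range[OF that(1)] that in auto)
    then show ?thesis by (simp add: inner_commute)
  qed
  have d_e: "deriv_at \<psi> u v \<bullet> e = 0" if "u \<in> U" for u v
    by (rule orth[OF that]) (use e_orth[OF \<psi>S(3,4)[OF that]] in auto)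
  have d_R: "deriv_at \<psi> u v \<bullet> R (\<psi> u) = 0" if "u \<in> U" for u v
    unfolding R_def by (rule orth[OF that]) (use R_orth[OF \<psi>S(3,4)[OF that]] in auto)
  obtain \<eta> where \<eta>: "\<eta> > 0" "ball u0 \<eta> \<subseteq> U" using U(2) Cinf_on_open[OF P.\<psi>] open_contains_ball by blast
  \<comment> \<open>height and distance are constant on the integral surface, because its tangent plane \<open>N\<^sub>1\<close> is orthogonal to \<open>e\<close> and \<open>R\<close>\<close>
  have dt: "((\<lambda>u. \<psi> u \<bullet> e) has_derivative (\<lambda>v. 0)) (at u within ball u0 \<eta>)" if "u \<in> ball u0 \<eta>" for u
  proof -
    have u: "u \<in> U" using \<eta> that by blast
    show ?thesis
      using has_derivative_inner_left[OF Cinf_on_has_derivative[OF P.\<psi> u], of e] d_e[OF u]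
      by (simp add: has_derivative_at_withinI)
  qed
  then obtain t0 where t0: "\<forall>u\<in>ball u0 \<eta>. \<psi> u \<bullet> e = t0"
    using has_derivative_zero_constant[OF convex_ball dt] by blast
  have ds: "((\<lambda>u. R (\<psi> u) \<bullet> R (\<psi> u)) has_derivative (\<lambda>v. 0)) (at u within ball u0 \<eta>)" if "u \<in> ball u0 \<eta>" for u
  proof -
    have u: "u \<in> U" using \<eta> that by blast
    have "((\<lambda>u. R (\<psi> u)) has_derivative (\<lambda>v. deriv_at \<psi> u v - 0 - (deriv_at \<psi> u v \<bullet> e) *\<^sub>R e)) (at u)"
      unfolding R_def
      by (intro has_derivative_diff Cinf_on_has_derivative[OF P.\<psi> u] has_derivative_const has_derivative_scaleR_left
          has_derivative_inner_left)
    then have "((\<lambda>u. R (\<psi> u)) has_derivative deriv_at \<psi> u) (at u)" by (simp add: d_e u)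
    from has_derivative_inner[OF this this] show ?thesis
      by (simp add: has_derivative_at_withinI d_R[OF u] inner_commute[of "R _" "deriv_at _ _ _"])
  qed
  then obtain s1 where s1: "\<forall>u\<in>ball u0 \<eta>. R (\<psi> u) \<bullet> R (\<psi> u) = s1"
    using has_derivative_zero_constant[OF convex_ball ds] by blast
  define s0 where "s0 = norm (R p)"
  have u0b: "u0 \<in> ball u0 \<eta>" using \<eta>(1) by simp
  have s0: "s0 > 0" using R_nz[OF p] \<epsilon>(1) by (simp add: s0_def R_def)
  have nR: "norm (R (\<psi> u)) = s0" if "u \<in> ball u0 \<eta>" for u
  proof -
    have "R (\<psi> u) \<bullet> R (\<psi> u) = R (\<psi> u0) \<bullet> R (\<psi> u0)" using s1 that u0b by simp
    then show ?thesis by (simp add: s0_def U(3) norm_eq_sqrt_inner)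
  qed
  let ?O = "ball u0 \<eta>" and ?Q = "Q \<inter> \<kappa> -` ball u0 \<eta>"
  have oQ: "open ?Q" by (rule Cinf_on_open_preimage[OF P.\<kappa> open_ball])
  have par: "parametrized ?O \<psi> ?Q \<kappa>"
  proof
    show "Cinf_on ?O \<psi>" by (rule Cinf_on_subset[OF P.\<psi> open_ball \<eta>(2)])
    show "Cinf_on ?Q \<kappa>" by (rule Cinf_on_subset[OF P.\<kappa> oQ]) blast
    show inv: "\<kappa> (\<psi> u) = u" if "u \<in> ?O" for u using P.inv subsetD[OF \<eta>(2) that] by blast
    show "\<psi> ` ?O \<subseteq> ?Q"
    proof (rule image_subsetI)
      fix u assume u: "u \<in> ?O"
      then show "\<psi> u \<in> ?Q" using inv[OF u] \<psi>S(2)[OF subsetD[OF \<eta>(2) u]] by simp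
    qed
    show "\<kappa> ` ?Q \<subseteq> ?O" by blast
  qed
  interpret C: cone_nbhd M W V X r \<rho> e c p \<epsilon> ?O \<psi> ?Q \<kappa> u0 s0 t0
  proof (rule cone_nbhd.intro[OF adapted_nbhd_axioms], rule cone_nbhd_axioms.intro)
    fix u assume u: "u \<in> ?O"
    note uU = subsetD[OF \<eta>(2) u]
    show "\<psi> u \<in> M" "\<psi> u \<in> ball p \<epsilon>" by (rule \<psi>S[OF uU])+
    show "range (deriv_at \<psi> u) = span {X 1 (\<psi> u), X 2 (\<psi> u)}" by (rule range[OF uU])
    show "norm (\<psi> u - c - (\<psi> u \<bullet> e) *\<^sub>R e) = s0" using nR[OF u] by (simp only: R_def)
    show "\<psi> u \<bullet> e = t0" using t0 u by blast
  qed (fact p \<epsilon> e e_tan R_tan e_orth R_orth par u0b U(3) s0)+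
  show "\<exists>W G L U (\<phi> :: real \<times> real \<Rightarrow> complex^3) D.
           open W \<and> p \<in> W \<and> unitary_congruence G \<and>
           special_lagrangian CP CP_J L \<and> horizontal_lift U \<phi> L \<and>
           D \<subseteq> UNIV \<times> UNIV \<times> U \<and>
           immersion_on D (cone_times_line \<phi>) \<and> inj_on (cone_times_line \<phi>) D \<and>
           M \<inter> W = G ` cone_times_line \<phi> ` D"
  proof (rule C.cone_structure[OF M4 \<delta>])
    fix u a b assume "u \<in> ?O" "\<bar>a\<bar> < \<delta>" "\<bar>b\<bar> < \<delta>"
    then show "\<psi> u + a *\<^sub>R e + b *\<^sub>R C.R (\<psi> u) \<in> M"
      using seg[OF \<psi>S(3) \<psi>S(5)] \<eta>(2) unfolding C.R_def by blast
  qed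
qed

end
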